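(* Let $m,n$ be positive integers with $\gcd(m,n)=1$ and let $\mathbb{H}_{m/n}=\{(z_1,z_2)\in\mathbb{C}^2:|z_1|^{m/n}<|z_2|<1\}$. Let $2\le p<r<\infty$. Then $f\in A^p(\mathbb{H}_{m/n})$ can be approximated by functions in $A^r(\mathbb{H}_{m/n})$ in the $L^p$ norm if and only if $\widetilde{\mathbf{B}^r}f=f$.
   Context: $A^p(\Omega)$ is the Bergman space of holomorphic functions on $\Omega$ lying in $L^p(\Omega)$ (Lebesgue measure $dV$). For a bounded domain $\Omega$ and $r\ge2$, let $G^{2,r}(\Omega)$ be the closure of $A^r(\Omega)$ in $A^2(\Omega)$ (with respect to the $L^2$ norm). The $L^r$ sub-Bergman projection $\widetilde{\mathbf{B}^r}$ is the orthogonal projection of $L^2(\Omega)$ onto $G^{2,r}(\Omega)$. *)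

theory Defs
  imports "HOL-Analysis.Analysis"
begin

text \<open>
  \<open>\<complex>\<^sup>2\<close> is the type \<open>complex \<times> complex\<close>. A function on a domain \<open>\<Omega>\<close> is a total function of which
  only the values on \<open>\<Omega>\<close> matter.
\<close>

text \<open>Complex differentiability: the real Frechet derivative exists and is complex linear.\<close>

definition holomorphic2_on :: "(complex \<times> complex \<Rightarrow> complex) \<Rightarrow> (complex \<times> complex) set \<Rightarrow> bool"
  where "holomorphic2_on f \<Omega> \<longleftrightarrow>
    (\<forall>z\<in>\<Omega>. \<exists>a b. (f has_derivative (\<lambda>v. a * fst v + b * snd v)) (at z within \<Omega>))"

definition Lp_space :: "real \<Rightarrow> (complex \<times> complex) set \<Rightarrow> (complex \<times> complex \<Rightarrow> complex) set"
  where "Lp_space p \<Omega> =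
    {f. f \<in> borel_measurable (lebesgue_on \<Omega>) \<and>
        integrable (lebesgue_on \<Omega>) (\<lambda>z. cmod (f z) powr p)}"

definition Lp_norm :: "real \<Rightarrow> (complex \<times> complex) set \<Rightarrow> (complex \<times> complex \<Rightarrow> complex) \<Rightarrow> real"
  where "Lp_norm p \<Omega> f = (LINT z|lebesgue_on \<Omega>. cmod (f z) powr p) powr (1 / p)"

definition L2_inner ::
  "(complex \<times> complex) set \<Rightarrow> (complex \<times> complex \<Rightarrow> complex) \<Rightarrow> (complex \<times> complex \<Rightarrow> complex) \<Rightarrow> complex"
  where "L2_inner \<Omega> f g = (LINT z|lebesgue_on \<Omega>. f z * cnj (g z))"

definition Bergman :: "real \<Rightarrow> (complex \<times> complex) set \<Rightarrow> (complex \<times> complex \<Rightarrow> complex) set"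
  where "Bergman p \<Omega> = {f \<in> Lp_space p \<Omega>. holomorphic2_on f \<Omega>}"

definition Lp_approximable ::
  "real \<Rightarrow> (complex \<times> complex) set \<Rightarrow> (complex \<times> complex \<Rightarrow> complex) set
    \<Rightarrow> (complex \<times> complex \<Rightarrow> complex) \<Rightarrow> bool"
  where "Lp_approximable p \<Omega> S f \<longleftrightarrow> (\<forall>\<epsilon>>0. \<exists>g\<in>S. Lp_norm p \<Omega> (\<lambda>z. f z - g z) < \<epsilon>)"

text \<open>The closure of \<open>A\<^sup>r(\<Omega>)\<close> in \<open>A\<^sup>2(\<Omega>)\<close>; for bounded \<open>\<Omega>\<close> and \<open>r \<ge> 2\<close> one has \<open>A\<^sup>r(\<Omega>) \<subseteq> A\<^sup>2(\<Omega>)\<close>.\<close>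

definition sub_Bergman_space :: "real \<Rightarrow> (complex \<times> complex) set \<Rightarrow> (complex \<times> complex \<Rightarrow> complex) set"
  where "sub_Bergman_space r \<Omega> = {f \<in> Bergman 2 \<Omega>. Lp_approximable 2 \<Omega> (Bergman r \<Omega>) f}"

text \<open>
  The orthogonal projection of \<open>f \<in> L\<^sup>2(\<Omega>)\<close> onto the closed subspace above. It is determined almost
  everywhere on \<open>\<Omega>\<close>, hence, being holomorphic, everywhere on \<open>\<Omega>\<close>; the value \<open>0\<close> outside \<open>\<Omega>\<close> makes
  it unique as a total function.
\<close>

definition sub_Bergman_proj ::
  "real \<Rightarrow> (complex \<times> complex) set \<Rightarrow> (complex \<times> complex \<Rightarrow> complex) \<Rightarrow> complex \<times> complex \<Rightarrow> complex"
  where "sub_Bergman_proj r \<Omega> f =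
    (THE g. g \<in> sub_Bergman_space r \<Omega> \<and>
            (\<forall>h\<in>sub_Bergman_space r \<Omega>. L2_inner \<Omega> (\<lambda>z. f z - g z) h = 0) \<and>
            (\<forall>z. z \<notin> \<Omega> \<longrightarrow> g z = 0))"

definition Hartogs_triangle :: "real \<Rightarrow> (complex \<times> complex) set"
  where "Hartogs_triangle \<gamma> = {(z1, z2). cmod z1 powr \<gamma> < cmod z2 \<and> cmod z2 < 1}"

end

theory Submission
  imports Defs "HOL-Complex_Analysis.Complex_Analysis"
begin

text \<open>
  The circle acts on the domain by \<open>(c\<^sup>n z\<^sub>1, c\<^sup>m z\<^sub>2)\<close>, and a monomial \<open>z\<^sub>1\<^sup>a z\<^sub>2\<^sup>b\<close> has weight
  \<open>k = na + mb\<close>. The weight-\<open>k\<close> part of a holomorphic \<open>f\<close> is the \<open>k\<close>-th Fourier coefficient of \<open>f\<close> along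
  the orbits; taking it is a contraction of \<open>A\<^sup>s\<close> that is selfadjoint for \<open>s = 2\<close>. By homogeneity it vanishes on
  \<open>A\<^sup>s\<close> as soon as \<open>ks + 2(m + n) \<le> 0\<close>. Call a weight with \<open>kr + 2(m + n) \<le> 0\<close> low; all low weights vanish on
  the closure of \<open>A\<^sup>r\<close>. Conversely, if \<open>f \<in> A\<^sup>p\<close> has no low weights, Cauchy's formula along the orbits bounds \<open>f\<close>
  by a power of \<open>z\<^sub>2\<close>, so that the dilates of \<open>f\<close> lie in \<open>A\<^sup>r\<close>; they converge to \<open>f\<close> in \<open>L\<^sup>p\<close>. Hence for \<open>p\<close> as
  for \<open>2\<close> approximability means that there are no low weights, and the projection subtracts the
  finitely many low weight parts that occur in \<open>A\<^sup>2\<close>.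
\<close>

section \<open>Complex linear changes of variables\<close>

text \<open>Approximability passes from L^p down to L^2 by itself because \<open>H\<close> has
  finite volume. The way back is the obstacle: L^2 approximants say nothing about the L^p norm when
  p > 2. The criterion by low weights gets around this because it refers to r alone and not to the
  exponent in which one approximates. The number 2(m + n) is the exponent of the Jacobian: (c^n z1,
  c^m z2) multiplies volume by |c|^(2(m + n)), so for 0 < c \<le> 1 the integral of the s-th power
  of a weight-k function over the image of \<open>H\<close> is c^(ks + 2(m + n)) times the integral
  over \<open>H\<close>. One circle suffices in place of the two-dimensional torus: all monomials of
  equal weight scale alike, hence are integrable to the same powers, and need not be separated.
  Moreover c need not be unimodular. Every orbit in \<open>H\<close> is parametrised by a punctured
  disc of radius greater than 1, and the weight parts are the Laurent coefficients there. Norm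
  estimates and orthogonality relations for weight parts are obtained for finite averages over
  equally spaced rotations and then passed to the limit.\<close>

lemma lborel_complex_eq_distr:
  "(lborel :: complex measure) = distr (lborel :: (real^2) measure) borel (\<lambda>v. Complex (v$1) (v$2))"
proof (rule lborel_eqI)
  have meas [measurable]: "(\<lambda>v::real^2. Complex (v$1) (v$2)) \<in> borel_measurable borel"
    by (intro borel_measurable_continuous_onI) (simp add: Complex_eq, intro continuous_intros)
  fix l u :: complex
  assume lu: "\<And>b. b \<in> Basis \<Longrightarrow> l \<bullet> b \<le> u \<bullet> b"
  have le: "Re l \<le> Re u" "Im l \<le> Im u"
    using lu[of 1] lu[of \<i>] by (auto simp: Basis_complex_def)
  have pre: "(\<lambda>v::real^2. Complex (v$1) (v$2)) -` box l u
      = box (vector [Re l, Im l]) (vector [Re u, Im u])"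
    by (auto simp: box_def Basis_complex_def Basis_vec_def inner_axis forall_2)
  have B: "(Basis :: (real^2) set) = {axis 1 1, axis 2 1}" "axis 1 1 \<noteq> (axis 2 1 :: real^2)"
    by (auto simp: Basis_vec_def UNIV_2 axis_eq_axis)
  show "emeasure (distr lborel borel (\<lambda>v::real^2. Complex (v $ 1) (v $ 2))) (box l u) =
      ennreal (\<Prod>b\<in>Basis. (u - l) \<bullet> b)"
    using le by (simp add: emeasure_distr pre emeasure_lborel_box_eq B inner_axis inner_diff_left
        Basis_complex_def)
qed simp

text \<open>The determinant rule for linear images is applied on \<open>real^2\<close>: there
  \<open>T\<close> is multiplication by 1/c, with determinant |1/c|^2. Preimages of boxes are the
  form in which \<open>lborel_eqI\<close> tests equality of measures.\<close>

lemma emeasure_lborel_complex_vimage_mult: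
  fixes c :: complex
  assumes c: "c \<noteq> 0"
  shows "ennreal ((cmod c)\<^sup>2) * emeasure lborel ((*) c -` box l u) = emeasure lborel (box l u)"
proof -
  define V where "V = (\<lambda>z. vector [Re z, Im z] :: real^2)"
  define C where "C = (\<lambda>v::real^2. Complex (v$1) (v$2))"
  define d where "d = inverse c"
  define T where "T = (\<lambda>v. V (d * C v))"
  have meas [measurable]: "C \<in> borel_measurable borel"
    unfolding C_def by (intro borel_measurable_continuous_onI) (simp add: Complex_eq, intro continuous_intros)
  have VC: "V (C v) = v" "C (V z) = z" for v z
    by (auto simp: V_def C_def vec_eq_iff forall_2 complex_eq_iff)
  have em: "emeasure lborel S = emeasure lborel (C -` S)" if "S \<in> sets borel" for S
    using that by (subst lborel_complex_eq_distr) (simp add: emeasure_distr C_def[symmetric])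
  have lin: "linear T"
    by (rule linearI) (auto simp: T_def V_def C_def vec_eq_iff forall_2 algebra_simps)
  have det: "det (matrix T) = (cmod d)\<^sup>2"
    unfolding cmod_power2 by (simp add: det_2 matrix_def T_def V_def C_def axis_def power2_eq_square)
  have op: "open ((*) c -` box l u)"
    by (intro open_vimage continuous_intros) auto
  have img: "C -` ((*) c -` box l u) = T ` (C -` box l u)"
  proof (intro set_eqI iffI)
    fix v assume "v \<in> C -` ((*) c -` box l u)"
    then have "V (c * C v) \<in> C -` box l u" "v = T (V (c * C v))"
      using c by (auto simp: T_def VC d_def mult.assoc[symmetric])
    then show "v \<in> T ` (C -` box l u)" by blast
  next
    fix v assume "v \<in> T ` (C -` box l u)"
    then show "v \<in> C -` ((*) c -` box l u)"
      using c by (auto simp: T_def VC d_def mult.assoc[symmetric])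
  qed
  have fin: "emeasure lborel (box l u) \<noteq> \<infinity>"
    by (simp add: emeasure_lborel_box_eq)
  have bl: "C -` box l u \<in> sets borel"
    using measurable_sets[OF meas, of "box l u"] by simp
  have bl2: "C -` ((*) c -` box l u) \<in> sets borel"
    using measurable_sets[OF meas, of "((*) c -` box l u)"] op by simp
  have lm: "C -` box l u \<in> lmeasurable"
    using fin em[of "box l u"] bl
    by (simp add: fmeasurable_def less_top[symmetric] )
  have "measure lebesgue (T ` (C -` box l u)) = (cmod d)\<^sup>2 * measure lebesgue (C -` box l u)"
    using measure_linear_image[OF lin lm] det by simp
  moreover have "T ` (C -` box l u) \<in> lmeasurable"
    using measurable_linear_image[OF lin lm] .
  ultimately have "emeasure lebesgue (T ` (C -` box l u)) = ennreal ((cmod d)\<^sup>2) * emeasure lebesgue (C -` box l u)"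
    using lm by (simp add: emeasure_eq_measure2 ennreal_mult')
  then have "emeasure lborel ((*) c -` box l u) = ennreal ((cmod d)\<^sup>2) * emeasure lborel (box l u)"
    using bl bl2 op by (simp add: em img[symmetric])
  then show ?thesis
    using c by (simp add: mult.assoc[symmetric] ennreal_mult'[symmetric] d_def norm_inverse power_mult_distrib[symmetric])
qed

lemma lborel_complex_affine:
  fixes c :: complex
  assumes "c \<noteq> 0"
  shows "(lborel :: complex measure) = density (distr lborel borel ((*) c)) (\<lambda>_. ennreal ((cmod c)\<^sup>2))"
proof (rule lborel_eqI)
  fix l u :: complex
  assume lu: "\<And>b. b \<in> Basis \<Longrightarrow> l \<bullet> b \<le> u \<bullet> b"
  have "emeasure (density (distr lborel borel ((*) c)) (\<lambda>_. ennreal ((cmod c)\<^sup>2))) (box l u)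
      = ennreal ((cmod c)\<^sup>2) * emeasure lborel ((*) c -` box l u)"
    by (simp add: emeasure_density nn_integral_cmult emeasure_distr)
  also have "\<dots> = emeasure lborel (box l u)"
    by (rule emeasure_lborel_complex_vimage_mult[OF assms])
  also have "\<dots> = ennreal (\<Prod>b\<in>Basis. (u - l) \<bullet> b)"
    using lu by (simp add: emeasure_lborel_box_eq)
  finally show "emeasure (density (distr lborel borel ((*) c)) (\<lambda>_. ennreal ((cmod c)\<^sup>2))) (box l u)
     = ennreal (\<Prod>b\<in>Basis. (u - l) \<bullet> b)" .
qed simp

lemma nn_integral_complex_mult:
  fixes c :: complex
  assumes "c \<noteq> 0" and [measurable]: "F \<in> borel_measurable borel"
  shows "ennreal ((cmod c)\<^sup>2) * (\<integral>\<^sup>+z. F (c * z) \<partial>lborel) = (\<integral>\<^sup>+z. F z \<partial>lborel)"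
  by (subst (2) lborel_complex_affine[OF assms(1)])
     (simp add: nn_integral_density nn_integral_distr nn_integral_cmult)

text \<open>Tonelli's theorem reduces this to one coordinate at a time. Rotation invariance, the
  homogeneity estimates and the bound for dilates are all instances of this formula.\<close>

lemma nn_integral_complex_diagonal:
  fixes a b :: complex and F :: "complex \<times> complex \<Rightarrow> ennreal"
  assumes ab: "a \<noteq> 0" "b \<noteq> 0" and [measurable]: "F \<in> borel_measurable borel"
  shows "ennreal ((cmod a)\<^sup>2 * (cmod b)\<^sup>2) * (\<integral>\<^sup>+z. F (a * fst z, b * snd z) \<partial>lborel) = (\<integral>\<^sup>+z. F z \<partial>lborel)"
proof -
  have [measurable]: "(\<lambda>z::complex \<times> complex. (a * fst z, b * snd z)) \<in> borel_measurable borel"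
    by (intro borel_measurable_continuous_onI continuous_intros)
  have meas: "(\<lambda>z. F (a * fst z, b * snd z)) \<in> borel_measurable (lborel \<Otimes>\<^sub>M lborel)"
    by (simp add: lborel_prod)
  have F2: "F \<in> borel_measurable (lborel \<Otimes>\<^sub>M lborel)"
    by (simp add: lborel_prod)
  have [measurable]: "(\<lambda>x. \<integral>\<^sup>+y. F (x, y) \<partial>lborel) \<in> borel_measurable borel"
    using lborel.borel_measurable_nn_integral_fst[OF F2] by simp
  have [measurable]: "(\<lambda>x. \<integral>\<^sup>+y. F (a * x, b * y) \<partial>lborel) \<in> borel_measurable borel"
    using lborel.borel_measurable_nn_integral_fst[OF meas] by simp
  have "(\<integral>\<^sup>+z. F z \<partial>lborel) = (\<integral>\<^sup>+x. \<integral>\<^sup>+y. F (x, y) \<partial>lborel \<partial>lborel)"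
    using lborel.nn_integral_fst[OF F2] by (simp add: lborel_prod)
  also have "\<dots> = ennreal ((cmod a)\<^sup>2) * (\<integral>\<^sup>+x. \<integral>\<^sup>+y. F (a * x, y) \<partial>lborel \<partial>lborel)"
    by (rule nn_integral_complex_mult[symmetric, OF ab(1)]) simp
  also have "(\<integral>\<^sup>+x. \<integral>\<^sup>+y. F (a * x, y) \<partial>lborel \<partial>lborel)
      = (\<integral>\<^sup>+x. ennreal ((cmod b)\<^sup>2) * (\<integral>\<^sup>+y. F (a * x, b * y) \<partial>lborel) \<partial>lborel)"
  proof (intro nn_integral_cong)
    fix x show "(\<integral>\<^sup>+y. F (a * x, y) \<partial>lborel) = ennreal ((cmod b)\<^sup>2) * (\<integral>\<^sup>+y. F (a * x, b * y) \<partial>lborel)"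
      by (rule nn_integral_complex_mult[symmetric, OF ab(2)]) measurable
  qed
  also have "\<dots> = ennreal ((cmod b)\<^sup>2) * (\<integral>\<^sup>+x. (\<integral>\<^sup>+y. F (a * x, b * y) \<partial>lborel) \<partial>lborel)"
    by (rule nn_integral_cmult) simp
  also have "(\<integral>\<^sup>+x. (\<integral>\<^sup>+y. F (a * x, b * y) \<partial>lborel) \<partial>lborel) = (\<integral>\<^sup>+z. F (a * fst z, b * snd z) \<partial>lborel)"
    using lborel.nn_integral_fst[OF meas] by (simp add: lborel_prod)
  finally show ?thesis
    by (simp add: ennreal_mult' mult.assoc)
qed

section \<open>Holomorphic functions of one and two variables\<close>

lemma holomorphic2_on_imp_continuous_on:
  assumes "holomorphic2_on f S"
  shows "continuous_on S f"
  unfolding continuous_on_eq_continuous_within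
  using assms has_derivative_continuous unfolding holomorphic2_on_def by blast

lemma holomorphic_on_compose_holomorphic2:
  assumes f: "holomorphic2_on f S" and "open S" "open A"
    and g: "g1 holomorphic_on A" "g2 holomorphic_on A"
    and mem: "\<And>x. x \<in> A \<Longrightarrow> (g1 x, g2 x) \<in> S"
  shows "(\<lambda>x. f (g1 x, g2 x)) holomorphic_on A"
  unfolding holomorphic_on_def
proof
  fix x assume x: "x \<in> A"
  obtain a b where "(f has_derivative (\<lambda>v. a * fst v + b * snd v)) (at (g1 x, g2 x) within S)"
    using f mem[OF x] unfolding holomorphic2_on_def by blast
  then have D: "(f has_derivative (\<lambda>v. a * fst v + b * snd v)) (at (g1 x, g2 x))"
    by (simp only: at_within_open[OF mem[OF x] \<open>open S\<close>])
  obtain d1 d2 where "(g1 has_field_derivative d1) (at x)" "(g2 has_field_derivative d2) (at x)"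
    using g x \<open>open A\<close> by (meson holomorphic_derivI)
  then have "((\<lambda>x. (g1 x, g2 x)) has_derivative (\<lambda>h. (d1 * h, d2 * h))) (at x)"
    by (intro has_derivative_Pair) (simp_all add: has_field_derivative_def)
  from has_derivative_compose[OF this D]
  have "((\<lambda>x. f (g1 x, g2 x)) has_derivative (\<lambda>h. a * (d1 * h) + b * (d2 * h))) (at x)"
    by simp
  then have "((\<lambda>x. f (g1 x, g2 x)) has_field_derivative (a * d1 + b * d2)) (at x)"
    unfolding has_field_derivative_def by (rule has_derivative_eq_rhs) (simp add: fun_eq_iff algebra_simps)
  then show "(\<lambda>x. f (g1 x, g2 x)) field_differentiable at x within A"
    using field_differentiable_at_within field_differentiable_def by blast
qed

lemma holomorphic2_on_cong:
  assumes "holomorphic2_on f S" "\<And>z. z \<in> S \<Longrightarrow> f z = g z"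
  shows "holomorphic2_on g S"
  unfolding holomorphic2_on_def
proof
  fix z assume z: "z \<in> S"
  obtain a b where "(f has_derivative (\<lambda>v. a * fst v + b * snd v)) (at z within S)"
    using assms(1) z unfolding holomorphic2_on_def by blast
  then have "(g has_derivative (\<lambda>v. a * fst v + b * snd v)) (at z within S)"
    by (rule has_derivative_transform[OF z, rotated]) (simp add: assms(2))
  then show "\<exists>a b. (g has_derivative (\<lambda>v. a * fst v + b * snd v)) (at z within S)" by blast
qed

lemma holomorphic2_on_diff:
  assumes "holomorphic2_on f S" "holomorphic2_on g S"
  shows "holomorphic2_on (\<lambda>z. f z - g z) S"
  unfolding holomorphic2_on_def
proof
  fix z assume z: "z \<in> S"
  obtain a b where D1: "(f has_derivative (\<lambda>v. a * fst v + b * snd v)) (at z within S)"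
    using assms(1) z unfolding holomorphic2_on_def by blast
  obtain a' b' where D2: "(g has_derivative (\<lambda>v. a' * fst v + b' * snd v)) (at z within S)"
    using assms(2) z unfolding holomorphic2_on_def by blast
  have "((\<lambda>z. f z - g z) has_derivative (\<lambda>v. (a - a') * fst v + (b - b') * snd v)) (at z within S)"
    using has_derivative_diff[OF D1 D2] by (rule has_derivative_eq_rhs) (simp add: fun_eq_iff algebra_simps)
  then show "\<exists>a b. ((\<lambda>z. f z - g z) has_derivative (\<lambda>v. a * fst v + b * snd v)) (at z within S)"
    by blast
qed

lemma holomorphic2_on_diagonal:
  assumes f: "holomorphic2_on f S" and "open S"
    and mem: "\<And>z. z \<in> S \<Longrightarrow> (a * fst z, b * snd z) \<in> S"
  shows "holomorphic2_on (\<lambda>z. f (a * fst z, b * snd z)) S"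
  unfolding holomorphic2_on_def
proof
  fix z assume z: "z \<in> S"
  obtain c d where "(f has_derivative (\<lambda>v. c * fst v + d * snd v)) (at (a * fst z, b * snd z) within S)"
    using f mem[OF z] unfolding holomorphic2_on_def by blast
  then have D: "(f has_derivative (\<lambda>v. c * fst v + d * snd v)) (at (a * fst z, b * snd z))"
    by (simp only: at_within_open[OF mem[OF z] \<open>open S\<close>])
  have "((\<lambda>z::complex \<times> complex. (a * fst z, b * snd z)) has_derivative (\<lambda>v. (a * fst v, b * snd v))) (at z within S)"
    by (auto intro!: derivative_eq_intros)
  from has_derivative_compose[OF this D]
  have "((\<lambda>z. f (a * fst z, b * snd z)) has_derivative (\<lambda>v. (c * a) * fst v + (d * b) * snd v)) (at z within S)"
    by (simp add: mult.assoc)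
  then show "\<exists>c d. ((\<lambda>z. f (a * fst z, b * snd z)) has_derivative (\<lambda>v. c * fst v + d * snd v)) (at z within S)"
    by blast
qed

text \<open>The easy half of Hartogs' theorem (Osgood's lemma). The error of the linear
  approximation splits into two one-variable errors and the increment of
  \<open>f (x, v) - f (a, v)\<close> between \<open>v = b\<close> and \<open>v = y\<close>. That
  difference is uniformly small by continuity, and Cauchy's inequality makes its derivative small,
  so the increment is small relative to \<open>y - b\<close>.\<close>

lemma holomorphic2_on_if_separately_holomorphic:
  fixes f :: "complex \<times> complex \<Rightarrow> complex"
  assumes op: "open S" and cont: "continuous_on S f"
    and hol1: "\<And>y. (\<lambda>x. f (x, y)) holomorphic_on {x. (x, y) \<in> S}"
    and hol2: "\<And>x. (\<lambda>y. f (x, y)) holomorphic_on {y. (x, y) \<in> S}"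
  shows "holomorphic2_on f S"
  unfolding holomorphic2_on_def
proof
  fix z assume z: "z \<in> S"
  obtain a b where zab: "z = (a, b)" by (cases z)
  have open1: "open {x. (x, y) \<in> S}" for y
    using open_vimage[OF op, of "\<lambda>x. (x, y)"] by (simp add: vimage_def continuous_intros)
  have open2: "open {y. (x, y) \<in> S}" for x
    using open_vimage[OF op, of "\<lambda>y. (x, y)"] by (simp add: vimage_def continuous_intros)
  obtain d1 where d1: "((\<lambda>x. f (x, b)) has_field_derivative d1) (at a)"
    using hol1[of b] z open1[of b] by (auto simp: zab intro: holomorphic_derivI)
  obtain d2 where d2: "((\<lambda>y. f (a, y)) has_field_derivative d2) (at b)"
    using hol2[of a] z open2[of a] by (auto simp: zab intro: holomorphic_derivI)
  obtain e where e: "e > 0" "cball z e \<subseteq> S"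
    using op z open_contains_cball by blast
  define s where "s = e / 2"
  have s: "s > 0" using e by (simp add: s_def)
  have sub: "cball a s \<times> cball b s \<subseteq> S"
  proof -
    have "(x, y) \<in> cball z e" if "dist a x \<le> s" "dist b y \<le> s" for x y
      using that sqrt_sum_squares_le_sum[of "dist a x" "dist b y"]
      by (auto simp: zab dist_prod_def s_def)
    then show ?thesis using e by auto
  qed
  have unif: "uniformly_continuous_on (cball a s \<times> cball b s) f"
    by (intro compact_uniformly_continuous continuous_on_subset[OF cont sub] compact_Times compact_cball)
  have "(f has_derivative (\<lambda>v. d1 * fst v + d2 * snd v)) (at z)"
    unfolding has_derivative_at_alt
  proof (intro conjI allI impI)
    show "bounded_linear (\<lambda>v. d1 * fst v + d2 * snd v)"
      by (intro bounded_linear_intros)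
    fix \<epsilon> :: real assume \<epsilon>: "\<epsilon> > 0"
    define \<eta> where "\<eta> = \<epsilon> / 3"
    have \<eta>: "\<eta> > 0" using \<epsilon> by (simp add: \<eta>_def)
    obtain r1 where r1: "r1 > 0"
      "\<And>x. norm (x - a) < r1 \<Longrightarrow> norm (f (x, b) - f (a, b) - d1 * (x - a)) \<le> \<eta> * norm (x - a)"
      using d1 \<eta> unfolding has_field_derivative_def has_derivative_at_alt by blast
    obtain r2 where r2: "r2 > 0"
      "\<And>y. norm (y - b) < r2 \<Longrightarrow> norm (f (a, y) - f (a, b) - d2 * (y - b)) \<le> \<eta> * norm (y - b)"
      using d2 \<eta> unfolding has_field_derivative_def has_derivative_at_alt by blast
    \<comment> \<open>Cauchy's inequality on discs of radius \<open>s / 2\<close> turns the bound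
      \<delta> for \<open>D\<close> into the bound \<open>\<delta> / (s / 2) = \<eta>\<close> for
      its derivative.\<close>
    define \<delta> where "\<delta> = \<eta> * s / 2"
    have "\<delta> > 0" using \<eta> s by (simp add: \<delta>_def)
    with unif obtain r3 where r3: "r3 > 0"
      "\<And>u v. u \<in> cball a s \<times> cball b s \<Longrightarrow> v \<in> cball a s \<times> cball b s \<Longrightarrow> dist v u < r3 \<Longrightarrow> dist (f v) (f u) < \<delta>"
      unfolding uniformly_continuous_on_def by meson
    define r where "r = min (min r1 r2) (min r3 (s / 2))"
    have r: "r > 0" "r \<le> r1" "r \<le> r2" "r \<le> r3" "r \<le> s / 2" using r1 r2 r3 s by (auto simp: r_def)
    show "\<exists>d>0. \<forall>w. norm (w - z) < d \<longrightarrow>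
        norm (f w - f z - (d1 * fst (w - z) + d2 * snd (w - z))) \<le> \<epsilon> * norm (w - z)"
    proof (intro exI[of _ r] conjI allI impI)
      fix w assume w: "norm (w - z) < r"
      obtain x y where wxy: "w = (x, y)" by (cases w)
      have nx: "norm (x - a) \<le> norm (w - z)" "norm (y - b) \<le> norm (w - z)"
        using norm_fst_le[of "x - a" "y - b"] norm_snd_le[of "y - b" "x - a"] by (simp_all add: wxy zab)
      have xs: "norm (x - a) < s" "norm (y - b) < s / 2" using nx w r s by linarith+
      define D where "D = (\<lambda>v. f (x, v) - f (a, v))"
      have xc: "x \<in> cball a s" using xs by (simp add: dist_norm norm_minus_commute)
      have subx: "ball b s \<subseteq> {v. (x, v) \<in> S}" "ball b s \<subseteq> {v. (a, v) \<in> S}"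
        using sub xc s by (auto simp: subset_iff)
      have holD: "D holomorphic_on ball b s"
        unfolding D_def by (intro holomorphic_intros holomorphic_on_subset[OF hol2] subx)
      have Dle: "norm (D v) \<le> \<delta>" if "v \<in> cball b s" for v
      proof -
        have "dist (x, v) (a, v) < r3"
          using nx w r by (simp add: dist_prod_def dist_norm)
        then show ?thesis
          using r3(2)[of "(a, v)" "(x, v)"] xc s that by (simp add: D_def dist_norm)
      qed
      have der: "norm (deriv D v) \<le> \<eta>" if v: "v \<in> ball b (s / 2)" for v
      proof -
        have sub': "cball v (s / 2) \<subseteq> ball b s"
        proof
          fix u assume "u \<in> cball v (s / 2)"
          then show "u \<in> ball b s"
            using v dist_triangle[of b u v] by (simp add: dist_commute)
        qed
        have "norm ((deriv ^^ 1) D v) \<le> fact 1 * \<delta> / (s / 2) ^ 1"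
        proof (rule Cauchy_inequality)
          show "D holomorphic_on ball v (s / 2)"
            using sub' by (intro holomorphic_on_subset[OF holD]) auto
          show "continuous_on (cball v (s / 2)) D"
            using holomorphic_on_imp_continuous_on[OF holomorphic_on_subset[OF holD sub']] .
          show "0 < s / 2" using s by simp
          fix u assume "norm (v - u) = s / 2"
          then have "u \<in> ball b s" using sub' by (auto simp: dist_norm)
          then show "norm (D u) \<le> \<delta>" using Dle by simp
        qed
        then show ?thesis using s by (simp add: \<delta>_def)
      qed
      have "norm (D y - D b) \<le> \<eta> * norm (y - b)"
      proof (rule field_differentiable_bound[of "ball b (s/2)" D "deriv D"])
        fix v assume v: "v \<in> ball b (s / 2)"
        then have "v \<in> ball b s" using s by simp
        then show "(D has_field_derivative deriv D v) (at v within ball b (s / 2))"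
          using holomorphic_derivI[OF holD open_ball] has_field_derivative_at_within by blast
        show "norm (deriv D v) \<le> \<eta>" by (rule der[OF v])
      qed (use xs s in \<open>auto simp: dist_norm norm_minus_commute\<close>)
      moreover have "norm (f (x, b) - f (a, b) - d1 * (x - a)) \<le> \<eta> * norm (x - a)"
        using r1 nx w r by simp
      moreover have "norm (f (a, y) - f (a, b) - d2 * (y - b)) \<le> \<eta> * norm (y - b)"
        using r2 nx w r by simp
      moreover have eq: "f w - f z - (d1 * fst (w - z) + d2 * snd (w - z))
        = (D y - D b) + (f (x, b) - f (a, b) - d1 * (x - a)) + (f (a, y) - f (a, b) - d2 * (y - b))"
        by (simp add: D_def wxy zab)
      moreover have "\<eta> * norm (y - b) \<le> \<eta> * norm (w - z)" "\<eta> * norm (x - a) \<le> \<eta> * norm (w - z)"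
        using nx \<eta> by auto
      moreover have "norm ((D y - D b) + (f (x, b) - f (a, b) - d1 * (x - a)) + (f (a, y) - f (a, b) - d2 * (y - b)))
        \<le> norm (D y - D b) + norm (f (x, b) - f (a, b) - d1 * (x - a)) + norm (f (a, y) - f (a, b) - d2 * (y - b))"
        by (intro norm_triangle_le add_mono order_refl)
      moreover have "\<eta> * norm (w - z) = \<epsilon> * norm (w - z) / 3" by (simp add: \<eta>_def)
      ultimately show "norm (f w - f z - (d1 * fst (w - z) + d2 * snd (w - z))) \<le> \<epsilon> * norm (w - z)"
        unfolding eq by linarith
    qed (use r in auto)
  qed
  then show "\<exists>a b. (f has_derivative (\<lambda>v. a * fst v + b * snd v)) (at z within S)"
    using has_derivative_at_withinI by blast
qed

section \<open>Contour integrals depending on a parameter\<close>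

lemma continuous_on_contour_integral_param:
  fixes H :: "'a::topological_space \<Rightarrow> complex \<Rightarrow> complex"
  assumes H: "continuous_on (U \<times> path_image g) (\<lambda>(z, \<zeta>). H z \<zeta>)"
    and g: "path g" "continuous_on {0..1} (\<lambda>t. vector_derivative g (at t))"
  shows "continuous_on U (\<lambda>z. contour_integral g (H z))"
proof -
  have "continuous_on (U \<times> cbox 0 (1::real)) (\<lambda>(z, t). H z (g t) * vector_derivative g (at t))"
  proof -
    have c1: "continuous_on (U \<times> {0..1}) (\<lambda>x. (fst x, g (snd x)))"
      using g(1) unfolding path_def
      by (intro continuous_intros continuous_on_compose2[of "{0..1}" g _ snd]) auto
    have "continuous_on (U \<times> {0..1}) (\<lambda>x. (\<lambda>(z, \<zeta>). H z \<zeta>) (fst x, g (snd x)))"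
      by (rule continuous_on_compose2[OF H c1]) (auto simp: path_image_def)
    moreover have "continuous_on (U \<times> {0..1}) (\<lambda>x. vector_derivative g (at (snd x)))"
      by (intro continuous_on_compose2[OF g(2), of _ snd] continuous_intros) auto
    ultimately show ?thesis
      by (auto simp: case_prod_unfold intro!: continuous_intros)
  qed
  then have "continuous_on U (\<lambda>z. integral (cbox 0 1) (\<lambda>t. H z (g t) * vector_derivative g (at t)))"
    by (rule integral_continuous_on_param)
  then show ?thesis by (simp add: contour_integral_integral)
qed

text \<open>Morera's theorem: joint continuity allows the integral over a triangle in
  \<open>z\<close> to be exchanged with the integral over the circle, and the inner triangle
  integral then vanishes by Cauchy's theorem for each fixed \<zeta>.\<close>

lemma holomorphic_on_contour_integral_circlepath:
  fixes H :: "complex \<Rightarrow> complex \<Rightarrow> complex"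
  assumes "open U" and H: "continuous_on (U \<times> sphere 0 1) (\<lambda>(z, \<zeta>). H z \<zeta>)"
    and hol: "\<And>\<zeta>. \<zeta> \<in> sphere 0 1 \<Longrightarrow> (\<lambda>z. H z \<zeta>) holomorphic_on U"
  shows "(\<lambda>z. contour_integral (circlepath 0 1) (H z)) holomorphic_on U"
proof -
  have cvd: "continuous_on {0..1} (\<lambda>t. vector_derivative (circlepath 0 1) (at t))"
    unfolding vector_derivative_circlepath by (intro continuous_intros)
  have lvd: "continuous_on {0..1} (\<lambda>t. vector_derivative (linepath a b) (at t))" for a b :: complex
    by (simp add: continuous_intros)
  have "(\<lambda>z. contour_integral (circlepath 0 1) (H z)) analytic_on U"
  proof (rule Morera_triangle)
    show "continuous_on U (\<lambda>z. contour_integral (circlepath 0 1) (H z))"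
      by (rule continuous_on_contour_integral_param) (use H cvd in \<open>auto simp: path_image_circlepath\<close>)
    show "open U" by fact
    fix a b c
    show "convex hull {a, b, c} \<subseteq> U \<longrightarrow>
       contour_integral (linepath a b) (\<lambda>z. contour_integral (circlepath 0 1) (H z)) +
       contour_integral (linepath b c) (\<lambda>z. contour_integral (circlepath 0 1) (H z)) +
       contour_integral (linepath c a) (\<lambda>z. contour_integral (circlepath 0 1) (H z)) = 0"
    proof
      assume tri: "convex hull {a, b, c} \<subseteq> U"
      have segs: "closed_segment a b \<subseteq> U" "closed_segment b c \<subseteq> U" "closed_segment c a \<subseteq> U"
        using tri hull_mono[of "{a, b}" "{a, b, c}" convex] hull_mono[of "{b, c}" "{a, b, c}" convex]
          hull_mono[of "{c, a}" "{a, b, c}" convex] by (auto simp: segment_convex_hull)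
      have swap: "contour_integral (linepath x y) (\<lambda>z. contour_integral (circlepath 0 1) (H z))
          = contour_integral (circlepath 0 1) (\<lambda>\<zeta>. contour_integral (linepath x y) (\<lambda>z. H z \<zeta>))"
        if "closed_segment x y \<subseteq> U" for x y
        by (rule contour_integral_swap)
          (use that lvd cvd in \<open>auto intro!: continuous_on_subset[OF H] simp: path_image_circlepath\<close>)
      have integ: "(\<lambda>\<zeta>. contour_integral (linepath x y) (\<lambda>z. H z \<zeta>)) contour_integrable_on circlepath 0 1"
        if "closed_segment x y \<subseteq> U" for x y
      proof (rule contour_integrable_continuous_circlepath)
        have "continuous_on (sphere 0 1 \<times> closed_segment x y) (\<lambda>p. (\<lambda>(z, \<zeta>). H z \<zeta>) (prod.swap p))"
          by (intro continuous_on_compose2[OF H] continuous_on_swap) (use that in auto)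
        then show "continuous_on (path_image (circlepath 0 1)) (\<lambda>\<zeta>. contour_integral (linepath x y) (\<lambda>z. H z \<zeta>))"
          by (intro continuous_on_contour_integral_param lvd)
             (auto simp: path_image_circlepath case_prod_unfold prod.swap_def)
      qed
      have "contour_integral (linepath a b) (\<lambda>z. contour_integral (circlepath 0 1) (H z)) +
       contour_integral (linepath b c) (\<lambda>z. contour_integral (circlepath 0 1) (H z)) +
       contour_integral (linepath c a) (\<lambda>z. contour_integral (circlepath 0 1) (H z))
       = contour_integral (circlepath 0 1) (\<lambda>\<zeta>. contour_integral (linepath a b) (\<lambda>z. H z \<zeta>)
         + contour_integral (linepath b c) (\<lambda>z. H z \<zeta>) + contour_integral (linepath c a) (\<lambda>z. H z \<zeta>))"
        using segs by (simp add: swap integ contour_integral_add contour_integrable_add)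
      also have "\<dots> = contour_integral (circlepath 0 1) (\<lambda>\<zeta>. 0)"
      proof (rule contour_integral_eq)
        fix \<zeta> assume "\<zeta> \<in> path_image (circlepath 0 1)"
        then have "(\<lambda>z. H z \<zeta>) holomorphic_on convex hull {a, b, c}"
          using hol tri by (auto simp: path_image_circlepath intro: holomorphic_on_subset)
        then show "contour_integral (linepath a b) (\<lambda>z. H z \<zeta>) + contour_integral (linepath b c) (\<lambda>z. H z \<zeta>)
          + contour_integral (linepath c a) (\<lambda>z. H z \<zeta>) = 0"
          by (metis Cauchy_theorem_triangle has_chain_integral_chain_integral3)
      qed
      finally show "contour_integral (linepath a b) (\<lambda>z. contour_integral (circlepath 0 1) (H z)) +
       contour_integral (linepath b c) (\<lambda>z. contour_integral (circlepath 0 1) (H z)) +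
       contour_integral (linepath c a) (\<lambda>z. contour_integral (circlepath 0 1) (H z)) = 0" by simp
    qed
  qed
  then show ?thesis by (rule analytic_imp_holomorphic)
qed

section \<open>Laurent coefficients on a punctured disc\<close>

lemma contour_integral_circlepath_radius:
  assumes "h holomorphic_on ball 0 R - {0}" "0 < r" "r < R" "0 < r'" "r' < R"
  shows "contour_integral (circlepath 0 r) h = contour_integral (circlepath 0 r') h"
proof -
  have "(h has_contour_integral 2 * pi * \<i> * residue h 0) (circlepath 0 s)" if "0 < s" "s < R" for s
    by (rule base_residue[OF open_ball, of 0 0 R]) (use assms(1) that in auto)
  then show ?thesis using assms(2-) by (metis contour_integral_unique)
qed

text \<open>The principal part of the Laurent expansion at the origin vanishes, so Cauchy's formula on the
  unit circle still represents \<open>h\<close> on the punctured disc.\<close>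

lemma bound_of_vanishing_principal_part:
  assumes h: "h holomorphic_on ball 0 R - {0}" and R: "R > 1"
    and van: "\<And>j. contour_integral (circlepath 0 1) (\<lambda>\<xi>. h \<xi> * \<xi> ^ j) = 0"
    and M: "\<And>\<xi>. cmod \<xi> = 1 \<Longrightarrow> cmod (h \<xi>) \<le> M"
    and w: "w \<noteq> 0" "cmod w < 1"
  shows "cmod (h w) \<le> M / (1 - cmod w)"
proof -
  define S where "S = ball 0 R - {0::complex}"
  have S: "open S" "h holomorphic_on S" using h by (auto simp: S_def)
  \<comment> \<open>A circle strictly inside \<open>w\<close>, on which \<open>\<xi> / w\<close> has
    modulus exactly 1/2.\<close>
  define \<epsilon> where "\<epsilon> = cmod w / 2"
  have \<epsilon>: "0 < \<epsilon>" "\<epsilon> < cmod w" "\<epsilon> < 1" using w by (auto simp: \<epsilon>_def)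
  define q where "q = (\<lambda>\<xi>. if \<xi> = w then deriv h w else (h \<xi> - h w) / (\<xi> - w))"
  have q: "q holomorphic_on ball 0 R - {0}"
    using pole_lemma_open[OF S(2,1)] by (simp add: q_def S_def)
  have on_circle: "continuous_on (path_image (circlepath 0 r)) (\<lambda>\<xi>. h \<xi> * g \<xi> / (\<xi> - w))"
    "continuous_on (path_image (circlepath 0 r)) (\<lambda>\<xi>. h w / (\<xi> - w))"
    if "0 < r" "r < R" "r \<noteq> cmod w" "continuous_on UNIV g" for r g
    using that by (auto intro!: continuous_intros continuous_on_subset[OF holomorphic_on_imp_continuous_on[OF S(2)]]
        continuous_on_subset[OF that(4)] simp: S_def)
  \<comment> \<open>The inner Cauchy integral \<open>J 0\<close> is shown to vanish. Raising
    \<open>N\<close> changes \<open>J N\<close> by a multiple of the moment of \<open>h\<close>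
    against \<open>\<xi> ^ N\<close>, which is zero by \<open>van\<close>; so all \<open>J N\<close>
    agree, while the factor \<open>(\<xi> / w) ^ N\<close> forces them to tend to 0.\<close>
  define J where "J = (\<lambda>N. contour_integral (circlepath 0 \<epsilon>) (\<lambda>\<xi>. h \<xi> * (\<xi> / w) ^ N / (\<xi> - w)))"
  have integJ: "(\<lambda>\<xi>. h \<xi> * (\<xi> / w) ^ N / (\<xi> - w)) contour_integrable_on circlepath 0 \<epsilon>" for N
    by (rule contour_integrable_continuous_circlepath, rule on_circle)
       (use \<epsilon> R w in \<open>auto intro!: continuous_intros\<close>)
  have step: "J N = J (Suc N)" for N
  proof -
    have "J N - J (Suc N) = contour_integral (circlepath 0 \<epsilon>)
        (\<lambda>\<xi>. h \<xi> * (\<xi> / w) ^ N / (\<xi> - w) - h \<xi> * (\<xi> / w) ^ Suc N / (\<xi> - w))"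
      unfolding J_def by (rule contour_integral_diff[symmetric]) (rule integJ)+
    also have "\<dots> = contour_integral (circlepath 0 \<epsilon>) (\<lambda>\<xi>. (- 1 / w ^ Suc N) * (h \<xi> * \<xi> ^ N))"
    proof (rule contour_integral_eq)
      fix \<xi> assume "\<xi> \<in> path_image (circlepath 0 \<epsilon>)"
      then have nz: "\<xi> - w \<noteq> 0" using \<epsilon> by auto
      have "h \<xi> * (\<xi> / w) ^ N / (\<xi> - w) - h \<xi> * (\<xi> / w) ^ Suc N / (\<xi> - w)
          = h \<xi> * (\<xi> / w) ^ N * ((1 - \<xi> / w) / (\<xi> - w))"
        by (simp add: algebra_simps diff_divide_distrib)
      also have "(1 - \<xi> / w) / (\<xi> - w) = - 1 / w"
        using w nz by (simp add: field_simps)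
      finally show "h \<xi> * (\<xi> / w) ^ N / (\<xi> - w) - h \<xi> * (\<xi> / w) ^ Suc N / (\<xi> - w)
          = - 1 / w ^ Suc N * (h \<xi> * \<xi> ^ N)"
        by (simp add: power_divide mult.commute)
    qed
    also have "\<dots> = (- 1 / w ^ Suc N) * contour_integral (circlepath 0 \<epsilon>) (\<lambda>\<xi>. h \<xi> * \<xi> ^ N)"
      by (rule contour_integral_lmul, rule contour_integrable_continuous_circlepath)
         (use \<epsilon> R in \<open>auto intro!: continuous_intros continuous_on_subset[OF holomorphic_on_imp_continuous_on[OF S(2)]] simp: S_def\<close>)
    also have "contour_integral (circlepath 0 \<epsilon>) (\<lambda>\<xi>. h \<xi> * \<xi> ^ N)
        = contour_integral (circlepath 0 1) (\<lambda>\<xi>. h \<xi> * \<xi> ^ N)"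
      by (rule contour_integral_circlepath_radius[of _ R])
         (use \<epsilon> R h in \<open>auto intro!: holomorphic_intros\<close>)
    finally show ?thesis by (simp add: van)
  qed
  have J0: "J N = J 0" for N by (induction N) (use step in auto)
  have "compact (h ` sphere 0 \<epsilon>)"
    by (intro compact_continuous_image continuous_on_subset[OF holomorphic_on_imp_continuous_on[OF S(2)]])
       (use \<epsilon> R in \<open>auto simp: S_def\<close>)
  then obtain B where B: "B > 0" "\<And>\<xi>. cmod \<xi> = \<epsilon> \<Longrightarrow> cmod (h \<xi>) \<le> B"
    using compact_imp_bounded bounded_pos[of "h ` sphere 0 \<epsilon>"] by auto
  have Jle: "cmod (J N) \<le> B / (cmod w - \<epsilon>) * (2 * pi * \<epsilon>) * (1/2) ^ N" for N
  proof -
    have "cmod (J N) \<le> (B * (1/2) ^ N / (cmod w - \<epsilon>)) * (2 * pi * \<epsilon>)"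
    proof (rule has_contour_integral_bound_circlepath)
      show "((\<lambda>\<xi>. h \<xi> * (\<xi> / w) ^ N / (\<xi> - w)) has_contour_integral J N) (circlepath 0 \<epsilon>)"
        unfolding J_def by (rule has_contour_integral_integral[OF integJ])
      show "0 \<le> B * (1/2) ^ N / (cmod w - \<epsilon>)" using B \<epsilon> by auto
      fix \<xi> assume "cmod (\<xi> - 0) = \<epsilon>"
      then have x: "cmod \<xi> = \<epsilon>" by simp
      have "cmod w - \<epsilon> \<le> cmod (\<xi> - w)" using norm_triangle_ineq2[of w \<xi>] x by (simp add: norm_minus_commute)
      moreover have "cmod (\<xi> / w) = 1/2" using x w by (simp add: norm_divide \<epsilon>_def)
      ultimately show "cmod (h \<xi> * (\<xi> / w) ^ N / (\<xi> - w)) \<le> B * (1/2) ^ N / (cmod w - \<epsilon>)"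
        unfolding norm_divide norm_mult norm_power using B x \<epsilon> by (intro frac_le mult_mono) (auto simp: norm_divide)
    qed (use \<epsilon> in auto)
    then show ?thesis by (simp add: field_simps)
  qed
  have "(\<lambda>N. B / (cmod w - \<epsilon>) * (2 * pi * \<epsilon>) * (1/2) ^ N) \<longlonglongrightarrow> B / (cmod w - \<epsilon>) * (2 * pi * \<epsilon>) * 0"
    by (intro tendsto_intros LIMSEQ_power_zero) auto
  then have "cmod (J 0) \<le> B / (cmod w - \<epsilon>) * (2 * pi * \<epsilon>) * 0"
    by (rule LIMSEQ_le_const) (metis Jle J0)
  then have J00: "contour_integral (circlepath 0 \<epsilon>) (\<lambda>\<xi>. h \<xi> / (\<xi> - w)) = 0"
    by (simp add: J_def)
  have split: "contour_integral (circlepath 0 r) q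
      = contour_integral (circlepath 0 r) (\<lambda>\<xi>. h \<xi> / (\<xi> - w)) - contour_integral (circlepath 0 r) (\<lambda>\<xi>. h w / (\<xi> - w))"
    if r: "0 < r" "r < R" "r \<noteq> cmod w" for r
  proof -
    have "contour_integral (circlepath 0 r) q
        = contour_integral (circlepath 0 r) (\<lambda>\<xi>. h \<xi> / (\<xi> - w) - h w / (\<xi> - w))"
      by (rule contour_integral_eq) (use r in \<open>auto simp: q_def diff_divide_distrib\<close>)
    also have "\<dots> = contour_integral (circlepath 0 r) (\<lambda>\<xi>. h \<xi> / (\<xi> - w)) - contour_integral (circlepath 0 r) (\<lambda>\<xi>. h w / (\<xi> - w))"
      by (rule contour_integral_diff)
         (use on_circle[OF r, of "\<lambda>_. 1"] in \<open>auto intro!: contour_integrable_continuous_circlepath\<close>)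
    finally show ?thesis .
  qed
  have c1: "((\<lambda>\<xi>. h w / (\<xi> - w)) has_contour_integral 2 * pi * \<i> * h w) (circlepath 0 1)"
    using Cauchy_integral_circlepath_simple[of "\<lambda>_. h w" 0 1 w] w by simp
  have c2: "((\<lambda>\<xi>. h w / (\<xi> - w)) has_contour_integral 0) (circlepath 0 \<epsilon>)"
    by (rule Cauchy_theorem_disc_simple[of _ 0 "cmod w"])
       (use \<epsilon> in \<open>auto intro!: holomorphic_intros\<close>)
  \<comment> \<open>The difference quotient has a removable singularity at \<open>w\<close>, so both
    circles give the same integral. The subtracted term \<open>h w / (\<xi> - w)\<close> contributes
    only on the unit circle, which encloses \<open>w\<close>; with \<open>J 0 = 0\<close> this
    leaves Cauchy's formula on the unit circle.\<close>
  have "contour_integral (circlepath 0 \<epsilon>) q = contour_integral (circlepath 0 1) q"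
    by (rule contour_integral_circlepath_radius[OF q]) (use \<epsilon> R in auto)
  then have "contour_integral (circlepath 0 1) (\<lambda>\<xi>. h \<xi> / (\<xi> - w)) = 2 * pi * \<i> * h w"
    using split[of \<epsilon>] split[of 1] \<epsilon> R w J00 contour_integral_unique[OF c1] contour_integral_unique[OF c2] by simp
  moreover have "(\<lambda>\<xi>. h \<xi> / (\<xi> - w)) contour_integrable_on circlepath 0 1"
    using on_circle(1)[of 1 "\<lambda>_. 1"] R w by (auto intro!: contour_integrable_continuous_circlepath)
  ultimately have c3: "((\<lambda>\<xi>. h \<xi> / (\<xi> - w)) has_contour_integral 2 * pi * \<i> * h w) (circlepath 0 1)"
    using has_contour_integral_integral by metis
  have M0: "0 \<le> M" using M[of 1] norm_ge_zero[of "h 1"] by (metis norm_one order_trans)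
  have "cmod (2 * pi * \<i> * h w) \<le> M / (1 - cmod w) * (2 * pi * 1)"
  proof (rule has_contour_integral_bound_circlepath[OF c3])
    show "0 \<le> M / (1 - cmod w)" using M0 w by simp
    fix \<xi> assume "cmod (\<xi> - 0) = 1"
    then have x: "cmod \<xi> = 1" by simp
    have "1 - cmod w \<le> cmod (\<xi> - w)" using norm_triangle_ineq2[of \<xi> w] x by simp
    then show "cmod (h \<xi> / (\<xi> - w)) \<le> M / (1 - cmod w)"
      unfolding norm_divide using M[OF x] M0 w by (intro frac_le) auto
  qed auto
  then have "(2 * pi) * cmod (h w) \<le> (2 * pi) * (M / (1 - cmod w))"
    by (simp add: norm_mult mult.commute)
  then show ?thesis by (rule mult_left_le_imp_le) simp
qed

text \<open>Through these sums an average over the circle becomes a limit of averages over finitely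
  many rotations. Uniform continuity bounds the error on each of the equal subintervals.\<close>

lemma riemann_sum_tendsto:
  fixes G :: "real \<Rightarrow> complex"
  assumes G: "continuous_on {0..1} G"
  shows "(\<lambda>N. (\<Sum>j<Suc N. G (real j / real (Suc N))) / of_nat (Suc N)) \<longlonglongrightarrow> integral {0..1} G"
proof (rule LIMSEQ_I)
  fix e :: real assume e: "e > 0"
  have "uniformly_continuous_on {0..1} G"
    using G by (intro compact_uniformly_continuous) auto
  then obtain d where d: "d > 0"
    "\<And>s t. s \<in> {0..1} \<Longrightarrow> t \<in> {0..1} \<Longrightarrow> dist t s < d \<Longrightarrow> dist (G t) (G s) < e / 2"
    unfolding uniformly_continuous_on_def using e by (metis half_gt_zero)
  obtain N0 where N0: "inverse (real (Suc N0)) < d" using d(1) reals_Archimedean by blast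
  show "\<exists>no. \<forall>N\<ge>no. norm ((\<Sum>j<Suc N. G (real j / real (Suc N))) / of_nat (Suc N) - integral {0..1} G) < e"
  proof (intro exI[of _ N0] allI impI)
    fix N assume N: "N \<ge> N0"
    define K where "K = real (Suc N)"
    have K: "K > 0" by (simp add: K_def)
    have Kd: "1 / K < d"
    proof -
      have "1 / K \<le> inverse (real (Suc N0))" using N by (simp add: K_def field_simps)
      then show ?thesis using N0 by simp
    qed
    have integrable: "G integrable_on {a..b}" if "0 \<le> a" "b \<le> 1" for a b
      using that by (intro integrable_continuous_real continuous_on_subset[OF G]) auto
    have tel: "integral {0..real j / K} G = (\<Sum>i<j. integral {real i / K..real (Suc i) / K} G)" if "j \<le> Suc N" for j
      using that
    proof (induction j)
      case (Suc j)
      have "real (Suc j) / K \<le> 1" using Suc.prems K by (simp add: K_def)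
      then have "integral {0..real j / K} G + integral {real j / K..real (Suc j) / K} G = integral {0..real (Suc j) / K} G"
        using K by (intro Henstock_Kurzweil_Integration.integral_combine integrable) (auto simp: divide_simps)
      then show ?case using Suc by simp
    qed simp
    have "integral {0..1} G = (\<Sum>i<Suc N. integral {real i / K..real (Suc i) / K} G)"
      using tel[of "Suc N"] by (simp add: K_def)
    moreover have "(\<Sum>j<Suc N. G (real j / K)) / of_nat (Suc N)
        = (\<Sum>i<Suc N. integral {real i / K..real (Suc i) / K} (\<lambda>t. G (real i / K)))"
    proof -
      have "integral {real i / K..real (Suc i) / K} (\<lambda>t. c) = c / of_nat (Suc N)" for i and c :: complex
      proof -
        have "real (Suc i) / K - real i / K = 1 / K" "real i / K \<le> real (Suc i) / K"
          using K by (simp_all add: diff_divide_distrib[symmetric] divide_right_mono)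
        then show ?thesis by (simp add: scaleR_conv_of_real K_def)
      qed
      then show ?thesis by (simp only: sum_divide_distrib)
    qed
    ultimately have "(\<Sum>j<Suc N. G (real j / K)) / of_nat (Suc N) - integral {0..1} G
        = (\<Sum>i<Suc N. integral {real i / K..real (Suc i) / K} (\<lambda>t. G (real i / K)) - integral {real i / K..real (Suc i) / K} G)"
      by (simp only: sum_subtractf)
    also have "norm \<dots> \<le> (\<Sum>i<Suc N. e / 2 * (1 / K))"
    proof (rule sum_norm_le)
      fix i assume "i \<in> {..<Suc N}"
      then have i: "0 \<le> real i / K" "real (Suc i) / K \<le> 1" using K by (auto simp: K_def)
      have "integral {real i / K..real (Suc i) / K} (\<lambda>t. G (real i / K)) - integral {real i / K..real (Suc i) / K} G
          = integral {real i / K..real (Suc i) / K} (\<lambda>t. G (real i / K) - G t)"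
        using i by (intro Henstock_Kurzweil_Integration.integral_diff[symmetric] integrable) auto
      also have "norm \<dots> \<le> e / 2 * (real (Suc i) / K - real i / K)"
      proof (rule integral_bound)
        show "real i / K \<le> real (Suc i) / K" using K by (simp add: divide_simps)
        show "continuous_on {real i / K..real (Suc i) / K} (\<lambda>t. G (real i / K) - G t)"
          using i by (intro continuous_intros continuous_on_subset[OF G]) auto
        fix t assume t: "t \<in> {real i / K..real (Suc i) / K}"
        then have "t - real i / K \<le> 1 / K" by (simp add: add_divide_distrib)
        then have "dist (real i / K) t < d" using t Kd by (auto simp: dist_real_def)
        then show "norm (G (real i / K) - G t) \<le> e / 2"
          using d(2)[of t "real i / K"] t i by (auto simp: dist_norm)
      qed
      finally show "norm (integral {real i / K..real (Suc i) / K} (\<lambda>t. G (real i / K)) - integral {real i / K..real (Suc i) / K} G) \<le> e / 2 * (1 / K)"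
        by (simp add: diff_divide_distrib[symmetric])
    qed
    also have "\<dots> < e" using e K by (simp add: K_def field_simps add_pos_nonneg)
    finally show "norm ((\<Sum>j<Suc N. G (real j / real (Suc N))) / of_nat (Suc N) - integral {0..1} G) < e"
      by (simp only: K_def)
  qed
qed

section \<open>Weights of the circle action\<close>

locale hartogs =
  fixes m n :: nat
  assumes m_pos: "m > 0" and n_pos: "n > 0"
begin

definition H :: "(complex \<times> complex) set"
  where "H = Hartogs_triangle (real m / real n)"

text \<open>The exponents are exchanged so that \<open>cmod (fst z) ^ m\<close> and
  \<open>cmod (snd z) ^ n\<close> are both multiplied by \<open>cmod c ^ (n * m)\<close>: the
  inequality between them is invariant for every nonzero \<open>c\<close>, and only
  \<open>cmod (snd z) < 1\<close> can be lost.\<close>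

definition twist :: "complex \<Rightarrow> complex \<times> complex \<Rightarrow> complex \<times> complex"
  where "twist c z = (c ^ n * fst z, c ^ m * snd z)"

text \<open>Written as an integral over the unit interval so that its Riemann sums are averages over
  rotations. As a contour integral it is the Laurent coefficient of degree \<open>k\<close> of the
  orbit function; see \<open>weight_part_eq_contour_integral\<close>.\<close>

definition weight_part :: "int \<Rightarrow> (complex \<times> complex \<Rightarrow> complex) \<Rightarrow> complex \<times> complex \<Rightarrow> complex"
  where "weight_part k f z =
    integral {0..1} (\<lambda>t. f (twist (cis (2 * pi * t)) z) * cis (- (2 * pi * of_int k * t)))"

lemma mem_H_iff: "z \<in> H \<longleftrightarrow> cmod (fst z) ^ m < cmod (snd z) ^ n \<and> cmod (snd z) < 1"
proof -
  have "x powr (real m / real n) < y \<longleftrightarrow> x ^ m < y ^ n" if "x \<ge> 0" "y \<ge> 0" for x y :: real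
  proof (cases "x = 0")
    \<comment> \<open>At \<open>x = 0\<close> both sides say \<open>0 < y\<close>, since
      \<open>m\<close> and \<open>n\<close> are positive and \<open>0 powr a = 0\<close>.\<close>
    case True
    then show ?thesis using that m_pos n_pos by (cases "y = 0") (auto simp: power_0_left)
  next
    case False
    then have "(x powr (real m / real n)) ^ n = x ^ m"
      using that n_pos by (simp add: powr_power powr_realpow)
    then have "x ^ m < y ^ n \<longleftrightarrow> (x powr (real m / real n)) ^ n < y ^ n" by simp
    also have "\<dots> \<longleftrightarrow> x powr (real m / real n) < y"
      using that n_pos by (meson power_strict_mono power_less_imp_less_base powr_ge_zero)
    finally show ?thesis by simp
  qed
  then show ?thesis
    by (auto simp: H_def Hartogs_triangle_def case_prod_unfold)
qed

lemma snd_nonzero: "z \<in> H \<Longrightarrow> snd z \<noteq> 0"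
  using n_pos by (auto simp: mem_H_iff power_0_left not_less)

lemma fst_less_one:
  assumes "z \<in> H" shows "cmod (fst z) < 1"
proof (rule ccontr)
  assume "\<not> cmod (fst z) < 1"
  then have "1 \<le> cmod (fst z) ^ m" by simp
  moreover have "cmod (snd z) ^ n \<le> 1"
    using assms by (intro power_le_one) (auto simp: mem_H_iff)
  ultimately show False using assms by (simp add: mem_H_iff)
qed

lemma open_H: "open H"
proof -
  have "H = {z. cmod (fst z) ^ m < cmod (snd z) ^ n} \<inter> {z. cmod (snd z) < 1}"
    by (auto simp: mem_H_iff)
  then show ?thesis
    by (auto intro!: open_Int open_Collect_less continuous_intros)
qed

lemma bounded_H: "bounded H"
proof -
  have "H \<subseteq> cball 0 1 \<times> cball 0 1"
    using fst_less_one by (fastforce simp: mem_H_iff)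
  then show ?thesis
    using bounded_Times bounded_subset bounded_cball by blast
qed

lemma twist_mem:
  assumes "z \<in> H" "c \<noteq> 0" "cmod c ^ m * cmod (snd z) < 1"
  shows "twist c z \<in> H"
proof -
  have "cmod c ^ (n * m) * cmod (fst z) ^ m < cmod c ^ (n * m) * cmod (snd z) ^ n"
    using assms by (intro mult_strict_left_mono) (auto simp: mem_H_iff)
  then show ?thesis
    using assms by (auto simp: mem_H_iff twist_def norm_mult norm_power power_mult_distrib power_mult[symmetric] mult.commute[of m n])
qed

lemma twist_mem_le:
  assumes "z \<in> H" "c \<noteq> 0" "cmod c \<le> 1"
  shows "twist c z \<in> H"
proof (rule twist_mem[OF assms(1,2)])
  have "cmod c ^ m * cmod (snd z) \<le> 1 * cmod (snd z)"
    using assms(3) by (intro mult_right_mono power_le_one) auto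
  also have "\<dots> < 1" using assms(1) by (simp add: mem_H_iff)
  finally show "cmod c ^ m * cmod (snd z) < 1" .
qed

lemma twist_twist: "twist c (twist d z) = twist (c * d) z"
  by (simp add: twist_def power_mult_distrib mult.assoc)

lemma twist_1 [simp]: "twist 1 z = z"
  by (simp add: twist_def)

lemma twist_mem_iff: "cmod c = 1 \<Longrightarrow> twist c z \<in> H \<longleftrightarrow> z \<in> H"
  by (simp add: mem_H_iff twist_def norm_mult norm_power)

lemma continuous_on_twist:
  assumes f: "continuous_on H f" and g: "continuous_on A c" "continuous_on A g"
    and "\<And>x. x \<in> A \<Longrightarrow> twist (c x) (g x) \<in> H"
  shows "continuous_on A (\<lambda>x. f (twist (c x) (g x)))"
  using assms(4) unfolding twist_def
  by (intro continuous_on_compose2[OF f] continuous_intros g) auto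

lemma continuous_on_twist_circle:
  assumes f: "continuous_on H f" and z: "z \<in> H"
    and g: "continuous_on A g" and h: "continuous_on A h"
  shows "continuous_on A (\<lambda>t. f (twist (cis (g t)) z) * cis (h t))"
  using g h z by (intro continuous_intros continuous_on_twist[OF f]) (auto simp: twist_mem_iff)

text \<open>The differential \<open>\<zeta> powi (- k - 1)\<close> d\<zeta> is homogeneous of degree
  \<open>- k\<close>, whence the factor \<open>c powi (- k)\<close>. One computation serves three
  purposes: \<open>c = 1\<close> gives the contour form of the weight part, a positive real
  \<open>c\<close> a change of radius, and a unimodular \<open>c\<close> a shift of the starting
  point.\<close>

lemma contour_integral_twist:
  assumes "c \<noteq> 0"
  shows "contour_integral (\<lambda>t. c * circlepath 0 1 t) (\<lambda>\<zeta>. f (twist \<zeta> z) * \<zeta> powi (- k - 1))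
    = 2 * pi * \<i> * c powi (- k) * weight_part k f (twist c z)"
proof -
  have circ: "circlepath 0 1 t = cis (2 * pi * t)" for t
    by (simp add: circlepath cis_conv_exp mult_ac)
  have vd: "vector_derivative (\<lambda>t. c * circlepath 0 1 t) (at t) = c * (2 * pi * \<i> * cis (2 * pi * t))" for t
  proof (rule vector_derivative_at, rule has_vector_derivative_mult_right)
    show "(circlepath 0 1 has_vector_derivative 2 * pi * \<i> * cis (2 * pi * t)) (at t)"
      using has_vector_derivative_circlepath[of 0 1 t UNIV] by (simp add: cis_conv_exp mult_ac)
  qed
  have "(c * cis (2 * pi * t)) powi (- k - 1) * (c * (2 * pi * \<i> * cis (2 * pi * t)))
      = 2 * pi * \<i> * c powi (- k) * cis (- (2 * pi * of_int k * t))" for t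
  proof -
    have e: "x powi (- k - 1) * x = x powi (- k)" if "x \<noteq> 0" for x :: complex
      using power_int_add[of x "- k - 1" 1] that by simp
    have "(c * cis (2 * pi * t)) powi (- k - 1) * (c * (2 * pi * \<i> * cis (2 * pi * t)))
      = 2 * pi * \<i> * ((c * cis (2 * pi * t)) powi (- k - 1) * (c * cis (2 * pi * t)))"
      by (simp only: mult_ac)
    also have "\<dots> = 2 * pi * \<i> * (c * cis (2 * pi * t)) powi (- k)"
      using assms by (subst e) auto
    also have "\<dots> = 2 * pi * \<i> * c powi (- k) * cis (- (2 * pi * of_int k * t))"
      by (simp add: power_int_mult_distrib cis_power_int mult_ac)
    finally show ?thesis .
  qed
  then have integrand: "f (twist (c * cis (2 * pi * t)) z) * (c * cis (2 * pi * t)) powi (- k - 1) * (c * (2 * pi * \<i> * cis (2 * pi * t)))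
      = (2 * pi * \<i> * c powi (- k)) * (f (twist (cis (2 * pi * t)) (twist c z)) * cis (- (2 * pi * of_int k * t)))" for t
    by (simp add: twist_twist mult.assoc mult.left_commute mult.commute[of c])
  then show ?thesis
    unfolding contour_integral_integral vd
    unfolding circ weight_part_def by (simp only: integrand integral_mult_right)
qed

lemma weight_part_eq_contour_integral:
  "weight_part k f z = contour_integral (circlepath 0 1) (\<lambda>\<zeta>. f (twist \<zeta> z) * \<zeta> powi (- k - 1)) / (2 * pi * \<i>)"
  using contour_integral_twist[of 1 f z k] by (simp add: fun_eq_iff)

lemma holomorphic_on_orbit:
  assumes f: "holomorphic2_on f H" and z: "z \<in> H"
  obtains R where "R > 1" "(\<lambda>\<zeta>. f (twist \<zeta> z)) holomorphic_on ball 0 R - {0}"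
proof
  \<comment> \<open>The radius at which the orbit leaves the domain: for
    \<open>\<zeta> \<noteq> 0\<close> the only remaining condition is
    \<open>cmod \<zeta> ^ m * cmod (snd z) < 1\<close>.\<close>
  define R where "R = root m (1 / cmod (snd z))"
  have s: "0 < cmod (snd z)" "cmod (snd z) < 1" using z snd_nonzero[OF z] by (auto simp: mem_H_iff)
  show "R > 1" using s m_pos by (simp add: R_def)
  have "twist \<zeta> z \<in> H" if "\<zeta> \<in> ball 0 R - {0}" for \<zeta>
  proof (rule twist_mem[OF z])
    have "cmod \<zeta> ^ m < R ^ m" using that m_pos by (intro power_strict_mono) auto
    also have "R ^ m = 1 / cmod (snd z)" using m_pos s by (simp add: R_def)
    finally show "cmod \<zeta> ^ m * cmod (snd z) < 1" using s by (simp add: field_simps)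
  qed (use that in auto)
  then show "(\<lambda>\<zeta>. f (twist \<zeta> z)) holomorphic_on ball 0 R - {0}"
    unfolding twist_def
    by (intro holomorphic_on_compose_holomorphic2[OF f open_H] holomorphic_intros) auto
qed

text \<open>The circles of radius \<rho> and 1 about the puncture yield the same Laurent
  coefficient. Holomorphy along the orbit enters here, in contrast to homogeneity under
  rotations.\<close>

lemma weight_part_twist_real:
  assumes f: "holomorphic2_on f H" and z: "z \<in> H" and \<rho>: "0 < \<rho>" "\<rho> \<le> 1"
  shows "weight_part k f (twist (of_real \<rho>) z) = of_real \<rho> powi k * weight_part k f z"
proof -
  obtain R where R: "R > 1" "(\<lambda>\<zeta>. f (twist \<zeta> z)) holomorphic_on ball 0 R - {0}"
    using holomorphic_on_orbit[OF f z] .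
  let ?h = "\<lambda>\<zeta>. f (twist \<zeta> z) * \<zeta> powi (- k - 1)"
  have "contour_integral (circlepath 0 \<rho>) ?h = contour_integral (circlepath 0 1) ?h"
    by (rule contour_integral_circlepath_radius[of _ R]) (use R \<rho> in \<open>auto intro!: holomorphic_intros\<close>)
  moreover have "circlepath 0 \<rho> = (\<lambda>t. of_real \<rho> * circlepath 0 1 t)"
    by (simp add: circlepath)
  ultimately have "2 * pi * \<i> * of_real \<rho> powi (- k) * weight_part k f (twist (of_real \<rho>) z)
      = 2 * pi * \<i> * weight_part k f z"
    using contour_integral_twist[of "of_real \<rho>" f z k] \<rho> by (simp add: weight_part_eq_contour_integral[of k f z])
  then show ?thesis using \<rho> by (simp add: power_int_minus field_simps)
qed

text \<open>A rotation only moves the starting point of a closed path, so no regularity of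
  \<open>f\<close> is involved.\<close>

lemma weight_part_twist_cis:
  assumes a: "0 \<le> a" "a \<le> 1"
  shows "weight_part k f (twist (cis (2 * pi * a)) z) = cis (2 * pi * of_int k * a) * weight_part k f z"
proof -
  let ?c = "cis (2 * pi * a)"
  have circ: "circlepath 0 1 t = cis (2 * pi * t)" for t
    by (simp add: circlepath cis_conv_exp mult_ac)
  have "shiftpath a (circlepath 0 1) = (\<lambda>t. ?c * circlepath 0 1 t)"
    by (auto simp: shiftpath_def circ cis_mult fun_eq_iff algebra_simps complex_eq_iff cos_diff sin_diff)
  then have "contour_integral (\<lambda>t. ?c * circlepath 0 1 t) (\<lambda>\<zeta>. f (twist \<zeta> z) * \<zeta> powi (- k - 1))
      = contour_integral (circlepath 0 1) (\<lambda>\<zeta>. f (twist \<zeta> z) * \<zeta> powi (- k - 1))"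
    using contour_integral_shiftpath[of "circlepath 0 1" a] a by simp
  then have "?c powi (- k) * weight_part k f (twist ?c z) = weight_part k f z"
    using contour_integral_twist[of ?c f z k] by (simp add: weight_part_eq_contour_integral[of k f z] field_simps)
  then show ?thesis by (simp add: power_int_minus cis_power_int field_simps)
qed

lemma weight_part_diff:
  assumes "continuous_on H f" "continuous_on H g" "z \<in> H"
  shows "weight_part k (\<lambda>z. f z - g z) z = weight_part k f z - weight_part k g z"
  unfolding weight_part_def left_diff_distrib
  by (intro Henstock_Kurzweil_Integration.integral_diff integrable_continuous_real continuous_on_twist_circle)
     (use assms in \<open>auto intro!: continuous_intros\<close>)

lemma weight_part_sum:
  assumes "finite K" "\<And>i. i \<in> K \<Longrightarrow> continuous_on H (f i)" "z \<in> H"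
  shows "weight_part k (\<lambda>z. \<Sum>i\<in>K. f i z) z = (\<Sum>i\<in>K. weight_part k (f i) z)"
  unfolding weight_part_def sum_distrib_right
  by (intro Henstock_Kurzweil_Integration.integral_sum integrable_continuous_real continuous_on_twist_circle)
     (use assms in \<open>auto intro!: continuous_intros\<close>)

text \<open>Homogeneity under rotations turns the outer integral into the inner product of two
  characters of the circle, which are orthonormal.\<close>

lemma weight_part_weight_part:
  "weight_part l (weight_part k f) z = (if l = k then weight_part k f z else 0)"
proof -
  have "weight_part l (weight_part k f) z
      = integral {0..1} (\<lambda>t. weight_part k f z * cis (2 * pi * of_int (k - l) * t))"
    unfolding weight_part_def[of l]
  proof (rule Henstock_Kurzweil_Integration.integral_cong)
    fix t :: real assume "t \<in> {0..1}"
    then have "weight_part k f (twist (cis (2 * pi * t)) z) * cis (- (2 * pi * of_int l * t))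
        = weight_part k f z * (cis (2 * pi * of_int k * t) * cis (- (2 * pi * of_int l * t)))"
      by (subst weight_part_twist_cis) auto
    then show "weight_part k f (twist (cis (2 * pi * t)) z) * cis (- (2 * pi * of_int l * t))
        = weight_part k f z * cis (2 * pi * of_int (k - l) * t)"
      by (simp add: cis_mult algebra_simps)
  qed
  also have "\<dots> = weight_part k f z * integral {0..1} (\<lambda>t. cis (2 * pi * of_int (k - l) * t))"
    by simp
  also have "integral {0..1} (\<lambda>t. cis (2 * pi * of_int (k - l) * t)) = (if l = k then 1 else 0)"
  proof (cases "l = k")
    case False
    define c where "c = 2 * pi * \<i> * of_int (k - l)"
    have c: "c \<noteq> 0" using False by (simp add: c_def)
    have "((\<lambda>t. exp (c * of_real t)) has_integral exp (c * of_real 1) / c - exp (c * of_real 0) / c) {0..1}"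
    proof (rule fundamental_theorem_of_calculus)
      fix t :: real
      have "((\<lambda>z. exp (c * z) / c) has_field_derivative exp (c * of_real t)) (at (of_real t))"
        using c by (auto intro!: derivative_eq_intros)
      then show "((\<lambda>t. exp (c * of_real t) / c) has_vector_derivative exp (c * of_real t)) (at t within {0..1})"
        by (rule has_vector_derivative_real_field)
    qed simp
    moreover have "exp c = 1"
      by (subst exp_eq_1) (auto simp: c_def intro!: exI[of _ "k - l"])
    moreover have "exp (c * of_real t) = cis (2 * pi * of_int (k - l) * t)" for t
      by (simp add: c_def cis_conv_exp mult_ac)
    ultimately show ?thesis using False by (simp add: integral_unique)
  qed simp
  finally show ?thesis by auto
qed

lemma continuous_on_weight_part:
  assumes f: "continuous_on H f"
  shows "continuous_on H (weight_part k f)"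
proof -
  have "continuous_on H (\<lambda>z. contour_integral (circlepath 0 1) (\<lambda>\<zeta>. f (twist \<zeta> z) * \<zeta> powi (- k - 1)))"
  proof (rule continuous_on_contour_integral_param)
    show "continuous_on (H \<times> path_image (circlepath 0 1)) (\<lambda>(z, \<zeta>). f (twist \<zeta> z) * \<zeta> powi (- k - 1))"
      unfolding case_prod_unfold path_image_circlepath
      by (intro continuous_intros continuous_on_twist[OF f]) (auto simp: twist_mem_iff)
    show "continuous_on {0..1} (\<lambda>t. vector_derivative (circlepath 0 1) (at t))"
      unfolding vector_derivative_circlepath by (intro continuous_intros)
  qed auto
  then show ?thesis
    unfolding weight_part_eq_contour_integral[abs_def] by (intro continuous_intros) auto
qed

text \<open>Each one-variable slice is a parameter integral over the circle, holomorphic by Morera's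
  theorem; joint continuity then gives holomorphy in both variables.\<close>

lemma holomorphic2_on_weight_part:
  assumes f: "holomorphic2_on f H"
  shows "holomorphic2_on (weight_part k f) H"
proof (rule holomorphic2_on_if_separately_holomorphic[OF open_H])
  have cf: "continuous_on H f" using holomorphic2_on_imp_continuous_on[OF f] .
  show "continuous_on H (weight_part k f)" using continuous_on_weight_part[OF cf] .
  show "(\<lambda>x. weight_part k f (x, y)) holomorphic_on {x. (x, y) \<in> H}" for y
  proof -
    have op: "open {x. (x, y) \<in> H}"
      using open_vimage[OF open_H, of "\<lambda>x. (x, y)"] by (simp add: vimage_def continuous_intros)
    have "(\<lambda>x. contour_integral (circlepath 0 1) (\<lambda>\<zeta>. f (twist \<zeta> (x, y)) * \<zeta> powi (- k - 1)))
        holomorphic_on {x. (x, y) \<in> H}"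
    proof (rule holomorphic_on_contour_integral_circlepath[OF op])
      show "continuous_on ({x. (x, y) \<in> H} \<times> sphere 0 1) (\<lambda>(x, \<zeta>). f (twist \<zeta> (x, y)) * \<zeta> powi (- k - 1))"
        unfolding case_prod_unfold
        by (intro continuous_intros continuous_on_twist[OF cf]) (auto simp: twist_mem_iff)
      fix \<zeta> :: complex assume "\<zeta> \<in> sphere 0 1"
      then have "twist \<zeta> (x, y) \<in> H" if "(x, y) \<in> H" for x using that by (simp add: twist_mem_iff)
      then show "(\<lambda>x. f (twist \<zeta> (x, y)) * \<zeta> powi (- k - 1)) holomorphic_on {x. (x, y) \<in> H}"
        unfolding twist_def
        by (intro holomorphic_intros holomorphic_on_compose_holomorphic2[OF f open_H op]) auto
    qed
    then show ?thesis
      unfolding weight_part_eq_contour_integral[abs_def] by (intro holomorphic_intros) auto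
  qed
  show "(\<lambda>y. weight_part k f (x, y)) holomorphic_on {y. (x, y) \<in> H}" for x
  proof -
    have op: "open {y. (x, y) \<in> H}"
      using open_vimage[OF open_H, of "\<lambda>y. (x, y)"] by (simp add: vimage_def continuous_intros)
    have "(\<lambda>y. contour_integral (circlepath 0 1) (\<lambda>\<zeta>. f (twist \<zeta> (x, y)) * \<zeta> powi (- k - 1)))
        holomorphic_on {y. (x, y) \<in> H}"
    proof (rule holomorphic_on_contour_integral_circlepath[OF op])
      show "continuous_on ({y. (x, y) \<in> H} \<times> sphere 0 1) (\<lambda>(y, \<zeta>). f (twist \<zeta> (x, y)) * \<zeta> powi (- k - 1))"
        unfolding case_prod_unfold
        by (intro continuous_intros continuous_on_twist[OF cf]) (auto simp: twist_mem_iff)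
      fix \<zeta> :: complex assume "\<zeta> \<in> sphere 0 1"
      then have "twist \<zeta> (x, y) \<in> H" if "(x, y) \<in> H" for y using that by (simp add: twist_mem_iff)
      then show "(\<lambda>y. f (twist \<zeta> (x, y)) * \<zeta> powi (- k - 1)) holomorphic_on {y. (x, y) \<in> H}"
        unfolding twist_def
        by (intro holomorphic_intros holomorphic_on_compose_holomorphic2[OF f open_H op]) auto
    qed
    then show ?thesis
      unfolding weight_part_eq_contour_integral[abs_def] by (intro holomorphic_intros) auto
  qed
qed

text \<open>The orbit function has no Laurent terms of degree below \<open>k0\<close>, so after
  division by \<open>\<zeta> powi k0\<close> its principal part is gone. The estimate for such
  functions inside the unit disc, multiplied back by \<open>cmod c powi k0\<close>, is the
  claim.\<close>

lemma bound_of_vanishing_weight_parts: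
  assumes f: "holomorphic2_on f H" and z: "z \<in> H"
    and van: "\<And>k. k < k0 \<Longrightarrow> weight_part k f z = 0"
    and M: "\<And>\<xi>. cmod \<xi> = 1 \<Longrightarrow> cmod (f (twist \<xi> z)) \<le> M"
    and c: "c \<noteq> 0" "cmod c < 1"
  shows "cmod (f (twist c z)) \<le> cmod c powi k0 * (M / (1 - cmod c))"
proof -
  obtain R where R: "R > 1" "(\<lambda>\<zeta>. f (twist \<zeta> z)) holomorphic_on ball 0 R - {0}"
    using holomorphic_on_orbit[OF f z] .
  have "cmod (f (twist c z) * c powi (- k0)) \<le> M / (1 - cmod c)"
  proof (rule bound_of_vanishing_principal_part[of _ R])
    show "(\<lambda>\<zeta>. f (twist \<zeta> z) * \<zeta> powi (- k0)) holomorphic_on ball 0 R - {0}"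
      using R by (auto intro!: holomorphic_intros)
    show "R > 1" by fact
    show "cmod (f (twist \<xi> z) * \<xi> powi (- k0)) \<le> M" if "cmod \<xi> = 1" for \<xi>
      using M[OF that] that by (simp add: norm_mult norm_power_int)
    fix j :: nat
    \<comment> \<open>The \<open>j\<close>-th moment picks out the weight \<open>k0 - 1 - j\<close>;
      as \<open>j\<close> runs through the naturals these are exactly the weights below
      \<open>k0\<close>.\<close>
    have "contour_integral (circlepath 0 1) (\<lambda>\<xi>. f (twist \<xi> z) * \<xi> powi (- k0) * \<xi> ^ j)
        = contour_integral (circlepath 0 1) (\<lambda>\<zeta>. f (twist \<zeta> z) * \<zeta> powi (- (k0 - 1 - int j) - 1))"
    proof (rule contour_integral_eq)
      fix \<xi> assume "\<xi> \<in> path_image (circlepath 0 1)"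
      then have "\<xi> \<noteq> 0" by auto
      then have "\<xi> powi (- k0 + int j) = \<xi> powi (- k0) * \<xi> ^ j"
        by (subst power_int_add) auto
      then show "f (twist \<xi> z) * \<xi> powi (- k0) * \<xi> ^ j = f (twist \<xi> z) * \<xi> powi (- (k0 - 1 - int j) - 1)"
        by (simp add: algebra_simps)
    qed
    also have "\<dots> = 2 * pi * \<i> * weight_part (k0 - 1 - int j) f z"
      by (simp add: weight_part_eq_contour_integral)
    finally show "contour_integral (circlepath 0 1) (\<lambda>\<xi>. f (twist \<xi> z) * \<xi> powi (- k0) * \<xi> ^ j) = 0"
      using van by simp
  qed (use c in auto)
  moreover have "cmod (f (twist c z) * c powi (- k0)) = cmod (f (twist c z)) / cmod c powi k0"
    by (simp add: norm_mult norm_power_int power_int_minus divide_inverse norm_inverse)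
  moreover have "cmod c powi k0 > 0" using c by simp
  ultimately show ?thesis
    by (simp only: pos_divide_le_eq mult.commute)
qed

text \<open>The Riemann sum of \<open>weight_part\<close> with \<open>Suc N\<close> equally spaced
  rotations; \<open>Suc N\<close> keeps the denominator nonzero.\<close>

definition weight_avg :: "nat \<Rightarrow> int \<Rightarrow> (complex \<times> complex \<Rightarrow> complex) \<Rightarrow> complex \<times> complex \<Rightarrow> complex"
  where "weight_avg N k f z = (\<Sum>j<Suc N. f (twist (cis (2 * pi * (real j / real (Suc N)))) z)
    * cis (- (2 * pi * of_int k * (real j / real (Suc N))))) / of_nat (Suc N)"

lemma weight_avg_tendsto:
  assumes "continuous_on H f" "z \<in> H"
  shows "(\<lambda>N. weight_avg N k f z) \<longlonglongrightarrow> weight_part k f z"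
  unfolding weight_avg_def weight_part_def
  by (rule riemann_sum_tendsto, rule continuous_on_twist_circle)
     (use assms in \<open>auto intro!: continuous_intros\<close>)

end

section \<open>Convergence of integrals\<close>

text \<open>The endpoint 0 is included because moduli of functions may vanish. There the inequality
  reduces to \<open>s powr p \<le> s\<close> for \<open>0 < s < 1\<close>.\<close>

lemma convex_on_powr_nonneg:
  assumes "p \<ge> (1::real)"
  shows "convex_on {0..} (\<lambda>x. x powr p)"
proof (rule convex_onI)
  fix t x y :: real assume t: "0 < t" "t < 1" and xy: "x \<in> {0..}" "y \<in> {0..}"
  have scale: "(s * z) powr p \<le> s * z powr p" if "0 < s" "s < 1" "0 \<le> z" for s z :: real
  proof -
    have "s powr p \<le> s powr 1" using that assms by (intro powr_mono') auto
    then show ?thesis using that by (simp add: powr_mult mult_right_mono)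
  qed
  consider "x = 0" | "y = 0" | "x > 0" "y > 0" using xy by force
  then show "((1 - t) *\<^sub>R x + t *\<^sub>R y) powr p \<le> (1 - t) * x powr p + t * y powr p"
  proof cases
    case 1
    then show ?thesis using scale[of t y] t xy by simp
  next
    case 2
    then show ?thesis using scale[of "1 - t" x] t xy by simp
  next
    case 3
    then show ?thesis using convex_onD[OF powr_convex[OF assms], of t x y] t by simp
  qed
qed simp

lemma norm_mean_powr_le:
  fixes a :: "nat \<Rightarrow> 'a::real_normed_field"
  assumes p: "p \<ge> 1"
  shows "norm ((\<Sum>j<Suc N. a j) / of_nat (Suc N)) powr p \<le> (\<Sum>j<Suc N. norm (a j) powr p) / real (Suc N)"
proof -
  have "norm ((\<Sum>j<Suc N. a j) / of_nat (Suc N)) \<le> (\<Sum>j<Suc N. norm (a j)) / real (Suc N)"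
    unfolding norm_divide norm_of_nat by (intro divide_right_mono norm_sum) simp
  also have "\<dots> = (\<Sum>j<Suc N. (1 / real (Suc N)) *\<^sub>R norm (a j))"
    by (simp add: sum_divide_distrib del: sum.lessThan_Suc)
  finally have "norm ((\<Sum>j<Suc N. a j) / of_nat (Suc N)) powr p \<le> (\<Sum>j<Suc N. (1 / real (Suc N)) *\<^sub>R norm (a j)) powr p"
    using p by (intro powr_mono2) auto
  also have "\<dots> \<le> (\<Sum>j<Suc N. (1 / real (Suc N)) * norm (a j) powr p)"
    by (rule convex_on_sum[OF _ _ convex_on_powr_nonneg[OF p]]) auto
  finally show ?thesis by (simp add: sum_divide_distrib del: sum.lessThan_Suc)
qed

lemma powr_add_le:
  assumes "0 \<le> a" "0 \<le> b" "0 \<le> (p::real)"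
  shows "(a + b) powr p \<le> 2 powr p * (a powr p + b powr p)"
proof -
  have "(a + b) powr p \<le> (2 * max a b) powr p"
    using assms by (intro powr_mono2) auto
  also have "\<dots> = 2 powr p * max a b powr p" using assms by (simp add: powr_mult)
  also have "\<dots> \<le> 2 powr p * (a powr p + b powr p)"
    by (intro mult_left_mono) (auto simp: max_def)
  finally show ?thesis .
qed

lemma norm_diff_powr_le:
  fixes x y :: "'a::real_normed_vector"
  assumes "0 \<le> (p::real)"
  shows "norm (x - y) powr p \<le> 2 powr p * (norm x powr p + norm y powr p)"
  using powr_mono2[OF assms norm_ge_zero norm_triangle_ineq4[of x y]]
    powr_add_le[OF norm_ge_zero norm_ge_zero assms, of x y] by linarith

text \<open>Rests on the pointwise bound \<open>uv \<le> min (uv) (Ku\<^sup>2) + v\<^sup>2/K\<close>: the first term is dominated, the second is small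
  for large \<open>K\<close>.\<close>

lemma nn_integral_mult_tendsto_zero:
  fixes u :: "'a \<Rightarrow> 'b::real_normed_vector" and v :: "nat \<Rightarrow> 'a \<Rightarrow> 'c::real_normed_vector"
  assumes [measurable]: "(\<lambda>x. norm (u x)) \<in> borel_measurable M" "\<And>N. (\<lambda>x. norm (v N x)) \<in> borel_measurable M"
    and u: "(\<integral>\<^sup>+x. ennreal ((norm (u x))\<^sup>2) \<partial>M) < \<infinity>"
    and v: "\<And>N. (\<integral>\<^sup>+x. ennreal ((norm (v N x))\<^sup>2) \<partial>M) \<le> ennreal C"
    and lim: "\<And>x. x \<in> space M \<Longrightarrow> (\<lambda>N. v N x) \<longlonglongrightarrow> 0"
  shows "(\<lambda>N. \<integral>\<^sup>+x. ennreal (norm (u x) * norm (v N x)) \<partial>M) \<longlonglongrightarrow> 0"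
proof (rule order_tendstoI)
  fix e :: ennreal assume "0 < e"
  then obtain \<epsilon> where \<epsilon>: "0 < \<epsilon>" "ennreal \<epsilon> < e"
    using dense[of 0 e] by (metis ennreal_cases ennreal_less_zero_iff order_less_imp_not_less top_greatest less_le_not_le)
  \<comment> \<open>Chosen so that the second term of the splitting, at most
    \<open>\<bar>C\<bar> / K\<close>, stays below \<open>\<epsilon> / 2\<close>; adding 1 keeps
    \<open>K\<close> positive.\<close>
  define K where "K = 2 * (\<bar>C\<bar> + 1) / \<epsilon>"
  have K: "K > 0" using \<epsilon> by (simp add: K_def)
  have CK: "\<bar>C\<bar> / K \<le> \<epsilon> / 2" using \<epsilon> K by (simp add: K_def field_simps)
  have "(\<lambda>N. \<integral>\<^sup>+x. ennreal (min (norm (u x) * norm (v N x)) (K * (norm (u x))\<^sup>2)) \<partial>M) \<longlonglongrightarrow> (\<integral>\<^sup>+x. 0 \<partial>M)"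
  proof (rule nn_integral_dominated_convergence[where w = "\<lambda>x. ennreal (K * (norm (u x))\<^sup>2)"])
    show "(\<integral>\<^sup>+x. ennreal (K * (norm (u x))\<^sup>2) \<partial>M) < \<infinity>"
      using u K by (simp add: ennreal_mult' nn_integral_cmult ennreal_mult_less_top)
    show "AE x in M. (\<lambda>N. ennreal (min (norm (u x) * norm (v N x)) (K * (norm (u x))\<^sup>2))) \<longlonglongrightarrow> 0"
    proof (rule AE_I2)
      fix x assume "x \<in> space M"
      then have "(\<lambda>N. min (norm (u x) * norm (v N x)) (K * (norm (u x))\<^sup>2)) \<longlonglongrightarrow> min (norm (u x) * norm (0::'c)) (K * (norm (u x))\<^sup>2)"
        by (intro tendsto_intros lim)
      moreover have "min (norm (u x) * norm (0::'c)) (K * (norm (u x))\<^sup>2) = 0" using K by simp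
      ultimately show "(\<lambda>N. ennreal (min (norm (u x) * norm (v N x)) (K * (norm (u x))\<^sup>2))) \<longlonglongrightarrow> 0"
        using tendsto_ennrealI by fastforce
    qed
  qed (auto intro!: ennreal_leI)
  then have "\<forall>\<^sub>F N in sequentially. (\<integral>\<^sup>+x. ennreal (min (norm (u x) * norm (v N x)) (K * (norm (u x))\<^sup>2)) \<partial>M) < ennreal (\<epsilon> / 2)"
    using \<epsilon> by (intro order_tendstoD(2)) auto
  then show "\<forall>\<^sub>F N in sequentially. (\<integral>\<^sup>+x. ennreal (norm (u x) * norm (v N x)) \<partial>M) < e"
  proof eventually_elim
    case (elim N)
    \<comment> \<open>If \<open>t \<le> K * s\<close>, the minimum is \<open>s * t\<close> itself;
      otherwise \<open>s < t / K\<close>, and the second term alone is large enough.\<close>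
    have pt: "s * t \<le> min (s * t) (K * s\<^sup>2) + (1 / K) * t\<^sup>2" if "0 \<le> s" "0 \<le> t" for s t :: real
    proof (cases "t \<le> K * s")
      case True
      then have "s * t \<le> K * s\<^sup>2" using that mult_left_mono[of t "K * s" s] by (simp add: power2_eq_square mult_ac)
      then show ?thesis using K by (simp add: min_def)
    next
      case False
      then have "s \<le> t / K" using K by (simp add: field_simps)
      then have "s * t \<le> (1 / K) * t\<^sup>2" using that mult_right_mono[of s "t / K" t] by (simp add: power2_eq_square)
      moreover have "0 \<le> K * s\<^sup>2" "0 \<le> (1 / K) * t\<^sup>2" using K by simp_all
      ultimately show ?thesis by (simp add: min_def)
    qed
    have "(\<integral>\<^sup>+x. ennreal (norm (u x) * norm (v N x)) \<partial>M)
      \<le> (\<integral>\<^sup>+x. ennreal (min (norm (u x) * norm (v N x)) (K * (norm (u x))\<^sup>2)) + ennreal (1 / K) * ennreal ((norm (v N x))\<^sup>2) \<partial>M)"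
    proof (rule nn_integral_mono)
      fix x
      have "ennreal (norm (u x) * norm (v N x)) \<le> ennreal (min (norm (u x) * norm (v N x)) (K * (norm (u x))\<^sup>2) + (1 / K) * (norm (v N x))\<^sup>2)"
        by (intro ennreal_leI pt) auto
      also have "\<dots> = ennreal (min (norm (u x) * norm (v N x)) (K * (norm (u x))\<^sup>2)) + ennreal (1 / K) * ennreal ((norm (v N x))\<^sup>2)"
        using K by (subst ennreal_plus) (auto simp: ennreal_mult'[symmetric])
      finally show "ennreal (norm (u x) * norm (v N x)) \<le> \<dots>" .
    qed
    also have "\<dots> = (\<integral>\<^sup>+x. ennreal (min (norm (u x) * norm (v N x)) (K * (norm (u x))\<^sup>2)) \<partial>M)
        + ennreal (1 / K) * (\<integral>\<^sup>+x. ennreal ((norm (v N x))\<^sup>2) \<partial>M)"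
      by (simp add: nn_integral_add nn_integral_cmult)
    also have "\<dots> \<le> ennreal (\<epsilon> / 2) + ennreal (1 / K) * ennreal \<bar>C\<bar>"
      using elim order_trans[OF v ennreal_leI[OF abs_ge_self]] by (intro add_mono mult_left_mono) auto
    also have "ennreal (1 / K) * ennreal \<bar>C\<bar> = ennreal (\<bar>C\<bar> / K)"
      using K by (simp add: ennreal_mult'[symmetric])
    also have "ennreal (\<epsilon> / 2) + ennreal (\<bar>C\<bar> / K) \<le> ennreal (\<epsilon> / 2) + ennreal (\<epsilon> / 2)"
      using CK by (intro add_left_mono ennreal_leI)
    also have "\<dots> = ennreal \<epsilon>" using \<epsilon> by (simp flip: ennreal_plus)
    finally show ?case using \<epsilon> by simp
  qed
qed simp

text \<open>The theorem of F. Riesz: pointwise convergence together with norms that do not exceed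
  the limit norm asymptotically gives convergence in L^p. Scheffe's lemma is applied to the p-th
  powers of the moduli, with the factors \<open>c j\<close> controlling the limit superior. For
  dilates these factors are Jacobians.\<close>

lemma nn_integral_norm_diff_powr_tendsto_zero:
  fixes f :: "'a \<Rightarrow> complex" and F :: "nat \<Rightarrow> 'a \<Rightarrow> complex"
  assumes [measurable]: "f \<in> borel_measurable M" "\<And>j. F j \<in> borel_measurable M"
    and p: "p > 0"
    and f: "(\<integral>\<^sup>+x. ennreal (cmod (f x) powr p) \<partial>M) < \<infinity>"
    and F: "\<And>j. (\<integral>\<^sup>+x. ennreal (cmod (F j x) powr p) \<partial>M) \<le> ennreal (c j) * (\<integral>\<^sup>+x. ennreal (cmod (f x) powr p) \<partial>M)"
    and c: "c \<longlonglongrightarrow> 1"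
    and lim: "\<And>x. x \<in> space M \<Longrightarrow> (\<lambda>j. F j x) \<longlonglongrightarrow> f x"
  shows "(\<lambda>j. \<integral>\<^sup>+x. ennreal (cmod (F j x - f x) powr p) \<partial>M) \<longlonglongrightarrow> 0"
proof -
  let ?I = "\<integral>\<^sup>+x. ennreal (cmod (f x) powr p) \<partial>M"
  have "(\<lambda>j. \<integral>\<^sup>+x. norm (cmod (F j x) powr p - cmod (f x) powr p) \<partial>M) \<longlonglongrightarrow> 0"
  proof (rule Scheffe_lemma1)
    show "integrable M (\<lambda>x. cmod (f x) powr p)"
      using f by (intro integrableI_bounded) auto
    show "integrable M (\<lambda>x. cmod (F j x) powr p)" for j
      using F[of j] f by (intro integrableI_bounded) (auto simp: ennreal_mult_less_top intro: le_less_trans)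
    show "AE x in M. (\<lambda>j. cmod (F j x) powr p) \<longlonglongrightarrow> cmod (f x) powr p"
      using p by (intro AE_I2 tendsto_powr' tendsto_norm lim) auto
    have "limsup (\<lambda>j. \<integral>\<^sup>+x. ennreal (norm (cmod (F j x) powr p)) \<partial>M) \<le> limsup (\<lambda>j. ennreal (c j) * ?I)"
      using F by (intro Limsup_mono always_eventually) auto
    also have "(\<lambda>j. ennreal (c j) * ?I) \<longlonglongrightarrow> ennreal 1 * ?I"
      using f c by (intro tendsto_mult_ennreal tendsto_intros tendsto_ennrealI) auto
    then have "limsup (\<lambda>j. ennreal (c j) * ?I) = ?I"
      by (simp add: lim_imp_Limsup)
    finally show "limsup (\<lambda>j. \<integral>\<^sup>+x. ennreal (norm (cmod (F j x) powr p)) \<partial>M) \<le> (\<integral>\<^sup>+x. ennreal (norm (cmod (f x) powr p)) \<partial>M)"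
      by simp
  qed
  then have t1: "(\<lambda>j. ennreal (2 powr p) * (\<integral>\<^sup>+x. norm (cmod (F j x) powr p - cmod (f x) powr p) \<partial>M)) \<longlonglongrightarrow> ennreal (2 powr p) * 0"
    by (intro tendsto_mult_ennreal tendsto_const) auto
  have t2: "(\<lambda>j. \<integral>\<^sup>+x. ennreal (min (cmod (F j x - f x) powr p) (2 powr p * (2 * cmod (f x) powr p))) \<partial>M) \<longlonglongrightarrow> (\<integral>\<^sup>+x. 0 \<partial>M)"
  proof (rule nn_integral_dominated_convergence[where w = "\<lambda>x. ennreal (2 powr p * 2) * ennreal (cmod (f x) powr p)"])
    show "(\<integral>\<^sup>+x. ennreal (2 powr p * 2) * ennreal (cmod (f x) powr p) \<partial>M) < \<infinity>"
      using f by (simp add: nn_integral_cmult ennreal_mult_less_top)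
    show "AE x in M. ennreal (min (cmod (F j x - f x) powr p) (2 powr p * (2 * cmod (f x) powr p)))
        \<le> ennreal (2 powr p * 2) * ennreal (cmod (f x) powr p)" for j
      by (intro AE_I2) (auto simp: ennreal_mult'[symmetric] mult.assoc intro!: ennreal_leI)
    show "AE x in M. (\<lambda>j. ennreal (min (cmod (F j x - f x) powr p) (2 powr p * (2 * cmod (f x) powr p)))) \<longlonglongrightarrow> 0"
    proof (rule AE_I2)
      fix x assume x: "x \<in> space M"
      have "(\<lambda>j. cmod (F j x - f x) powr p) \<longlonglongrightarrow> cmod (f x - f x) powr p"
        using p by (intro tendsto_powr' tendsto_norm tendsto_diff lim[OF x] tendsto_const) auto
      then have "(\<lambda>j. min (cmod (F j x - f x) powr p) (2 powr p * (2 * cmod (f x) powr p)))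
        \<longlonglongrightarrow> min (cmod (f x - f x) powr p) (2 powr p * (2 * cmod (f x) powr p))"
        by (rule tendsto_min[OF _ tendsto_const])
      moreover have "min (cmod (f x - f x) powr p) (2 powr p * (2 * cmod (f x) powr p)) = 0" by simp
      ultimately show "(\<lambda>j. ennreal (min (cmod (F j x - f x) powr p) (2 powr p * (2 * cmod (f x) powr p)))) \<longlonglongrightarrow> 0"
        using tendsto_ennrealI by fastforce
    qed
  qed auto
  \<comment> \<open>In the bound \<open>2 powr p * (cmod (F j x) powr p + cmod (f x) powr p)\<close>
    the first power is replaced by that of \<open>f\<close> plus the Scheffe difference. This leaves
    a part capped by an integrable function, treated by dominated convergence, and a part that
    Scheffe's lemma sends to 0.\<close>
  have le: "(\<integral>\<^sup>+x. ennreal (cmod (F j x - f x) powr p) \<partial>M)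
      \<le> (\<integral>\<^sup>+x. ennreal (min (cmod (F j x - f x) powr p) (2 powr p * (2 * cmod (f x) powr p))) \<partial>M)
        + ennreal (2 powr p) * (\<integral>\<^sup>+x. norm (cmod (F j x) powr p - cmod (f x) powr p) \<partial>M)" for j
  proof -
    have "ennreal (cmod (F j x - f x) powr p)
      \<le> ennreal (min (cmod (F j x - f x) powr p) (2 powr p * (2 * cmod (f x) powr p)))
        + ennreal (2 powr p) * ennreal (norm (cmod (F j x) powr p - cmod (f x) powr p))" for x
    proof -
      let ?X = "cmod (F j x - f x) powr p" and ?Y = "2 powr p * (2 * cmod (f x) powr p)"
        and ?D = "2 powr p * \<bar>cmod (F j x) powr p - cmod (f x) powr p\<bar>"
      have "?X \<le> 2 powr p * (cmod (F j x) powr p + cmod (f x) powr p)"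
        using p by (intro norm_diff_powr_le) auto
      also have "\<dots> \<le> 2 powr p * (2 * cmod (f x) powr p + \<bar>cmod (F j x) powr p - cmod (f x) powr p\<bar>)"
        by (intro mult_left_mono) auto
      finally have "?X \<le> ?Y + ?D" by (simp add: distrib_left)
      moreover have "?D \<ge> 0" by simp
      ultimately have "?X \<le> min ?X ?Y + ?D" by linarith
      then have "ennreal ?X \<le> ennreal (min ?X ?Y + ?D)" by (rule ennreal_leI)
      also have "\<dots> = ennreal (min ?X ?Y) + ennreal ?D" by (rule ennreal_plus) auto
      finally show ?thesis by (simp add: ennreal_mult')
    qed
    then have "(\<integral>\<^sup>+x. ennreal (cmod (F j x - f x) powr p) \<partial>M) \<le> (\<integral>\<^sup>+x. ennreal (min (cmod (F j x - f x) powr p) (2 powr p * (2 * cmod (f x) powr p)))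
        + ennreal (2 powr p) * ennreal (norm (cmod (F j x) powr p - cmod (f x) powr p)) \<partial>M)"
      by (intro nn_integral_mono)
    then show ?thesis by (simp add: nn_integral_add nn_integral_cmult)
  qed
  have "(\<lambda>j. (\<integral>\<^sup>+x. ennreal (min (cmod (F j x - f x) powr p) (2 powr p * (2 * cmod (f x) powr p))) \<partial>M)
        + ennreal (2 powr p) * (\<integral>\<^sup>+x. norm (cmod (F j x) powr p - cmod (f x) powr p) \<partial>M)) \<longlonglongrightarrow> 0"
    using tendsto_add[OF t2 t1] by simp
  then show ?thesis
    by (rule tendsto_sandwich[OF _ _ tendsto_const, rotated 2]) (use le in auto)
qed

section \<open>Integrability on the Hartogs triangle\<close>

lemma zero_of_nn_integral_open_zero:
  fixes h :: "'a::euclidean_space \<Rightarrow> 'b::real_normed_vector"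
  assumes U: "open U" and h: "continuous_on U h"
    and zero: "(\<integral>\<^sup>+z. ennreal (norm (h z) powr s) * indicator U z \<partial>lborel) = 0"
    and z: "z \<in> U"
  shows "h z = 0"
proof (rule ccontr)
  assume nz: "h z \<noteq> 0"
  define V where "V = {z \<in> U. h z \<noteq> 0}"
  have "open (U \<inter> h -` (- {0}))"
    by (rule continuous_open_preimage[OF h U]) auto
  moreover have "V = U \<inter> h -` (- {0})" by (auto simp: V_def)
  ultimately have V: "open V" by simp
  have [measurable]: "(\<lambda>z. norm (h z) powr s * indicator U z) \<in> borel_measurable borel"
  proof -
    have "continuous_on U (\<lambda>z. norm (h z))" using h by (intro continuous_intros)
    then have [measurable]: "(\<lambda>z. indicator U z *\<^sub>R norm (h z)) \<in> borel_measurable borel"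
      using U by (intro borel_measurable_continuous_on_indicator) auto
    have [measurable]: "U \<in> sets borel" using U by simp
    have "(\<lambda>z. (indicator U z *\<^sub>R norm (h z)) powr s * indicator U z) \<in> borel_measurable borel" by measurable
    also have "(\<lambda>z. (indicator U z *\<^sub>R norm (h z)) powr s * indicator U z) = (\<lambda>z. norm (h z) powr s * indicator U z)"
      by (auto simp: indicator_def)
    finally show ?thesis .
  qed
  have eq: "(\<lambda>z. ennreal (norm (h z) powr s) * indicator U z) = (\<lambda>z. ennreal (norm (h z) powr s * indicator U z))"
    by (auto simp: indicator_def)
  have "AE z in lborel. ennreal (norm (h z) powr s * indicator U z) = 0"
    using zero unfolding eq by (subst (asm) nn_integral_0_iff_AE) auto
  then have "AE z in lborel. z \<notin> V"
    by eventually_elim (auto simp: V_def indicator_def split: if_splits)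
  then have "V \<in> null_sets lborel"
    using V by (subst (asm) AE_iff_null_sets[symmetric]) auto
  then have "negligible V"
    by (simp add: negligible_iff_null_sets null_sets_completionI)
  then have "V = {}" using open_not_negligible[OF V] by blast
  then show False using z nz by (auto simp: V_def)
qed

context hartogs
begin

text \<open>The s-th power of the L^s norm as an extended real: the value infinity marks failure of
  integrability, so estimates need no integrability side conditions.\<close>

definition pint :: "real \<Rightarrow> (complex \<times> complex \<Rightarrow> complex) \<Rightarrow> ennreal"
  where "pint s h = (\<integral>\<^sup>+z. ennreal (cmod (h z) powr s) \<partial>lebesgue_on H)"

lemma H_sets_borel [measurable, simp]: "H \<in> sets borel"
  using open_H by simp

lemma H_sets_lebesgue [measurable, simp]: "H \<in> sets lebesgue"
  by simp

lemma measurable_continuous_H: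
  "continuous_on H h \<Longrightarrow> h \<in> borel_measurable (lebesgue_on H)"
  for h :: "complex \<times> complex \<Rightarrow> 'b::{second_countable_topology, metric_space}"
  by (rule continuous_imp_measurable_on_sets_lebesgue) auto

lemma nn_integral_lebesgue_on_H:
  "(\<integral>\<^sup>+z. F z \<partial>lebesgue_on H) = (\<integral>\<^sup>+z. F z * indicator H z \<partial>lborel)"
  by (simp add: nn_integral_restrict_space nn_integral_completion)

text \<open>A function continuous on \<open>H\<close> is arbitrary elsewhere; cutting it off before
  taking the modulus to the power gives the Borel integrand that the change of variables
  requires.\<close>

lemma measurable_indicator_powr:
  fixes h :: "complex \<times> complex \<Rightarrow> complex"
  assumes h: "continuous_on H h"
  shows "(\<lambda>z. ennreal (cmod (h z) powr s) * indicator H z) \<in> borel_measurable borel"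
proof -
  have "continuous_on H (\<lambda>z. cmod (h z))" using h by (intro continuous_intros)
  then have [measurable]: "(\<lambda>z. indicator H z *\<^sub>R cmod (h z)) \<in> borel_measurable borel"
    by (intro borel_measurable_continuous_on_indicator) auto
  have "(\<lambda>z. ennreal ((indicator H z *\<^sub>R cmod (h z)) powr s) * indicator H z) \<in> borel_measurable borel"
    by measurable
  also have "(\<lambda>z. ennreal ((indicator H z *\<^sub>R cmod (h z)) powr s) * indicator H z)
      = (\<lambda>z. ennreal (cmod (h z) powr s) * indicator H z)"
    by (auto simp: indicator_def)
  finally show ?thesis .
qed

lemma emeasure_H_finite: "emeasure lborel H < \<infinity>"
  by (rule emeasure_bounded_finite[OF bounded_H])

lemma nn_integral_const_H: "(\<integral>\<^sup>+z. ennreal c \<partial>lebesgue_on H) = ennreal c * emeasure lborel H"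
  unfolding nn_integral_lebesgue_on_H by (subst nn_integral_cmult_indicator) auto

lemma Lp_space_H_iff:
  assumes "continuous_on H h"
  shows "h \<in> Lp_space s H \<longleftrightarrow> pint s h < \<infinity>"
  using measurable_continuous_H[OF assms]
  by (simp add: Lp_space_def pint_def integrable_iff_bounded)

lemma Bergman_H_iff: "h \<in> Bergman s H \<longleftrightarrow> holomorphic2_on h H \<and> pint s h < \<infinity>"
  using Lp_space_H_iff holomorphic2_on_imp_continuous_on by (auto simp: Bergman_def)

lemma Bergman_continuous: "h \<in> Bergman s H \<Longrightarrow> continuous_on H h"
  by (simp add: Bergman_H_iff holomorphic2_on_imp_continuous_on)

lemma pint_cong: "(\<And>z. z \<in> H \<Longrightarrow> f z = g z) \<Longrightarrow> pint s f = pint s g"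
  unfolding pint_def by (intro nn_integral_cong) (simp add: space_restrict_space)

lemma pint_diff_le:
  assumes "0 \<le> s" "continuous_on H f" "continuous_on H g"
  shows "pint s (\<lambda>z. f z - g z) \<le> ennreal (2 powr s) * (pint s f + pint s g)"
proof -
  have [measurable]: "f \<in> borel_measurable (lebesgue_on H)" "g \<in> borel_measurable (lebesgue_on H)"
    using assms by (auto intro: measurable_continuous_H)
  have "pint s (\<lambda>z. f z - g z) \<le> (\<integral>\<^sup>+z. ennreal (2 powr s) * (ennreal (cmod (f z) powr s) + ennreal (cmod (g z) powr s)) \<partial>lebesgue_on H)"
    unfolding pint_def
    using norm_diff_powr_le[OF assms(1)]
    by (intro nn_integral_mono) (simp add: ennreal_mult'[symmetric] flip: ennreal_plus)
  also have "\<dots> = ennreal (2 powr s) * (pint s f + pint s g)"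
    unfolding pint_def by (simp add: nn_integral_cmult nn_integral_add)
  finally show ?thesis .
qed

lemma Bergman_diff:
  assumes "0 \<le> s" "f \<in> Bergman s H" "g \<in> Bergman s H"
  shows "(\<lambda>z. f z - g z) \<in> Bergman s H"
  using assms pint_diff_le[of s f g] Bergman_continuous[of f s] Bergman_continuous[of g s]
  by (auto simp: Bergman_H_iff holomorphic2_on_diff ennreal_mult_less_top intro: le_less_trans)

text \<open>The free parameter \<open>\<delta>\<close> lets this bound replace Hoelder's inequality.\<close>

lemma pint_le_pint:
  assumes q: "0 \<le> q" "q \<le> p" and \<delta>: "\<delta> > 0" and h: "continuous_on H h"
  shows "pint q h \<le> ennreal (\<delta> powr q) * emeasure lborel H + ennreal (\<delta> powr (q - p)) * pint p h"
proof -
  have [measurable]: "h \<in> borel_measurable (lebesgue_on H)"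
    using h by (rule measurable_continuous_H)
  have pt: "t powr q \<le> \<delta> powr q + \<delta> powr (q - p) * t powr p" if "0 \<le> t" for t
  proof (cases "t \<le> \<delta>")
    case True
    then have "t powr q \<le> \<delta> powr q" using that q by (intro powr_mono2) auto
    then show ?thesis by (simp add: add_increasing2)
  next
    case False
    then have "t powr q = t powr (q - p) * t powr p" using \<delta> by (simp flip: powr_add)
    also have "\<dots> \<le> \<delta> powr (q - p) * t powr p"
      using False \<delta> q by (intro mult_right_mono powr_mono2') auto
    finally show ?thesis by (simp add: add_increasing)
  qed
  have "pint q h \<le> (\<integral>\<^sup>+z. ennreal (\<delta> powr q) + ennreal (\<delta> powr (q - p)) * ennreal (cmod (h z) powr p) \<partial>lebesgue_on H)"
    unfolding pint_def using pt
    by (intro nn_integral_mono) (simp add: ennreal_mult'[symmetric] flip: ennreal_plus)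
  also have "\<dots> = ennreal (\<delta> powr q) * emeasure lborel H + ennreal (\<delta> powr (q - p)) * pint p h"
    unfolding pint_def by (subst nn_integral_add) (simp_all only: nn_integral_const_H, simp_all add: nn_integral_cmult)
  finally show ?thesis .
qed

lemma Bergman_mono:
  assumes "0 \<le> q" "q \<le> p"
  shows "Bergman p H \<subseteq> Bergman q H"
proof
  fix h assume h: "h \<in> Bergman p H"
  have "pint q h \<le> ennreal 1 * emeasure lborel H + ennreal 1 * pint p h"
    using pint_le_pint[OF assms, of 1 h] Bergman_continuous[OF h] by simp
  also have "\<dots> < \<infinity>" using h emeasure_H_finite by (simp add: Bergman_H_iff)
  finally show "h \<in> Bergman q H" using h by (simp add: Bergman_H_iff)
qed

section \<open>Approximability expressed through power integrals\<close>

lemma Lp_norm_less_iff: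
  assumes s: "s > 0" and \<epsilon>: "\<epsilon> > 0" and h: "continuous_on H h" and fin: "pint s h < \<infinity>"
  shows "Lp_norm s H h < \<epsilon> \<longleftrightarrow> pint s h < ennreal (\<epsilon> powr s)"
proof -
  define I where "I = enn2real (pint s h)"
  have I: "pint s h = ennreal I" "I \<ge> 0" using fin by (auto simp: I_def)
  have [measurable]: "h \<in> borel_measurable (lebesgue_on H)"
    using h by (rule measurable_continuous_H)
  have "(LINT z|lebesgue_on H. cmod (h z) powr s) = I"
    unfolding I_def pint_def by (rule integral_eq_nn_integral) auto
  then have "Lp_norm s H h = I powr (1 / s)" by (simp add: Lp_norm_def)
  moreover have "I powr (1 / s) < \<epsilon> \<longleftrightarrow> I < \<epsilon> powr s"
  proof
    assume "I powr (1 / s) < \<epsilon>"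
    then have "(I powr (1 / s)) powr s < \<epsilon> powr s" using s by (intro powr_less_mono2) auto
    then show "I < \<epsilon> powr s" using s I by (simp add: powr_powr)
  next
    assume "I < \<epsilon> powr s"
    then have "I powr (1 / s) < (\<epsilon> powr s) powr (1 / s)" using s I by (intro powr_less_mono2) auto
    then show "I powr (1 / s) < \<epsilon>" using s \<epsilon> by (simp add: powr_powr)
  qed
  ultimately show ?thesis using I by (simp add: ennreal_less_iff)
qed

lemma Lp_approximable_H_iff:
  assumes s: "s > 0" and f: "f \<in> Bergman s H" and S: "S \<subseteq> Bergman s H"
  shows "Lp_approximable s H S f \<longleftrightarrow> (\<forall>\<epsilon>>0. \<exists>g\<in>S. pint s (\<lambda>z. f z - g z) < ennreal \<epsilon>)"
proof -
  have iff: "Lp_norm s H (\<lambda>z. f z - g z) < \<epsilon> \<longleftrightarrow> pint s (\<lambda>z. f z - g z) < ennreal (\<epsilon> powr s)"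
    if "\<epsilon> > 0" "g \<in> S" for g \<epsilon>
  proof -
    have "(\<lambda>z. f z - g z) \<in> Bergman s H" using s f S that by (intro Bergman_diff) auto
    then show ?thesis
      using s that by (intro Lp_norm_less_iff) (auto simp: Bergman_H_iff holomorphic2_on_imp_continuous_on)
  qed
  show ?thesis
  proof
    assume L: "Lp_approximable s H S f"
    show "\<forall>\<epsilon>>0. \<exists>g\<in>S. pint s (\<lambda>z. f z - g z) < ennreal \<epsilon>"
    proof (intro allI impI)
      fix \<epsilon> :: real assume "\<epsilon> > 0"
      then obtain g where "g \<in> S" "Lp_norm s H (\<lambda>z. f z - g z) < \<epsilon> powr (1 / s)"
        using L unfolding Lp_approximable_def by (metis powr_gt_zero less_numeral_extra(3))
      then show "\<exists>g\<in>S. pint s (\<lambda>z. f z - g z) < ennreal \<epsilon>"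
        using iff[of "\<epsilon> powr (1 / s)" g] s \<open>\<epsilon> > 0\<close> by (auto simp: powr_powr)
    qed
  next
    assume R: "\<forall>\<epsilon>>0. \<exists>g\<in>S. pint s (\<lambda>z. f z - g z) < ennreal \<epsilon>"
    show "Lp_approximable s H S f"
      unfolding Lp_approximable_def
    proof (intro allI impI)
      fix \<epsilon> :: real assume "\<epsilon> > 0"
      then obtain g where "g \<in> S" "pint s (\<lambda>z. f z - g z) < ennreal (\<epsilon> powr s)"
        using R by (metis powr_gt_zero less_numeral_extra(3))
      then show "\<exists>g\<in>S. Lp_norm s H (\<lambda>z. f z - g z) < \<epsilon>"
        using iff[of \<epsilon> g] \<open>\<epsilon> > 0\<close> by auto
    qed
  qed
qed

lemma Lp_approximable_mono:
  assumes q: "0 < q" "q \<le> p" and f: "f \<in> Bergman p H" and S: "S \<subseteq> Bergman p H"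
    and approx: "Lp_approximable p H S f"
  shows "Lp_approximable q H S f"
proof -
  have f': "f \<in> Bergman q H" and S': "S \<subseteq> Bergman q H"
    using Bergman_mono[of q p] q f S by auto
  define B where "B = measure lborel H"
  have B: "emeasure lborel H = ennreal B" "B \<ge> 0"
    using emeasure_H_finite by (auto simp: B_def emeasure_eq_ennreal_measure)
  show ?thesis
    unfolding Lp_approximable_H_iff[OF q(1) f' S']
  proof (intro allI impI)
    fix \<epsilon> :: real assume \<epsilon>: "\<epsilon> > 0"
    \<comment> \<open>The free parameter is fixed before the approximant: it makes the volume term
      at most \<open>\<epsilon> / 4\<close>. Only then is \<open>g\<close> chosen, small enough to
      absorb the factor \<open>\<delta> powr (q - p)\<close>. The summand 1 allows
      \<open>B = 0\<close>.\<close>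
    define \<delta> where "\<delta> = (\<epsilon> / (4 * (B + 1))) powr (1 / q)"
    have \<delta>: "\<delta> > 0" "\<delta> powr q * B \<le> \<epsilon> / 4"
      using B \<epsilon> q by (auto simp: \<delta>_def powr_powr field_simps)
    have "\<forall>\<epsilon>>0. \<exists>g\<in>S. pint p (\<lambda>z. f z - g z) < ennreal \<epsilon>"
      using approx Lp_approximable_H_iff[of p f S] q f S by simp
    moreover have "\<epsilon> / 2 / \<delta> powr (q - p) > 0" using \<epsilon> \<delta> by simp
    ultimately obtain g where g: "g \<in> S" "pint p (\<lambda>z. f z - g z) < ennreal (\<epsilon> / 2 / \<delta> powr (q - p))"
      by blast
    have c: "continuous_on H (\<lambda>z. f z - g z)"
      using f S g by (intro continuous_intros Bergman_continuous) auto
    have "pint q (\<lambda>z. f z - g z) \<le> ennreal (\<delta> powr q) * ennreal B + ennreal (\<delta> powr (q - p)) * pint p (\<lambda>z. f z - g z)"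
      using pint_le_pint[of q p \<delta>, OF _ q(2) \<delta>(1) c] q B by simp
    also have "\<dots> \<le> ennreal (\<epsilon> / 4) + ennreal (\<epsilon> / 2)"
    proof (rule add_mono)
      show "ennreal (\<delta> powr q) * ennreal B \<le> ennreal (\<epsilon> / 4)"
        using \<delta> B by (simp add: ennreal_mult'[symmetric] ennreal_leI)
      have "ennreal (\<delta> powr (q - p)) * pint p (\<lambda>z. f z - g z)
        \<le> ennreal (\<delta> powr (q - p)) * ennreal (\<epsilon> / 2 / \<delta> powr (q - p))"
        using g(2) by (intro mult_left_mono) auto
      also have "\<dots> = ennreal (\<epsilon> / 2)" using \<delta> \<epsilon> by (simp add: ennreal_mult'[symmetric])
      finally show "ennreal (\<delta> powr (q - p)) * pint p (\<lambda>z. f z - g z) \<le> ennreal (\<epsilon> / 2)" .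
    qed
    also have "\<dots> < ennreal \<epsilon>" using \<epsilon> by (simp add: ennreal_less_iff flip: ennreal_plus)
    finally show "\<exists>g\<in>S. pint q (\<lambda>z. f z - g z) < ennreal \<epsilon>" using g(1) by blast
  qed
qed

section \<open>Power integrals under the circle action and diagonal maps\<close>

lemma pint_twist_unimodular:
  assumes c: "cmod c = 1" and h: "continuous_on H h"
  shows "pint s (\<lambda>z. h (twist c z)) = pint s h"
proof -
  have "c \<noteq> 0" using c by auto
  have "(\<integral>\<^sup>+z. ennreal (cmod (h (twist c z)) powr s) * indicator H (twist c z) \<partial>lborel)
      = (\<integral>\<^sup>+z. ennreal (cmod (h z) powr s) * indicator H z \<partial>lborel)"
    using nn_integral_complex_diagonal[OF _ _ measurable_indicator_powr[OF h, of s], of "c ^ n" "c ^ m"] \<open>c \<noteq> 0\<close> c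
    by (simp add: twist_def norm_power)
  moreover have "indicator H (twist c z) = (indicator H z :: ennreal)" for z
    using twist_mem_iff[OF c] by (simp add: indicator_def)
  ultimately show ?thesis
    by (simp add: pint_def nn_integral_lebesgue_on_H)
qed

text \<open>Only an inequality, because the image of \<open>H\<close> may be a proper part of
  \<open>H\<close>; the constant is the inverse Jacobian.\<close>

lemma pint_diagonal_le:
  assumes ab: "a \<noteq> 0" "b \<noteq> 0" and h: "continuous_on H h"
    and mem: "\<And>z. z \<in> H \<Longrightarrow> (a * fst z, b * snd z) \<in> H"
  shows "pint s (\<lambda>z. h (a * fst z, b * snd z)) \<le> ennreal (1 / ((cmod a)\<^sup>2 * (cmod b)\<^sup>2)) * pint s h"
proof -
  let ?d = "(cmod a)\<^sup>2 * (cmod b)\<^sup>2"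
  let ?G = "\<lambda>z. ennreal (cmod (h z) powr s) * indicator H z"
  have d: "?d > 0" using ab by simp
  have "pint s (\<lambda>z. h (a * fst z, b * snd z)) \<le> (\<integral>\<^sup>+z. ?G (a * fst z, b * snd z) \<partial>lborel)"
    unfolding pint_def nn_integral_lebesgue_on_H
    using mem by (intro nn_integral_mono) (auto simp: indicator_def)
  also have "\<dots> = ennreal (1 / ?d) * (ennreal ?d * (\<integral>\<^sup>+z. ?G (a * fst z, b * snd z) \<partial>lborel))"
    using d ab by (simp add: mult.assoc[symmetric] ennreal_mult'[symmetric])
  also have "ennreal ?d * (\<integral>\<^sup>+z. ?G (a * fst z, b * snd z) \<partial>lborel) = pint s h"
    unfolding pint_def nn_integral_lebesgue_on_H
    by (rule nn_integral_complex_diagonal[OF ab measurable_indicator_powr[OF h]])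
  finally show ?thesis .
qed

lemma continuous_on_weight_avg:
  assumes f: "continuous_on H f"
  shows "continuous_on H (weight_avg N k f)"
  unfolding weight_avg_def[abs_def]
  by (intro continuous_on_divide continuous_on_sum continuous_on_mult continuous_on_const
      continuous_on_twist[OF f] continuous_on_id) (simp_all add: twist_mem_iff del: of_nat_Suc)

text \<open>Jensen's inequality for the mean, followed by the invariance of the integral under each
  of the rotations.\<close>

lemma pint_weight_avg_le:
  assumes s: "s \<ge> 1" and f: "continuous_on H f"
  shows "pint s (weight_avg N k f) \<le> pint s f"
proof -
  define c where "c = (\<lambda>j. cis (2 * pi * (real j / real (Suc N))))"
  have cont: "continuous_on H (\<lambda>z. f (twist (c j) z))" for j
    by (intro continuous_on_twist[OF f] continuous_intros) (auto simp: twist_mem_iff c_def)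
  have [measurable]: "(\<lambda>z. f (twist (c j) z)) \<in> borel_measurable (lebesgue_on H)" for j
    by (rule measurable_continuous_H[OF cont])
  have "pint s (weight_avg N k f) \<le> (\<integral>\<^sup>+z. (\<Sum>j<Suc N. ennreal (1 / real (Suc N)) * ennreal (cmod (f (twist (c j) z)) powr s)) \<partial>lebesgue_on H)"
    unfolding pint_def
  proof (rule nn_integral_mono)
    fix z
    have "cmod (weight_avg N k f z) powr s \<le> (\<Sum>j<Suc N. cmod (f (twist (c j) z) * cis (- (2 * pi * of_int k * (real j / real (Suc N))))) powr s) / real (Suc N)"
      unfolding weight_avg_def c_def by (rule norm_mean_powr_le[OF s])
    also have "\<dots> = (\<Sum>j<Suc N. 1 / real (Suc N) * cmod (f (twist (c j) z)) powr s)"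
      by (simp add: norm_mult sum_divide_distrib del: sum.lessThan_Suc)
    finally have "ennreal (cmod (weight_avg N k f z) powr s) \<le> ennreal (\<Sum>j<Suc N. 1 / real (Suc N) * cmod (f (twist (c j) z)) powr s)"
      by (rule ennreal_leI)
    also have "\<dots> = (\<Sum>j<Suc N. ennreal (1 / real (Suc N) * cmod (f (twist (c j) z)) powr s))"
      by (rule sum_ennreal[symmetric]) auto
    also have "\<dots> = (\<Sum>j<Suc N. ennreal (1 / real (Suc N)) * ennreal (cmod (f (twist (c j) z)) powr s))"
      by (intro sum.cong refl ennreal_mult) auto
    finally show "ennreal (cmod (weight_avg N k f z) powr s) \<le> \<dots>" .
  qed
  also have "\<dots> = (\<Sum>j<Suc N. ennreal (1 / real (Suc N)) * pint s (\<lambda>z. f (twist (c j) z)))"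
    unfolding pint_def by (subst nn_integral_sum) (simp_all add: nn_integral_cmult del: sum.lessThan_Suc)
  also have "\<dots> = (\<Sum>j<Suc N. ennreal (1 / real (Suc N)) * pint s f)"
    by (simp add: pint_twist_unimodular[OF _ f] c_def del: sum.lessThan_Suc)
  also have "\<dots> = (ennreal (real (Suc N)) * ennreal (1 / real (Suc N))) * pint s f"
    by (simp only: sum_constant card_lessThan ennreal_of_nat_eq_real_of_nat mult.assoc)
  also have "ennreal (real (Suc N)) * ennreal (1 / real (Suc N)) = 1"
    by (simp add: ennreal_mult'[symmetric] del: of_nat_Suc)
  finally show ?thesis by simp
qed

text \<open>Fatou's lemma carries the contraction property from the finite averages to their
  pointwise limit.\<close>

lemma pint_weight_part_le:
  assumes s: "s \<ge> 1" and f: "continuous_on H f"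
  shows "pint s (weight_part k f) \<le> pint s f"
proof -
  have [measurable]: "weight_avg N k f \<in> borel_measurable (lebesgue_on H)" for N
    by (rule measurable_continuous_H[OF continuous_on_weight_avg[OF f]])
  have "pint s (weight_part k f) = (\<integral>\<^sup>+z. liminf (\<lambda>N. ennreal (cmod (weight_avg N k f z) powr s)) \<partial>lebesgue_on H)"
    unfolding pint_def
  proof (intro nn_integral_cong)
    fix z assume "z \<in> space (lebesgue_on H)"
    then have z: "z \<in> H" by simp
    have "(\<lambda>N. cmod (weight_avg N k f z) powr s) \<longlonglongrightarrow> cmod (weight_part k f z) powr s"
      using s by (intro tendsto_powr' tendsto_norm weight_avg_tendsto[OF f z]) auto
    then show "ennreal (cmod (weight_part k f z) powr s) = liminf (\<lambda>N. ennreal (cmod (weight_avg N k f z) powr s))"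
      by (intro lim_imp_Liminf[symmetric] tendsto_ennrealI) auto
  qed
  also have "\<dots> \<le> liminf (\<lambda>N. pint s (weight_avg N k f))"
    unfolding pint_def by (rule nn_integral_liminf) simp
  also have "\<dots> \<le> liminf (\<lambda>N. pint s f)"
    using pint_weight_avg_le[OF s f] by (intro Liminf_mono always_eventually) auto
  finally show ?thesis by (simp add: Liminf_const)
qed

lemma zero_of_pint_zero:
  assumes "continuous_on H h" "pint s h = 0" "z \<in> H"
  shows "h z = 0"
  using zero_of_nn_integral_open_zero[OF open_H assms(1) _ assms(3)] assms(2)
  by (simp add: pint_def nn_integral_lebesgue_on_H)

end

section \<open>Low weights and orthogonality\<close>

context hartogs
begin

text \<open>The weight-\<open>k\<close> part scales by \<open>c\<^sup>k\<close> under \<open>twist c\<close>, so for these weights its \<open>L\<^sup>s\<close> mass cannot decrease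
  under restriction to a neighbourhood of the origin.\<close>

lemma weight_part_eq_zero:
  assumes h: "h \<in> Bergman s H" and s: "s \<ge> 1"
    and k: "of_int k * s + 2 * (real m + real n) \<le> 0" and z: "z \<in> H"
  shows "weight_part k h z = 0"
proof -
  have hol: "holomorphic2_on h H" and fin: "pint s h < \<infinity>" using h by (auto simp: Bergman_H_iff)
  define u where "u = weight_part k h"
  have cu: "continuous_on H u"
    unfolding u_def using continuous_on_weight_part[OF holomorphic2_on_imp_continuous_on[OF hol]] .
  have finu: "pint s u < \<infinity>"
    using pint_weight_part_le[OF s Bergman_continuous[OF h], of k] fin by (simp add: u_def)
  \<comment> \<open>Half the modulus puts the given point outside \<open>E\<close>, while
    \<open>c ^ m = q\<close> makes \<open>twist c\<close> map all of \<open>H\<close> into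
    \<open>E\<close>.\<close>
  define q where "q = cmod (snd z) / 2"
  define c where "c = root m q"
  have q: "0 < q" "q < 1" "q < cmod (snd z)"
    using snd_nonzero[OF z] z by (auto simp: q_def mem_H_iff)
  have c: "0 < c" "c < 1" "c ^ m = q"
    using q m_pos by (auto simp: c_def)
  define E where "E = {w \<in> H. cmod (snd w) < q}"
  have openE: "open E"
  proof -
    have "E = H \<inter> {w. cmod (snd w) < q}" by (auto simp: E_def)
    then show ?thesis using open_H by (auto intro!: open_Int open_Collect_less continuous_intros)
  qed
  let ?U = "\<lambda>w. ennreal (cmod (u w) powr s) * indicator H w"
  let ?G = "\<lambda>w. ?U w * indicator E w"
  have mU [measurable]: "?U \<in> borel_measurable borel" by (rule measurable_indicator_powr[OF cu])
  have [measurable]: "E \<in> sets borel" using openE by simp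
  have twist_E: "twist (of_real c) w \<in> E" if "w \<in> H" for w
  proof -
    have "c ^ m * cmod (snd w) < c ^ m * 1"
      using that c by (intro mult_strict_left_mono) (auto simp: mem_H_iff)
    then show ?thesis
      using twist_mem_le[of w "of_real c"] that c
      by (auto simp: E_def twist_def norm_mult norm_power)
  qed
  have scale: "?G (twist (of_real c) w) = ennreal (c powr (of_int k * s)) * ?U w" if "w \<in> H" for w
  proof -
    have "cmod (u (twist (of_real c) w)) = c powr of_int k * cmod (u w)"
      unfolding u_def using weight_part_twist_real[OF hol that, of c k] c
      by (simp add: norm_mult norm_power_int powr_real_of_int')
    then have "cmod (u (twist (of_real c) w)) powr s = c powr (of_int k * s) * cmod (u w) powr s"
      by (simp add: powr_mult powr_powr)
    then show ?thesis
      using twist_E[OF that] that by (simp add: E_def ennreal_mult')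
  qed
  define d where "d = (cmod (of_real c ^ n))\<^sup>2 * (cmod (of_real c ^ m))\<^sup>2"
  have d: "d = c powr (2 * (real m + real n))"
  proof -
    have "d = c ^ (2 * (m + n))"
      using c(1) by (simp add: d_def norm_power power_mult[symmetric] power_add[symmetric] algebra_simps)
    also have "\<dots> = c powr real (2 * (m + n))" by (rule powr_realpow[symmetric]) (rule c(1))
    finally show ?thesis by simp
  qed
  have "ennreal (d * c powr (of_int k * s)) * pint s u
      = ennreal d * (\<integral>\<^sup>+w. ennreal (c powr (of_int k * s)) * ?U w \<partial>lborel)"
    by (simp add: pint_def nn_integral_lebesgue_on_H nn_integral_cmult ennreal_mult' d mult.assoc)
  also have "\<dots> \<le> ennreal d * (\<integral>\<^sup>+w. ?G (twist (of_real c) w) \<partial>lborel)"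
  proof (intro mult_left_mono nn_integral_mono)
    fix w
    show "ennreal (c powr (of_int k * s)) * ?U w \<le> ?G (twist (of_real c) w)"
      using scale[of w] by (cases "w \<in> H") simp_all
  qed simp
  also have "\<dots> = (\<integral>\<^sup>+w. ?G w \<partial>lborel)"
    unfolding d_def twist_def using c by (intro nn_integral_complex_diagonal) auto
  finally have "ennreal (d * c powr (of_int k * s)) * pint s u \<le> (\<integral>\<^sup>+w. ?G w \<partial>lborel)" .
  \<comment> \<open>The Jacobian and the homogeneity combine to \<open>c\<close> to the power
    \<open>k * s + 2 * (m + n)\<close>, which is at least 1 since \<open>c < 1\<close> and the
    exponent is not positive.\<close>
  moreover have "1 \<le> d * c powr (of_int k * s)"
  proof -
    have "d * c powr (of_int k * s) = c powr (of_int k * s + 2 * (real m + real n))"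
      using c by (simp add: d powr_add mult.commute)
    moreover have "c powr 0 \<le> c powr (of_int k * s + 2 * (real m + real n))"
      using c k by (intro powr_mono') auto
    ultimately show ?thesis using c by simp
  qed
  then have "1 * pint s u \<le> ennreal (d * c powr (of_int k * s)) * pint s u"
    by (intro mult_right_mono) auto
  ultimately have le: "pint s u \<le> (\<integral>\<^sup>+w. ?G w \<partial>lborel)" by simp
  have "pint s u = (\<integral>\<^sup>+w. ?G w + ?U w * indicator (- E) w \<partial>lborel)"
    unfolding pint_def nn_integral_lebesgue_on_H
    by (intro nn_integral_cong) (auto simp: indicator_def)
  also have "\<dots> = (\<integral>\<^sup>+w. ?G w \<partial>lborel) + (\<integral>\<^sup>+w. ?U w * indicator (- E) w \<partial>lborel)"
    by (rule nn_integral_add) auto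
  finally have eq: "pint s u = (\<integral>\<^sup>+w. ?G w \<partial>lborel) + (\<integral>\<^sup>+w. ?U w * indicator (- E) w \<partial>lborel)" .
  \<comment> \<open>The mass in \<open>E\<close> is already the whole mass; cancelling it uses that
    the whole mass is finite.\<close>
  then have "(\<integral>\<^sup>+w. ?U w * indicator (- E) w \<partial>lborel) = 0"
    using le finu ennreal_add_left_cancel_le[of "\<integral>\<^sup>+w. ?G w \<partial>lborel" "\<integral>\<^sup>+w. ?U w * indicator (- E) w \<partial>lborel" 0]
    by auto
  \<comment> \<open>The strict inequality yields an open set outside \<open>E\<close> that still
    contains \<open>z\<close>, so vanishing of the integral forces vanishing at the point.\<close>
  moreover define V where "V = H \<inter> {w. q < cmod (snd w)}"
  have "(\<integral>\<^sup>+w. ennreal (cmod (u w) powr s) * indicator V w \<partial>lborel) \<le> (\<integral>\<^sup>+w. ?U w * indicator (- E) w \<partial>lborel)"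
    by (intro nn_integral_mono) (auto simp: indicator_def V_def E_def)
  ultimately have zero: "(\<integral>\<^sup>+w. ennreal (cmod (u w) powr s) * indicator V w \<partial>lborel) = 0" by simp
  have "open V" unfolding V_def
    using open_H by (auto intro!: open_Int open_Collect_less continuous_intros)
  moreover have "continuous_on V u" using cu by (rule continuous_on_subset) (auto simp: V_def)
  ultimately show ?thesis
    using zero_of_nn_integral_open_zero[OF _ _ zero, of z] z q by (simp add: V_def u_def)
qed

text \<open>Invariance of the measure itself, and not only of nonnegative integrals, transfers to
  complex-valued integrals without any integrability assumption.\<close>

lemma distr_twist:
  assumes c: "cmod c = 1"
  shows "distr lborel borel (twist c) = lborel"
proof (rule measure_eqI)
  have [measurable]: "twist c \<in> borel_measurable borel"
    unfolding twist_def by (intro borel_measurable_continuous_onI continuous_intros)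
  fix A assume "A \<in> sets (distr lborel borel (twist c))"
  then have [measurable]: "A \<in> sets borel" by simp
  have "c \<noteq> 0" using c by auto
  have "emeasure (distr lborel borel (twist c)) A = (\<integral>\<^sup>+z. indicator A z \<partial>distr lborel borel (twist c))"
    by simp
  also have "\<dots> = (\<integral>\<^sup>+z. indicator A (twist c z) \<partial>lborel)"
    by (rule nn_integral_distr) auto
  also have "\<dots> = (\<integral>\<^sup>+z. indicator A z \<partial>lborel)"
    using nn_integral_complex_diagonal[of "c ^ n" "c ^ m" "indicator A"] c \<open>c \<noteq> 0\<close>
    by (simp add: twist_def norm_power)
  finally show "emeasure (distr lborel borel (twist c)) A = emeasure lborel A" by simp
qed simp

lemma integral_twist_unimodular:
  fixes g :: "complex \<times> complex \<Rightarrow> complex"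
  assumes c: "cmod c = 1" and g: "continuous_on H g"
  shows "(LINT z|lebesgue_on H. g (twist c z)) = (LINT z|lebesgue_on H. g z)"
proof -
  have conv: "(LINT z|lebesgue_on H. h z) = (LINT z|lborel. indicator H z *\<^sub>R h z)"
    if "continuous_on H h" for h :: "complex \<times> complex \<Rightarrow> complex"
    using borel_measurable_continuous_on_indicator[OF H_sets_borel that]
    by (simp add: integral_restrict_space integral_completion)
  have [measurable]: "twist c \<in> borel_measurable borel"
    unfolding twist_def by (intro borel_measurable_continuous_onI continuous_intros)
  have cont: "continuous_on H (\<lambda>z. g (twist c z))"
    by (intro continuous_on_twist[OF g] continuous_intros) (auto simp: twist_mem_iff c)
  have "(LINT z|lborel. indicator H z *\<^sub>R g (twist c z)) = (LINT z|lborel. indicator H (twist c z) *\<^sub>R g (twist c z))"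
    by (rule Bochner_Integration.integral_cong) (simp_all add: indicator_def twist_mem_iff c)
  also have "\<dots> = (LINT z|distr lborel borel (twist c). indicator H z *\<^sub>R g z)"
    by (rule integral_distr[symmetric])
       (auto intro: borel_measurable_continuous_on_indicator[OF H_sets_borel g])
  finally show ?thesis by (simp add: conv cont g distr_twist[OF c])
qed

lemma integrable_mult_cnj:
  assumes "continuous_on H u" "continuous_on H v" "pint 2 u < \<infinity>" "pint 2 v < \<infinity>"
  shows "integrable (lebesgue_on H) (\<lambda>z. u z * cnj (v z))"
proof (rule integrableI_bounded)
  have [measurable]: "u \<in> borel_measurable (lebesgue_on H)" "v \<in> borel_measurable (lebesgue_on H)"
    using assms by (auto intro: measurable_continuous_H)
  show "(\<lambda>z. u z * cnj (v z)) \<in> borel_measurable (lebesgue_on H)"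
    using assms by (intro measurable_continuous_H continuous_intros)
  have "(\<integral>\<^sup>+z. ennreal (norm (u z * cnj (v z))) \<partial>lebesgue_on H)
      \<le> (\<integral>\<^sup>+z. ennreal (cmod (u z) powr 2) + ennreal (cmod (v z) powr 2) \<partial>lebesgue_on H)"
  proof (rule nn_integral_mono)
    fix z
    have "norm (u z * cnj (v z)) \<le> cmod (u z) powr 2 + cmod (v z) powr 2"
    proof -
      have "2 * cmod (u z) * cmod (v z) \<le> (cmod (u z))\<^sup>2 + (cmod (v z))\<^sup>2"
        by (rule sum_squares_bound)
      moreover have "0 \<le> cmod (u z) * cmod (v z)" by simp
      ultimately have "cmod (u z) * cmod (v z) \<le> (cmod (u z))\<^sup>2 + (cmod (v z))\<^sup>2" by linarith
      then show ?thesis by (simp add: norm_mult)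
    qed
    then show "ennreal (norm (u z * cnj (v z))) \<le> ennreal (cmod (u z) powr 2) + ennreal (cmod (v z) powr 2)"
      by (simp add: ennreal_leI flip: ennreal_plus del: powr_numeral)
  qed
  also have "\<dots> = pint 2 u + pint 2 v"
    unfolding pint_def by (rule nn_integral_add) auto
  also have "\<dots> < \<infinity>" using assms by simp
  finally show "(\<integral>\<^sup>+z. ennreal (norm (u z * cnj (v z))) \<partial>lebesgue_on H) < \<infinity>" .
qed

text \<open>Selfadjointness in a form that is exact for every \<open>N\<close>: the character in
  each summand is absorbed by rotating the weight part, and rotation invariance then turns the
  summand into the unrotated inner product.\<close>

lemma L2_inner_weight_avg:
  assumes f: "continuous_on H f" "pint 2 f < \<infinity>" and h: "continuous_on H h" "pint 2 h < \<infinity>"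
  shows "L2_inner H (weight_part k f) (weight_avg N k h) = L2_inner H (weight_part k f) h"
proof -
  define u where "u = weight_part k f"
  have cu: "continuous_on H u" unfolding u_def by (rule continuous_on_weight_part[OF f(1)])
  have fu: "pint 2 u < \<infinity>"
    unfolding u_def using pint_weight_part_le[of 2 f k] f by (simp add: le_less_trans)
  define a where "a = (\<lambda>j. real j / real (Suc N))"
  have a: "0 \<le> a j" "a j \<le> 1" if "j < Suc N" for j using that by (auto simp: a_def)
  define c where "c = (\<lambda>j. cis (2 * pi * a j))"
  have c1: "cmod (c j) = 1" for j by (simp add: c_def)
  \<comment> \<open>Conjugation turns the factor into the positive character, by which the weight
    part is multiplied under the same rotation.\<close>
  have shift: "u z * cnj (h (twist (c j) z) * cis (- (2 * pi * of_int k * a j)))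
      = u (twist (c j) z) * cnj (h (twist (c j) z))" if "j < Suc N" for j z
    unfolding u_def c_def by (subst weight_part_twist_cis) (use a[OF that] in \<open>auto simp: cis_cnj\<close>)
  have ch: "continuous_on H (\<lambda>z. h (twist (c j) z))" for j
    by (intro continuous_on_twist[OF h(1)] continuous_on_id continuous_on_const) (auto simp: twist_mem_iff c1)
  have cuj: "continuous_on H (\<lambda>z. u (twist (c j) z))" for j
    by (intro continuous_on_twist[OF cu] continuous_on_id continuous_on_const) (auto simp: twist_mem_iff c1)
  have integrable: "integrable (lebesgue_on H) (\<lambda>z. u (twist (c j) z) * cnj (h (twist (c j) z)))" for j
    using integrable_mult_cnj[OF cuj ch] fu h(2)
    by (simp add: pint_twist_unimodular[OF c1 cu] pint_twist_unimodular[OF c1 h(1)])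
  have "L2_inner H u (weight_avg N k h)
      = (LINT z|lebesgue_on H. (\<Sum>j<Suc N. u (twist (c j) z) * cnj (h (twist (c j) z))) / of_nat (Suc N))"
    unfolding L2_inner_def
  proof (rule Bochner_Integration.integral_cong[OF refl])
    fix z
    have "u z * cnj (weight_avg N k h z)
      = (\<Sum>j<Suc N. u z * cnj (h (twist (c j) z) * cis (- (2 * pi * of_int k * a j)))) / of_nat (Suc N)"
      by (simp add: weight_avg_def c_def a_def sum_distrib_left del: sum.lessThan_Suc of_nat_Suc)
    also have "\<dots> = (\<Sum>j<Suc N. u (twist (c j) z) * cnj (h (twist (c j) z))) / of_nat (Suc N)"
      using shift by (intro arg_cong2[where f = "(/)"] sum.cong refl) auto
    finally show "u z * cnj (weight_avg N k h z) = \<dots>" .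
  qed
  also have "\<dots> = (\<Sum>j<Suc N. LINT z|lebesgue_on H. u (twist (c j) z) * cnj (h (twist (c j) z))) / of_nat (Suc N)"
    using integrable by (simp del: sum.lessThan_Suc of_nat_Suc)
  also have "\<dots> = (\<Sum>j<Suc N. L2_inner H u h) / of_nat (Suc N)"
  proof (intro arg_cong2[where f = "(/)"] sum.cong refl)
    fix j
    show "(LINT z|lebesgue_on H. u (twist (c j) z) * cnj (h (twist (c j) z))) = L2_inner H u h"
      unfolding L2_inner_def
      using integral_twist_unimodular[OF c1[of j], of "\<lambda>z. u z * cnj (h z)"] cu h
      by (simp add: continuous_intros)
  qed
  also have "\<dots> = L2_inner H u h" by (simp del: of_nat_Suc)
  finally show ?thesis by (simp add: u_def)
qed

text \<open>The inner product with the averages of \<open>h\<close> does not depend on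
  \<open>N\<close>. These averages tend to 0 pointwise with bounded L^2 norms, which suffices for
  their products with a fixed square integrable function to tend to 0 in mean.\<close>

lemma L2_inner_weight_part_eq_zero:
  assumes f: "continuous_on H f" "pint 2 f < \<infinity>" and h: "continuous_on H h" "pint 2 h < \<infinity>"
    and zero: "\<And>z. z \<in> H \<Longrightarrow> weight_part k h z = 0"
  shows "L2_inner H (weight_part k f) h = 0"
proof -
  define u where "u = weight_part k f"
  have cu: "continuous_on H u" unfolding u_def by (rule continuous_on_weight_part[OF f(1)])
  have fu: "pint 2 u < \<infinity>"
    unfolding u_def using pint_weight_part_le[of 2 f k] f by (simp add: le_less_trans)
  have cv: "continuous_on H (weight_avg N k h)" for N by (rule continuous_on_weight_avg[OF h(1)])
  have [measurable]: "u \<in> borel_measurable (lebesgue_on H)" "weight_avg N k h \<in> borel_measurable (lebesgue_on H)" for N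
    using cu cv by (auto intro: measurable_continuous_H)
  have "(\<lambda>N. \<integral>\<^sup>+z. ennreal (norm (u z) * norm (weight_avg N k h z)) \<partial>lebesgue_on H) \<longlonglongrightarrow> 0"
  proof (rule nn_integral_mult_tendsto_zero)
    show "(\<integral>\<^sup>+z. ennreal ((cmod (u z))\<^sup>2) \<partial>lebesgue_on H) < \<infinity>"
      using fu by (simp add: pint_def)
    show "(\<integral>\<^sup>+z. ennreal ((cmod (weight_avg N k h z))\<^sup>2) \<partial>lebesgue_on H) \<le> ennreal (enn2real (pint 2 h))" for N
      using pint_weight_avg_le[OF _ h(1), of 2 N k] h(2) by (simp add: pint_def)
    show "(\<lambda>N. weight_avg N k h z) \<longlonglongrightarrow> 0" if "z \<in> space (lebesgue_on H)" for z
      using weight_avg_tendsto[OF h(1), of z k] zero that by simp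
  qed auto
  then have "(\<lambda>N. enn2real (\<integral>\<^sup>+z. ennreal (norm (u z) * norm (weight_avg N k h z)) \<partial>lebesgue_on H)) \<longlonglongrightarrow> enn2real 0"
    by (intro tendsto_enn2real) auto
  moreover have "cmod (L2_inner H u h) \<le> enn2real (\<integral>\<^sup>+z. ennreal (norm (u z) * norm (weight_avg N k h z)) \<partial>lebesgue_on H)" for N
  proof -
    have "cmod (L2_inner H u h) = cmod (LINT z|lebesgue_on H. u z * cnj (weight_avg N k h z))"
      using L2_inner_weight_avg[OF f h, of k N] by (simp add: u_def L2_inner_def)
    also have "\<dots> \<le> (LINT z|lebesgue_on H. norm (u z * cnj (weight_avg N k h z)))"
      by (rule integral_norm_bound)
    also have "\<dots> = enn2real (\<integral>\<^sup>+z. ennreal (norm (u z * cnj (weight_avg N k h z))) \<partial>lebesgue_on H)"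
      by (rule integral_eq_nn_integral) (use cu cv in \<open>auto intro!: measurable_continuous_H continuous_intros\<close>)
    finally show ?thesis by (simp add: norm_mult)
  qed
  ultimately have "cmod (L2_inner H u h) \<le> enn2real 0"
    by (intro LIMSEQ_le_const) auto
  then show ?thesis by (simp add: u_def)
qed

text \<open>Splitting off the shell \<open>cmod (snd z) \<ge> q\<close> and rescaling the rest gives \<open>J (j + 1) \<le> J 1 + \<theta> J j\<close> with
  \<open>\<theta> < 1\<close> for the truncated integrals \<open>J j\<close>.\<close>

lemma nn_integral_snd_powr_finite:
  assumes a: "a + 2 * (real m + real n) > 0"
  shows "(\<integral>\<^sup>+z. ennreal (cmod (snd z) powr (a / real m)) \<partial>lebesgue_on H) < \<infinity>"
proof -
  \<comment> \<open>\<open>twist 2\<close> multiplies \<open>cmod (snd z)\<close> by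
    \<open>2 ^ m = 1 / q\<close> and so moves the truncation level \<open>q ^ Suc j\<close> to
    \<open>q ^ j\<close>.\<close>
  define q :: real where "q = (1/2) ^ m"
  have q: "0 < q" "q < 1" using m_pos by (auto simp: q_def power_less_one_iff)
  \<comment> \<open>The Jacobian of \<open>twist (1/2)\<close> contributes
    \<open>2 * (m + n)\<close> to the exponent. The weight \<open>cmod (snd z) powr (a / m)\<close>
    is homogeneous of degree \<open>a\<close> and contributes the rest.\<close>
  define \<theta> :: real where "\<theta> = (1/2) powr (a + 2 * (real m + real n))"
  have \<theta>: "0 < \<theta>" "\<theta> < 1"
    using a powr_less_mono'[of "1/2" 0 "a + 2 * (real m + real n)"] by (auto simp: \<theta>_def)
  define E where "E = (\<lambda>j. {z \<in> H. q ^ j \<le> cmod (snd z)})"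
  define W where "W = (\<lambda>z::complex \<times> complex. ennreal (cmod (snd z) powr (a / real m)))"
  have [measurable]: "W \<in> borel_measurable borel" 
  proof -
    have [measurable]: "(snd :: complex \<times> complex \<Rightarrow> complex) \<in> borel_measurable borel"
      by (intro borel_measurable_continuous_onI continuous_intros)
    show ?thesis unfolding W_def by measurable
  qed
  have [measurable]: "E j \<in> sets borel" for j
  proof -
    have "E j = H \<inter> {z. q ^ j \<le> cmod (snd z)}" by (auto simp: E_def)
    moreover have "closed {z::complex \<times> complex. q ^ j \<le> cmod (snd z)}"
      by (intro closed_Collect_le continuous_intros)
    ultimately show ?thesis by auto
  qed
  define J where "J = (\<lambda>j. \<integral>\<^sup>+z. W z * indicator (E j) z \<partial>lborel)"
  define A where "A = enn2real (J 1)"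
  have J1: "J 1 = ennreal A"
  proof -
    define B where "B = max 1 (q powr (a / real m))"
    have "cmod (snd z) powr (a / real m) \<le> B" if "z \<in> E 1" for z
    proof (cases "a \<ge> 0")
      case True
      have "cmod (snd z) powr (a / real m) \<le> 1 powr (a / real m)"
        using that True by (intro powr_mono2) (auto simp: E_def mem_H_iff)
      then show ?thesis by (simp add: B_def)
    next
      case False
      then have "cmod (snd z) powr (a / real m) \<le> q powr (a / real m)"
        using that q by (intro powr_mono2') (auto simp: E_def divide_nonpos_nonneg)
      then show ?thesis by (simp add: B_def)
    qed
    then have "J 1 \<le> (\<integral>\<^sup>+z. ennreal B * indicator H z \<partial>lborel)"
      unfolding J_def W_def by (intro nn_integral_mono) (auto simp: indicator_def E_def intro: ennreal_leI)
    also have "\<dots> = ennreal B * emeasure lborel H" by (rule nn_integral_cmult_indicator) simp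
    also have "\<dots> < \<infinity>" using emeasure_H_finite by (simp add: ennreal_mult_less_top)
    finally show ?thesis by (simp add: A_def)
  qed
  have A: "A \<ge> 0" by (simp add: A_def)
  have step: "J (Suc j) \<le> ennreal A + ennreal \<theta> * J j" for j
  proof -
    let ?G = "\<lambda>z. W z * indicator (E j) (twist 2 z)"
    have [measurable]: "twist 2 \<in> borel_measurable borel"
      unfolding twist_def by (intro borel_measurable_continuous_onI continuous_intros)
    have split: "indicator (E (Suc j)) z \<le> indicator (E 1) z + (indicator (E j) (twist 2 z) :: ennreal)" for z
    proof (cases "z \<in> E (Suc j) \<and> z \<notin> E 1")
      case True
      then have z: "z \<in> H" "q ^ Suc j \<le> cmod (snd z)" "cmod (snd z) < q" by (auto simp: E_def)
      have q2: "2 ^ m * q = (1::real)" by (simp add: q_def power_mult_distrib[symmetric])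
      have "2 ^ m * cmod (snd z) < 2 ^ m * q" using z by simp
      then have "twist 2 z \<in> H" using z q2 by (intro twist_mem) auto
      moreover have "q ^ j \<le> 2 ^ m * cmod (snd z)"
      proof -
        have "q ^ j = 2 ^ m * q ^ Suc j" using q2 by (simp add: mult.assoc[symmetric])
        also have "\<dots> \<le> 2 ^ m * cmod (snd z)" using z by (intro mult_left_mono) auto
        finally show ?thesis .
      qed
      ultimately have "twist 2 z \<in> E j" by (simp add: E_def twist_def norm_mult norm_power)
      then show ?thesis by (simp add: indicator_def)
    qed (auto simp: indicator_def)
    have "J (Suc j) \<le> (\<integral>\<^sup>+z. W z * indicator (E 1) z + ?G z \<partial>lborel)"
      unfolding J_def
    proof (rule nn_integral_mono)
      fix z show "W z * indicator (E (Suc j)) z \<le> W z * indicator (E 1) z + ?G z"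
        using mult_left_mono[OF split, of "W z" z] by (simp add: distrib_left)
    qed
    also have "\<dots> = J 1 + (\<integral>\<^sup>+z. ?G z \<partial>lborel)"
      unfolding J_def by (rule nn_integral_add) auto
    also have "(\<integral>\<^sup>+z. ?G z \<partial>lborel) = ennreal ((cmod ((1/2) ^ n))\<^sup>2 * (cmod ((1/2) ^ m))\<^sup>2)
        * (\<integral>\<^sup>+z. ?G ((1/2) ^ n * fst z, (1/2) ^ m * snd z) \<partial>lborel)"
      by (rule nn_integral_complex_diagonal[symmetric]) auto
    also have "(\<integral>\<^sup>+z. ?G ((1/2) ^ n * fst z, (1/2) ^ m * snd z) \<partial>lborel)
        = (\<integral>\<^sup>+z. ennreal ((1/2) powr a) * (W z * indicator (E j) z) \<partial>lborel)"
    proof (rule nn_integral_cong)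
      fix z :: "complex \<times> complex"
      have "twist 2 ((1/2) ^ n * fst z, (1/2) ^ m * snd z) = z"
        by (simp add: twist_def mult.assoc[symmetric] power_mult_distrib[symmetric])
      moreover have "W ((1/2) ^ n * fst z, (1/2) ^ m * snd z) = ennreal ((1/2) powr a) * W z"
      proof -
        have "((1/2) ^ m) powr (a / real m) = (1/2::real) powr a"
          using m_pos by (simp add: powr_realpow[symmetric] powr_powr)
        then show ?thesis
          unfolding W_def by (simp add: norm_mult norm_power powr_mult ennreal_mult' norm_divide)
      qed
      ultimately show "?G ((1/2) ^ n * fst z, (1/2) ^ m * snd z) = ennreal ((1/2) powr a) * (W z * indicator (E j) z)"
        by (simp add: mult.assoc)
    qed
    also have "\<dots> = ennreal ((1/2) powr a) * J j"
      unfolding J_def by (rule nn_integral_cmult) auto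
    also have "ennreal ((cmod ((1/2) ^ n))\<^sup>2 * (cmod ((1/2) ^ m))\<^sup>2) * (ennreal ((1/2) powr a) * J j) = ennreal \<theta> * J j"
    proof -
      have "(cmod ((1/2) ^ n))\<^sup>2 * (cmod ((1/2) ^ m))\<^sup>2 = (1/2) ^ (2 * (m + n))"
        by (simp add: norm_power norm_divide power_mult[symmetric] power_add[symmetric] algebra_simps)
      also have "\<dots> = (1/2) powr real (2 * (m + n))" by (rule powr_realpow[symmetric]) simp
      finally have "(cmod ((1/2) ^ n))\<^sup>2 * (cmod ((1/2) ^ m))\<^sup>2 * (1/2) powr a = \<theta>"
        by (simp add: \<theta>_def powr_add[symmetric] algebra_simps)
      then show ?thesis by (simp add: mult.assoc[symmetric] ennreal_mult'[symmetric])
    qed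
    finally show ?thesis by (simp only: J1)
  qed
  \<comment> \<open>The bound is the fixed point of \<open>x = A + \<theta> * x\<close>, and the
    recursion starts at 0 because \<open>E 0\<close> is empty.\<close>
  have bound: "J j \<le> ennreal (A / (1 - \<theta>))" for j
  proof (induction j)
    case 0
    have "E 0 = {}" by (auto simp: E_def mem_H_iff)
    then show ?case by (simp add: J_def)
  next
    case (Suc j)
    have "J (Suc j) \<le> ennreal A + ennreal \<theta> * ennreal (A / (1 - \<theta>))"
      using Suc by (intro order_trans[OF step] add_left_mono mult_left_mono) auto
    also have "\<dots> = ennreal (A + \<theta> * (A / (1 - \<theta>)))"
      using A \<theta> by (simp add: ennreal_mult'[symmetric] flip: ennreal_plus)
    also have "A + \<theta> * (A / (1 - \<theta>)) = A / (1 - \<theta>)" using \<theta> by (simp add: field_simps)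
    finally show ?case .
  qed
  \<comment> \<open>The sets \<open>E j\<close> exhaust \<open>H\<close>, as the second coordinate
    never vanishes there; Fatou's lemma passes the uniform bound to the limit.\<close>
  have "(\<integral>\<^sup>+z. W z \<partial>lebesgue_on H) = (\<integral>\<^sup>+z. liminf (\<lambda>j. W z * indicator (E j) z) \<partial>lborel)"
    unfolding nn_integral_lebesgue_on_H
  proof (rule nn_integral_cong)
    fix z
    have "\<forall>\<^sub>F j in sequentially. indicator (E j) z = (indicator H z :: ennreal)"
    proof (cases "z \<in> H")
      case True
      then have "0 < cmod (snd z)" using snd_nonzero by simp
      moreover have "(\<lambda>j. q ^ j) \<longlonglongrightarrow> 0" using q by (intro LIMSEQ_power_zero) auto
      ultimately have "\<forall>\<^sub>F j in sequentially. q ^ j < cmod (snd z)" by (rule order_tendstoD(2)[rotated])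
      then show ?thesis by eventually_elim (use True in \<open>auto simp: E_def indicator_def\<close>)
    qed (auto simp: E_def indicator_def)
    then have "(\<lambda>j. W z * indicator (E j) z) \<longlonglongrightarrow> W z * indicator H z"
      by (intro tendsto_eventually) (auto elim: eventually_mono)
    then show "W z * indicator H z = liminf (\<lambda>j. W z * indicator (E j) z)"
      by (simp add: lim_imp_Liminf)
  qed
  also have "\<dots> \<le> liminf J"
    unfolding J_def by (rule nn_integral_liminf) auto
  also have "\<dots> \<le> liminf (\<lambda>j. ennreal (A / (1 - \<theta>)))"
    using bound by (intro Liminf_mono always_eventually) auto
  also have "\<dots> < \<infinity>" by (simp add: Liminf_const)
  finally show ?thesis by (simp add: W_def)
qed

end

section \<open>Dilations and the projection\<close>

context hartogs
begin

text \<open>This is \<open>twist (\<theta>\<^sup>2)\<close> followed by shrinking the first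
  coordinate once more by \<theta>. The orbits never move away from the boundary part where
  \<open>cmod (fst z) ^ m = cmod (snd z) ^ n\<close>, and the extra factor does. Squaring \<theta>
  leaves one factor of the orbit parameter to place the base point in a compact set and one to keep
  the parameter off the unit circle.\<close>

abbreviation dil :: "real \<Rightarrow> complex \<times> complex \<Rightarrow> complex \<times> complex"
  where "dil \<theta> z \<equiv> (of_real \<theta> ^ (2 * n + 1) * fst z, of_real \<theta> ^ (2 * m) * snd z)"

lemma dil_mem:
  assumes \<theta>: "0 < \<theta>" "\<theta> \<le> 1" and z: "z \<in> H"
  shows "dil \<theta> z \<in> H"
proof -
  have "\<theta> ^ ((2 * n + 1) * m) * cmod (fst z) ^ m \<le> \<theta> ^ (2 * m * n) * cmod (fst z) ^ m"
    using \<theta> by (intro mult_right_mono power_decreasing) (auto simp: algebra_simps)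
  also have "\<dots> < \<theta> ^ (2 * m * n) * cmod (snd z) ^ n"
    using \<theta> z by (intro mult_strict_left_mono) (auto simp: mem_H_iff)
  finally have "cmod (fst (dil \<theta> z)) ^ m < cmod (snd (dil \<theta> z)) ^ n"
    by (simp only: fst_conv snd_conv norm_mult norm_power norm_of_real abs_of_pos[OF \<theta>(1)]
        power_mult_distrib power_mult)
  moreover have "\<theta> ^ (2 * m) * cmod (snd z) \<le> 1 * cmod (snd z)"
    using \<theta> by (intro mult_right_mono power_le_one) auto
  then have "cmod (snd (dil \<theta> z)) < 1"
    using \<theta> z by (auto simp: norm_mult norm_power mem_H_iff)
  ultimately show ?thesis by (simp add: mem_H_iff)
qed

text \<open>Every point of \<open>dil \<theta> ` H\<close> is \<open>twist c w\<close> with \<open>cmod c < \<theta>\<close> and \<open>w\<close> in a compact subset of \<open>H\<close> that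
  depends only on \<open>\<theta>\<close>.\<close>

lemma dil_growth:
  assumes f: "holomorphic2_on f H" and \<theta>: "0 < \<theta>" "\<theta> < 1"
    and van: "\<And>k z. k < k0 \<Longrightarrow> z \<in> H \<Longrightarrow> weight_part k f z = 0"
  obtains C where "C \<ge> 0" "\<And>z. z \<in> H \<Longrightarrow> cmod (f (dil \<theta> z)) \<le> C * cmod (snd z) powr (of_int k0 / real m)"
proof -
  \<comment> \<open>\<open>K\<close> lies in \<open>H\<close> because
    \<open>(n + 1) * m > m * n\<close>. It is invariant under unimodular twists, so one bound
    \<open>M\<close> serves the whole unit circle of every orbit through \<open>K\<close>.\<close>
  define K where "K = cball (0::complex) (\<theta> ^ (n + 1)) \<times> sphere (0::complex) (\<theta> ^ m)"
  have KH: "K \<subseteq> H"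
  proof
    fix w assume "w \<in> K"
    then have w: "cmod (fst w) \<le> \<theta> ^ (n + 1)" "cmod (snd w) = \<theta> ^ m" by (auto simp: K_def)
    have "cmod (fst w) ^ m \<le> (\<theta> ^ (n + 1)) ^ m" using w by (intro power_mono) auto
    also have "\<dots> = \<theta> ^ ((n + 1) * m)" by (rule power_mult[symmetric])
    also have "\<dots> < \<theta> ^ (m * n)" using \<theta> m_pos by (intro power_strict_decreasing) auto
    also have "\<dots> = cmod (snd w) ^ n" using w by (simp add: power_mult)
    finally show "w \<in> H"
      using w \<theta> m_pos by (simp add: mem_H_iff power_less_one_iff)
  qed
  have "compact (f ` K)"
    by (intro compact_continuous_image continuous_on_subset[OF holomorphic2_on_imp_continuous_on[OF f] KH])
       (auto simp: K_def intro!: compact_Times)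
  then obtain M where M: "M > 0" "\<And>w. w \<in> K \<Longrightarrow> cmod (f w) \<le> M"
    using compact_imp_bounded bounded_pos[of "f ` K"] by auto
  \<comment> \<open>The denominator is \<open>1 - \<theta>\<close>, uniform in the point, since the
    orbit parameter will have modulus \<open>\<theta> * s\<close> with \<open>s < 1\<close>.\<close>
  define C where "C = \<theta> powi k0 * (M / (1 - \<theta>))"
  show ?thesis
  proof (rule that)
    show "C \<ge> 0" using M \<theta> by (simp add: C_def)
    fix z assume z: "z \<in> H"
    define s where "s = root m (cmod (snd z))"
    have snd: "0 < cmod (snd z)" "cmod (snd z) < 1" using z snd_nonzero[OF z] by (auto simp: mem_H_iff)
    have s: "0 < s" "s < 1" "s ^ m = cmod (snd z)"
      using snd m_pos by (auto simp: s_def)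
    \<comment> \<open>Dividing by \<open>s ^ n\<close> and \<open>s ^ m\<close> normalises the
      second coordinate to modulus 1 before it is multiplied by \<open>\<theta> ^ m\<close>; the
      remaining factor \<open>\<theta> * s\<close> is the orbit parameter.\<close>
    define w where "w = (of_real \<theta> ^ (n + 1) * fst z / of_real s ^ n, of_real \<theta> ^ m * snd z / of_real s ^ m)"
    have "w \<in> K"
    proof -
      have "(s ^ n) ^ m = cmod (snd z) ^ n"
        by (simp only: power_mult[symmetric] mult.commute[of n m]) (simp only: power_mult s(3))
      then have "cmod (fst z) ^ m < (s ^ n) ^ m"
        using z unfolding mem_H_iff by (simp only:)
      then have "cmod (fst z) < s ^ n" by (rule power_less_imp_less_base) (use s in simp)
      then have "\<theta> ^ (n + 1) * cmod (fst z) / s ^ n \<le> \<theta> ^ (n + 1)"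
        using s \<theta> by (simp add: divide_le_eq mult_left_mono)
      then show ?thesis
        using s \<theta> snd by (auto simp: K_def w_def norm_mult norm_divide norm_power)
    qed
    define c where "c = complex_of_real (\<theta> * s)"
    have c: "c \<noteq> 0" "cmod c = \<theta> * s" using s \<theta> by (auto simp: c_def norm_mult)
    have "dil \<theta> z = twist c w"
      using s by (simp add: twist_def w_def c_def power_mult_distrib power_add mult_2_right mult_ac)
    moreover have "cmod (f (twist c w)) \<le> cmod c powi k0 * (M / (1 - cmod c))"
    proof (rule bound_of_vanishing_weight_parts[OF f])
      show "w \<in> H" using \<open>w \<in> K\<close> KH by blast
      then show "weight_part k f w = 0" if "k < k0" for k using van that by blast
      show "cmod (f (twist \<xi> w)) \<le> M" if "cmod \<xi> = 1" for \<xi>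
        using \<open>w \<in> K\<close> that by (intro M) (auto simp: K_def twist_def norm_mult norm_power)
      show "c \<noteq> 0" by fact
      show "cmod c < 1" unfolding c(2) using s \<theta> mult_strict_mono[of \<theta> 1 s 1] by simp
    qed
    ultimately have "cmod (f (dil \<theta> z)) \<le> (\<theta> * s) powi k0 * (M / (1 - \<theta> * s))"
      by (simp add: c)
    also have "\<dots> \<le> (\<theta> * s) powi k0 * (M / (1 - \<theta>))"
    proof (intro mult_left_mono divide_left_mono mult_pos_pos)
      have "\<theta> * s \<le> \<theta> * 1" using s \<theta> by (intro mult_left_mono) auto
      then show "1 - \<theta> \<le> 1 - \<theta> * s" "0 < 1 - \<theta> * s" using \<theta> by linarith+
    qed (use s \<theta> M in auto)
    also have "\<dots> = C * s powi k0" by (simp add: C_def power_int_mult_distrib)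
    also have "s powi k0 = s powr of_int k0" using s by (simp add: powr_real_of_int')
    also have "\<dots> = cmod (snd z) powr (of_int k0 / real m)"
      using s m_pos by (simp add: s(3)[symmetric] powr_realpow[symmetric] powr_powr)
    finally show "cmod (f (dil \<theta> z)) \<le> C * cmod (snd z) powr (of_int k0 / real m)" .
  qed
qed

lemma dil_in_Bergman:
  assumes f: "holomorphic2_on f H" and \<theta>: "0 < \<theta>" "\<theta> < 1" and r: "r > 0"
    and van: "\<And>k z. k < k0 \<Longrightarrow> z \<in> H \<Longrightarrow> weight_part k f z = 0"
    and k0: "of_int k0 * r + 2 * (real m + real n) > 0"
  shows "(\<lambda>z. f (dil \<theta> z)) \<in> Bergman r H"
  unfolding Bergman_H_iff
proof
  show "holomorphic2_on (\<lambda>z. f (dil \<theta> z)) H"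
    using dil_mem \<theta> by (intro holomorphic2_on_diagonal[OF f open_H]) auto
  obtain C where C: "C \<ge> 0" "\<And>z. z \<in> H \<Longrightarrow> cmod (f (dil \<theta> z)) \<le> C * cmod (snd z) powr (of_int k0 / real m)"
    using dil_growth[OF f \<theta> van] by blast
  have meas: "(\<lambda>z. ennreal (cmod (snd z) powr (of_int k0 * r / real m))) \<in> borel_measurable (lebesgue_on H)"
  proof -
    have "(\<lambda>z::complex \<times> complex. cmod (snd z)) \<in> borel_measurable (lebesgue_on H)"
      by (intro measurable_continuous_H continuous_intros)
    then show ?thesis
      by (rule measurable_compose[where g = "\<lambda>x. ennreal (x powr (of_int k0 * r / real m))"]) measurable
  qed
  have "pint r (\<lambda>z. f (dil \<theta> z)) \<le> (\<integral>\<^sup>+z. ennreal (C powr r) * ennreal (cmod (snd z) powr (of_int k0 * r / real m)) \<partial>lebesgue_on H)"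
    unfolding pint_def
  proof (rule nn_integral_mono)
    fix z assume "z \<in> space (lebesgue_on H)"
    then have "cmod (f (dil \<theta> z)) powr r \<le> (C * cmod (snd z) powr (of_int k0 / real m)) powr r"
      using C(2)[of z] r by (intro powr_mono2) auto
    also have "\<dots> = C powr r * cmod (snd z) powr (of_int k0 * r / real m)"
      using C(1) by (simp add: powr_mult powr_powr)
    finally show "ennreal (cmod (f (dil \<theta> z)) powr r) \<le> ennreal (C powr r) * ennreal (cmod (snd z) powr (of_int k0 * r / real m))"
      by (simp add: ennreal_mult'[symmetric] ennreal_leI)
  qed
  also have "\<dots> = ennreal (C powr r) * (\<integral>\<^sup>+z. ennreal (cmod (snd z) powr (of_int k0 * r / real m)) \<partial>lebesgue_on H)"
    by (rule nn_integral_cmult[OF meas])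
  also have "\<dots> < \<infinity>"
    using nn_integral_snd_powr_finite[OF k0] by (simp add: ennreal_mult_less_top)
  finally show "pint r (\<lambda>z. f (dil \<theta> z)) < \<infinity>" .
qed

text \<open>Needed for two exponents with the same r: for 2 to recognise elements of the closure of
  A^r, and for the given p to return from that closure to L^p.\<close>

lemma Lp_approximable_of_vanishing_weight_parts:
  assumes f: "f \<in> Bergman p H" and p: "1 \<le> p" "p \<le> r"
    and van: "\<And>k z. of_int k * r + 2 * (real m + real n) \<le> 0 \<Longrightarrow> z \<in> H \<Longrightarrow> weight_part k f z = 0"
  shows "Lp_approximable p H (Bergman r H) f"
proof -
  have hol: "holomorphic2_on f H" and cf: "continuous_on H f" and fin: "pint p f < \<infinity>"
    using f by (auto simp: Bergman_H_iff holomorphic2_on_imp_continuous_on)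
  \<comment> \<open>The least weight that is not low. Equality in the low-weight condition counts as
    low, hence the floor plus 1; the weights below \<open>k0\<close> are then low, and the power of
    \<open>snd z\<close> belonging to \<open>k0\<close> is integrable.\<close>
  define k0 where "k0 = \<lfloor>- 2 * (real m + real n) / r\<rfloor> + 1"
  have k0: "of_int k0 * r + 2 * (real m + real n) > 0"
  proof -
    have "- 2 * (real m + real n) / r < of_int k0" unfolding k0_def by linarith
    then show ?thesis using p by (simp add: field_simps)
  qed
  have low: "of_int l * r + 2 * (real m + real n) \<le> 0" if "l < k0" for l
  proof -
    have "of_int l \<le> - 2 * (real m + real n) / r" using that unfolding k0_def by (simp add: le_floor_iff)
    then show ?thesis using p by (simp add: field_simps)
  qed
  define \<theta> where "\<theta> = (\<lambda>j. 1 - 1 / real (j + 2))"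
  have \<theta>: "0 < \<theta> j" "\<theta> j < 1" for j by (auto simp: \<theta>_def)
  have lim\<theta>: "\<theta> \<longlonglongrightarrow> 1"
  proof -
    have "(\<lambda>j. 1 / real (j + 2)) \<longlonglongrightarrow> 0"
      using LIMSEQ_ignore_initial_segment[OF lim_const_over_n[of 1], of 2] by simp
    then show ?thesis unfolding \<theta>_def using tendsto_diff[OF tendsto_const, of _ 0 sequentially 1] by simp
  qed
  define F where "F = (\<lambda>j z. f (dil (\<theta> j) z))"
  have F: "F j \<in> Bergman r H" for j
    unfolding F_def using p van low by (intro dil_in_Bergman[OF hol \<theta> _ _ k0]) auto
  have sub: "Bergman r H \<subseteq> Bergman p H" using p by (intro Bergman_mono) auto
  \<comment> \<open>The inverse Jacobian of the dilation, tending to 1: the dilates cannot exceed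
    the norm of \<open>f\<close> in the limit.\<close>
  define c where "c = (\<lambda>j. 1 / ((\<theta> j ^ (2 * n + 1))\<^sup>2 * (\<theta> j ^ (2 * m))\<^sup>2))"
  have "(\<lambda>j. \<integral>\<^sup>+z. ennreal (cmod (F j z - f z) powr p) \<partial>lebesgue_on H) \<longlonglongrightarrow> 0"
  proof (rule nn_integral_norm_diff_powr_tendsto_zero)
    show "f \<in> borel_measurable (lebesgue_on H)" by (rule measurable_continuous_H[OF cf])
    show "F j \<in> borel_measurable (lebesgue_on H)" for j
      by (rule measurable_continuous_H[OF Bergman_continuous[OF F]])
    show "p > 0" using p by simp
    show "(\<integral>\<^sup>+z. ennreal (cmod (f z) powr p) \<partial>lebesgue_on H) < \<infinity>" using fin by (simp add: pint_def)
    show "(\<integral>\<^sup>+z. ennreal (cmod (F j z) powr p) \<partial>lebesgue_on H)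
        \<le> ennreal (c j) * (\<integral>\<^sup>+z. ennreal (cmod (f z) powr p) \<partial>lebesgue_on H)" for j
    proof -
      have "pint p (F j) \<le> ennreal (1 / ((cmod (of_real (\<theta> j) ^ (2 * n + 1)))\<^sup>2 * (cmod (of_real (\<theta> j) ^ (2 * m)))\<^sup>2)) * pint p f"
        unfolding F_def using \<theta>[of j] by (intro pint_diagonal_le[OF _ _ cf] dil_mem) auto
      moreover have "cmod (of_real (\<theta> j) ^ l) = \<theta> j ^ l" for l
        using \<theta>[of j] by (simp add: norm_power)
      ultimately show ?thesis by (simp only: c_def pint_def)
    qed
    have "c \<longlonglongrightarrow> 1 / ((1 ^ (2 * n + 1))\<^sup>2 * (1 ^ (2 * m))\<^sup>2)"
      unfolding c_def by (intro tendsto_intros lim\<theta>) auto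
    then show "c \<longlonglongrightarrow> 1" by simp
    fix z assume "z \<in> space (lebesgue_on H)"
    then have z: "z \<in> H" by simp
    have "(\<lambda>j. dil (\<theta> j) z) \<longlonglongrightarrow> (of_real 1 ^ (2 * n + 1) * fst z, of_real 1 ^ (2 * m) * snd z)"
      by (intro tendsto_intros lim\<theta>)
    then have "(\<lambda>j. dil (\<theta> j) z) \<longlonglongrightarrow> z" by simp
    moreover have "\<forall>\<^sub>F j in sequentially. dil (\<theta> j) z \<in> H"
      using dil_mem[OF _ _ z] \<theta> by (intro always_eventually) (auto intro: less_imp_le)
    ultimately show "(\<lambda>j. F j z) \<longlonglongrightarrow> f z"
      unfolding F_def by (intro continuous_on_tendsto_compose[OF cf _ z])
  qed
  then have lim: "(\<lambda>j. pint p (\<lambda>z. f z - F j z)) \<longlonglongrightarrow> 0"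
    by (simp add: pint_def norm_minus_commute)
  show ?thesis
    unfolding Lp_approximable_H_iff[OF order.strict_trans2[OF zero_less_one p(1)] f sub]
  proof (intro allI impI)
    fix \<epsilon> :: real assume "\<epsilon> > 0"
    then have "\<forall>\<^sub>F j in sequentially. pint p (\<lambda>z. f z - F j z) < ennreal \<epsilon>"
      by (intro order_tendstoD(2)[OF lim]) simp
    then obtain j where "pint p (\<lambda>z. f z - F j z) < ennreal \<epsilon>"
      by (auto dest: eventually_happens)
    then show "\<exists>g\<in>Bergman r H. pint p (\<lambda>z. f z - g z) < ennreal \<epsilon>" using F by blast
  qed
qed

section \<open>The closure of A^r in A^2 and the projection onto it\<close>

lemma sub_Bergman_space_H_iff:
  assumes "r \<ge> 2"
  shows "g \<in> sub_Bergman_space r H \<longleftrightarrow>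
    g \<in> Bergman 2 H \<and> (\<forall>\<epsilon>>0. \<exists>h\<in>Bergman r H. pint 2 (\<lambda>z. g z - h z) < ennreal \<epsilon>)"
proof (cases "g \<in> Bergman 2 H")
  case True
  have "Bergman r H \<subseteq> Bergman 2 H" using assms by (intro Bergman_mono) auto
  with True show ?thesis by (simp add: sub_Bergman_space_def Lp_approximable_H_iff)
qed (simp add: sub_Bergman_space_def)

text \<open>Low weights vanish on A^r, and taking a weight part is an L^2 contraction; the vanishing
  therefore persists in the L^2 closure.\<close>

lemma weight_part_sub_Bergman_eq_zero:
  assumes r: "r \<ge> 2" and g: "g \<in> sub_Bergman_space r H"
    and k: "of_int k * r + 2 * (real m + real n) \<le> 0" and z: "z \<in> H"
  shows "weight_part k g z = 0"
proof (rule zero_of_pint_zero[OF _ _ z])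
  have cg: "continuous_on H g"
    using g Bergman_continuous by (auto simp: sub_Bergman_space_def)
  show "continuous_on H (weight_part k g)" by (rule continuous_on_weight_part[OF cg])
  have "pint 2 (weight_part k g) \<le> ennreal \<epsilon>" if \<epsilon>: "\<epsilon> > 0" for \<epsilon>
  proof -
    obtain h where h: "h \<in> Bergman r H" "pint 2 (\<lambda>z. g z - h z) < ennreal \<epsilon>"
      using g \<epsilon> sub_Bergman_space_H_iff[OF r] by blast
    have ch: "continuous_on H h" using Bergman_continuous[OF h(1)] .
    have "weight_part k g z = weight_part k (\<lambda>z. g z - h z) z" if "z \<in> H" for z
      using weight_part_eq_zero[OF h(1) _ k that] r by (simp add: weight_part_diff[OF cg ch that])
    then have "pint 2 (weight_part k g) = pint 2 (weight_part k (\<lambda>z. g z - h z))"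
      by (rule pint_cong)
    also have "\<dots> \<le> pint 2 (\<lambda>z. g z - h z)"
      using cg ch by (intro pint_weight_part_le continuous_intros) auto
    also have "\<dots> \<le> ennreal \<epsilon>" using h by simp
    finally show ?thesis .
  qed
  then show "pint 2 (weight_part k g) = 0"
    by (metis ennreal_le_epsilon add_0 le_zero_eq)
qed

lemma L2_inner_self_eq_zero:
  assumes "continuous_on H u" "pint 2 u < \<infinity>" "L2_inner H u u = 0" "z \<in> H"
  shows "u z = 0"
proof (rule zero_of_pint_zero[OF assms(1) _ assms(4)])
  have [measurable]: "u \<in> borel_measurable (lebesgue_on H)"
    using assms(1) by (rule measurable_continuous_H)
  have "L2_inner H u u = (LINT z|lebesgue_on H. complex_of_real ((cmod (u z))\<^sup>2))"
    unfolding L2_inner_def by (simp only: complex_norm_square)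
  also have "\<dots> = of_real (LINT z|lebesgue_on H. (cmod (u z))\<^sup>2)" by (rule integral_complex_of_real)
  finally have "(LINT z|lebesgue_on H. (cmod (u z))\<^sup>2) = 0" using assms(3) by simp
  moreover have "(LINT z|lebesgue_on H. (cmod (u z))\<^sup>2) = enn2real (\<integral>\<^sup>+z. ennreal ((cmod (u z))\<^sup>2) \<partial>lebesgue_on H)"
    by (rule integral_eq_nn_integral) auto
  ultimately show "pint 2 u = 0"
    using assms(2) by (auto simp: pint_def enn2real_eq_0_iff)
qed

lemma sub_Bergman_space_diff:
  assumes r: "r \<ge> 2" and g: "g \<in> sub_Bergman_space r H" "g' \<in> sub_Bergman_space r H"
  shows "(\<lambda>z. g z - g' z) \<in> sub_Bergman_space r H"
  unfolding sub_Bergman_space_H_iff[OF r]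
proof (intro conjI allI impI)
  have B: "g \<in> Bergman 2 H" "g' \<in> Bergman 2 H" using g by (auto simp: sub_Bergman_space_def)
  then show "(\<lambda>z. g z - g' z) \<in> Bergman 2 H" by (intro Bergman_diff) auto
  fix \<epsilon> :: real assume "\<epsilon> > 0"
  \<comment> \<open>The power estimate for a difference costs the factor
    \<open>2 powr 2 = 4\<close>, so two errors of \<open>\<epsilon> / 16\<close> add up to
    \<open>\<epsilon> / 2\<close>.\<close>
  then have "\<epsilon> / 16 > 0" by simp
  then obtain h h' where h: "h \<in> Bergman r H" "pint 2 (\<lambda>z. g z - h z) < ennreal (\<epsilon> / 16)"
    and h': "h' \<in> Bergman r H" "pint 2 (\<lambda>z. g' z - h' z) < ennreal (\<epsilon> / 16)"
    using g sub_Bergman_space_H_iff[OF r] by blast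
  note cont = Bergman_continuous[OF B(1)] Bergman_continuous[OF B(2)] Bergman_continuous[OF h(1)] Bergman_continuous[OF h'(1)]
  have "pint 2 (\<lambda>z. g z - g' z - (h z - h' z)) = pint 2 (\<lambda>z. (g z - h z) - (g' z - h' z))"
    by (rule pint_cong) simp
  also have "\<dots> \<le> ennreal (2 powr 2) * (pint 2 (\<lambda>z. g z - h z) + pint 2 (\<lambda>z. g' z - h' z))"
    by (rule pint_diff_le) (use cont in \<open>auto intro!: continuous_intros\<close>)
  also have "\<dots> \<le> ennreal (2 powr 2) * (ennreal (\<epsilon> / 16) + ennreal (\<epsilon> / 16))"
    using h h' by (intro mult_left_mono add_mono) auto
  also have "\<dots> = ennreal (\<epsilon> / 2)"
    using \<open>\<epsilon> > 0\<close> by (simp add: ennreal_mult'[symmetric] flip: ennreal_plus ennreal_numeral)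
  also have "\<dots> < ennreal \<epsilon>" using \<open>\<epsilon> > 0\<close> by (simp add: ennreal_less_iff)
  finally have "pint 2 (\<lambda>z. g z - g' z - (h z - h' z)) < ennreal \<epsilon>" .
  moreover have "(\<lambda>z. h z - h' z) \<in> Bergman r H" using r h h' by (intro Bergman_diff) auto
  ultimately show "\<exists>h\<in>Bergman r H. pint 2 (\<lambda>z. g z - g' z - h z) < ennreal \<epsilon>"
    by (intro bexI[of _ "\<lambda>z. h z - h' z"]) auto
qed

lemma Bergman_cong:
  assumes "f \<in> Bergman s H" "\<And>z. z \<in> H \<Longrightarrow> f z = g z"
  shows "g \<in> Bergman s H"
  using assms holomorphic2_on_cong[of f H g] pint_cong[of f g s] by (auto simp: Bergman_H_iff)

lemma sub_Bergman_space_cong: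
  assumes r: "r \<ge> 2" and "f \<in> sub_Bergman_space r H" "\<And>z. z \<in> H \<Longrightarrow> f z = g z"
  shows "g \<in> sub_Bergman_space r H"
proof -
  have "pint 2 (\<lambda>z. g z - h z) = pint 2 (\<lambda>z. f z - h z)" for h
    using assms(3) by (intro pint_cong) simp
  then show ?thesis
    using assms(2) Bergman_cong[OF _ assms(3)] by (auto simp: sub_Bergman_space_H_iff[OF r])
qed

lemma L2_inner_cong:
  assumes "\<And>z. z \<in> H \<Longrightarrow> u z = u' z" "\<And>z. z \<in> H \<Longrightarrow> v z = v' z"
  shows "L2_inner H u v = L2_inner H u' v'"
  unfolding L2_inner_def using assms by (intro Bochner_Integration.integral_cong) auto

text \<open>Existence of the projection is supplied by the candidate \<open>g\<close>, so
  completeness of the subspace is not invoked. Uniqueness is the usual argument: the difference of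
  two candidates lies in the subspace and is orthogonal to itself. Cutting \<open>g\<close> off
  outside \<open>H\<close> matches the normalisation in \<open>sub_Bergman_proj\<close>.\<close>

lemma sub_Bergman_proj_eqI:
  assumes r: "r \<ge> 2" and f: "f \<in> Bergman 2 H" and g: "g \<in> sub_Bergman_space r H"
    and orth: "\<And>h. h \<in> sub_Bergman_space r H \<Longrightarrow> L2_inner H (\<lambda>z. f z - g z) h = 0"
    and z: "z \<in> H"
  shows "sub_Bergman_proj r H f z = g z"
proof -
  define g0 where "g0 = (\<lambda>z. if z \<in> H then g z else 0)"
  have g0: "g0 \<in> sub_Bergman_space r H"
    by (rule sub_Bergman_space_cong[OF r g]) (simp add: g0_def)
  have "sub_Bergman_proj r H f = g0"
    unfolding sub_Bergman_proj_def
  proof (rule the_equality)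
    have "L2_inner H (\<lambda>z. f z - g0 z) h = 0" if "h \<in> sub_Bergman_space r H" for h
      using L2_inner_cong[of "\<lambda>z. f z - g0 z" "\<lambda>z. f z - g z" h h] orth[OF that] by (simp add: g0_def)
    then show "g0 \<in> sub_Bergman_space r H \<and> (\<forall>h\<in>sub_Bergman_space r H. L2_inner H (\<lambda>z. f z - g0 z) h = 0)
        \<and> (\<forall>z. z \<notin> H \<longrightarrow> g0 z = 0)"
      using g0 by (simp add: g0_def)
  next
    fix g' assume g': "g' \<in> sub_Bergman_space r H \<and> (\<forall>h\<in>sub_Bergman_space r H. L2_inner H (\<lambda>z. f z - g' z) h = 0)
        \<and> (\<forall>z. z \<notin> H \<longrightarrow> g' z = 0)"
    define u where "u = (\<lambda>z. g z - g' z)"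
    have u: "u \<in> sub_Bergman_space r H"
      unfolding u_def using g' by (intro sub_Bergman_space_diff[OF r g]) auto
    have B: "u \<in> Bergman 2 H" "(\<lambda>z. f z - g z) \<in> Bergman 2 H" "(\<lambda>z. f z - g' z) \<in> Bergman 2 H"
      using u g g' f by (auto simp: sub_Bergman_space_def intro: Bergman_diff)
    note cont = Bergman_continuous[OF B(1)] Bergman_continuous[OF B(2)] Bergman_continuous[OF B(3)]
    have fin: "pint 2 u < \<infinity>" "pint 2 (\<lambda>z. f z - g z) < \<infinity>" "pint 2 (\<lambda>z. f z - g' z) < \<infinity>"
      using B by (auto simp: Bergman_H_iff)
    have "L2_inner H u u = (LINT z|lebesgue_on H. (f z - g' z) * cnj (u z) - (f z - g z) * cnj (u z))"
      unfolding L2_inner_def by (rule Bochner_Integration.integral_cong) (auto simp: u_def algebra_simps)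
    also have "\<dots> = L2_inner H (\<lambda>z. f z - g' z) u - L2_inner H (\<lambda>z. f z - g z) u"
      unfolding L2_inner_def
      by (intro Bochner_Integration.integral_diff integrable_mult_cnj cont fin)
    also have "\<dots> = 0" using orth[OF u] g' u by simp
    finally have "u z = 0" if "z \<in> H" for z
      using L2_inner_self_eq_zero[OF cont(1) fin(1) _ that] by simp
    then show "g' = g0" using g' by (auto simp: g0_def u_def fun_eq_iff)
  qed
  then show ?thesis using z by (simp add: g0_def)
qed

text \<open>The projection removes the finitely many weights that are square integrable but not
  \<open>r\<close>-integrable.\<close>

lemma sub_Bergman_proj_weight_parts:
  assumes r: "r \<ge> 2" and f: "f \<in> Bergman 2 H"
  obtains g where "g \<in> sub_Bergman_space r H" "\<And>z. z \<in> H \<Longrightarrow> sub_Bergman_proj r H f z = g z"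
proof -
  \<comment> \<open>The weights that are low for r but not for the exponent 2. The first condition
    forces \<open>k \<le> 0\<close> and the second \<open>k > - (m + n)\<close>, so there are only
    finitely many.\<close>
  define K where "K = {k::int. of_int k * r + 2 * (real m + real n) \<le> 0 \<and> 0 < of_int k * 2 + 2 * (real m + real n)}"
  have finK: "finite K"
  proof (rule finite_subset)
    show "K \<subseteq> {- int (m + n)..0}"
    proof
      fix k assume k: "k \<in> K"
      have "real_of_int k * r \<le> 0" using k by (auto simp: K_def)
      then have "k \<le> 0" using r by (simp add: mult_le_0_iff)
      moreover have "- int (m + n) \<le> k" using k by (auto simp: K_def)
      ultimately show "k \<in> {- int (m + n)..0}" by simp
    qed
  qed simp
  define g where "g = (\<lambda>z. f z - (\<Sum>k\<in>K. weight_part k f z))"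
  have cf: "continuous_on H f" using Bergman_continuous[OF f] .
  have hol: "holomorphic2_on f H" and finf: "pint 2 f < \<infinity>" using f by (auto simp: Bergman_H_iff)
  have part: "weight_part k f \<in> Bergman 2 H" for k
    using holomorphic2_on_weight_part[OF hol] pint_weight_part_le[of 2 f k, OF _ cf] finf
    by (simp add: Bergman_H_iff le_less_trans)
  have cpart: "continuous_on H (weight_part k f)" for k by (rule continuous_on_weight_part[OF cf])
  have gB: "g \<in> Bergman 2 H"
  proof -
    have "(\<lambda>z. f z - (\<Sum>k\<in>L. weight_part k f z)) \<in> Bergman 2 H" if "finite L" for L
      using that
    proof (induction L)
      case empty
      then show ?case using f by simp
    next
      case (insert k L)
      have "(\<lambda>z. (f z - (\<Sum>k\<in>L. weight_part k f z)) - weight_part k f z) \<in> Bergman 2 H"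
        by (intro Bergman_diff insert part) simp
      then show ?case using insert by (simp add: algebra_simps)
    qed
    then show ?thesis using finK by (simp add: g_def)
  qed
  have van: "weight_part l g z = 0" if l: "of_int l * r + 2 * (real m + real n) \<le> 0" and z: "z \<in> H" for l z
  proof -
    have "weight_part l g z = weight_part l f z - (\<Sum>k\<in>K. weight_part l (weight_part k f) z)"
      unfolding g_def
      using cf cpart z finK by (simp add: weight_part_diff weight_part_sum continuous_on_sum)
    also have "(\<Sum>k\<in>K. weight_part l (weight_part k f) z) = (if l \<in> K then weight_part l f z else 0)"
      using finK by (simp add: weight_part_weight_part)
    also have "weight_part l f z - \<dots> = 0"
    \<comment> \<open>A low weight outside \<open>K\<close> is low for the exponent 2 as well, and
      so it already vanishes on A^2.\<close>
    proof (cases "l \<in> K")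
      case False
      then have "of_int l * 2 + 2 * (real m + real n) \<le> 0" using l by (auto simp: K_def)
      then show ?thesis using weight_part_eq_zero[OF f _ _ z, of l] False by simp
    qed simp
    finally show ?thesis .
  qed
  have "Lp_approximable 2 H (Bergman r H) g"
    using van r by (intro Lp_approximable_of_vanishing_weight_parts[OF gB]) auto
  then have gG: "g \<in> sub_Bergman_space r H" using gB by (simp add: sub_Bergman_space_def)
  have "sub_Bergman_proj r H f z = g z" if "z \<in> H" for z
  proof (rule sub_Bergman_proj_eqI[OF r f gG _ that])
    fix h assume h: "h \<in> sub_Bergman_space r H"
    then have hB: "h \<in> Bergman 2 H" by (simp add: sub_Bergman_space_def)
    have ch: "continuous_on H h" and finh: "pint 2 h < \<infinity>"
      using Bergman_continuous[OF hB] hB by (auto simp: Bergman_H_iff)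
    have "L2_inner H (\<lambda>z. f z - g z) h = (LINT z|lebesgue_on H. (\<Sum>k\<in>K. weight_part k f z * cnj (h z)))"
      unfolding L2_inner_def g_def by (simp add: sum_distrib_right)
    also have "\<dots> = (\<Sum>k\<in>K. L2_inner H (weight_part k f) h)"
      unfolding L2_inner_def using part
      by (intro Bochner_Integration.integral_sum integrable_mult_cnj cpart ch finh) (simp add: Bergman_H_iff)
    also have "\<dots> = 0"
    proof (rule sum.neutral, rule ballI)
      fix k assume "k \<in> K"
      then have "weight_part k h z = 0" if "z \<in> H" for z
        using weight_part_sub_Bergman_eq_zero[OF r h _ that] by (auto simp: K_def)
      then show "L2_inner H (weight_part k f) h = 0"
        by (rule L2_inner_weight_part_eq_zero[OF cf finf ch finh])
    qed
    finally show "L2_inner H (\<lambda>z. f z - g z) h = 0" .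
  qed
  then show ?thesis using that gG by blast
qed

text \<open>An L^p approximable \<open>f\<close> is L^2 approximable, so it lies in the closure and
  is its own projection. Conversely, a fixed \<open>f\<close> lies in the closure and thus has no
  low weights, a property free of the exponent 2 that gives approximability in L^p.\<close>

lemma Lp_approximable_iff_sub_Bergman_proj:
  assumes p: "2 \<le> p" "p \<le> r" and f: "f \<in> Bergman p H"
  shows "Lp_approximable p H (Bergman r H) f \<longleftrightarrow> (\<forall>z\<in>H. sub_Bergman_proj r H f z = f z)"
proof -
  have r: "r \<ge> 2" using p by simp
  have f2: "f \<in> Bergman 2 H" using Bergman_mono[of 2 p] p f by auto
  show ?thesis
  proof
    assume "Lp_approximable p H (Bergman r H) f"
    then have "Lp_approximable 2 H (Bergman r H) f"
      using p f Bergman_mono[of p r] by (intro Lp_approximable_mono[of 2 p f]) auto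
    then have fG: "f \<in> sub_Bergman_space r H" using f2 by (simp add: sub_Bergman_space_def)
    show "\<forall>z\<in>H. sub_Bergman_proj r H f z = f z"
    proof
      fix z assume "z \<in> H"
      then show "sub_Bergman_proj r H f z = f z"
        by (intro sub_Bergman_proj_eqI[OF r f2 fG]) (auto simp: L2_inner_def)
    qed
  next
    assume eq: "\<forall>z\<in>H. sub_Bergman_proj r H f z = f z"
    obtain g where g: "g \<in> sub_Bergman_space r H" "\<And>z. z \<in> H \<Longrightarrow> sub_Bergman_proj r H f z = g z"
      using sub_Bergman_proj_weight_parts[OF r f2] by blast
    have "f \<in> sub_Bergman_space r H"
      using sub_Bergman_space_cong[OF r g(1), of f] g(2) eq by auto
    then show "Lp_approximable p H (Bergman r H) f"
      using weight_part_sub_Bergman_eq_zero[OF r] p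
      by (intro Lp_approximable_of_vanishing_weight_parts[OF f]) auto
  qed
qed

end

theorem proposition4p43:
  fixes m n :: nat and p r :: real and f :: "complex \<times> complex \<Rightarrow> complex"
  assumes "m > 0" and "n > 0" and "gcd m n = 1"
    and "2 \<le> p" and "p < r"
    and "f \<in> Bergman p (Hartogs_triangle (real m / real n))"
  shows "Lp_approximable p (Hartogs_triangle (real m / real n))
           (Bergman r (Hartogs_triangle (real m / real n))) f
         \<longleftrightarrow> (\<forall>z \<in> Hartogs_triangle (real m / real n).
               sub_Bergman_proj r (Hartogs_triangle (real m / real n)) f z = f z)"
proof -
  interpret hartogs m n by unfold_locales (use assms in auto)
  show ?thesis
    using Lp_approximable_iff_sub_Bergman_proj[of p r f] assms by (simp add: H_def)
qed

end
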